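(* There are unique real numbers $r_0, r_1\in(0,\frac13)$ satisfying, respectively, $$-\frac{3 r_0^5+15 r_0^4+6 r_0^3-42 r_0^2+31 r_0-13}{240 (r_0+1)}=-\frac{3 r_0^3-3 r_0^2+r_0-1}{24 (r_0+1)},$$ $$-\frac{3 r_1^5+15 r_1^4+6 r_1^3-42 r_1^2+31 r_1-13}{240 (r_1+1)}=-\frac{3 r_1^7+15 r_1^6+60 r_1^5+66 r_1^4+18 r_1^3-324 r_1^2+283 r_1-121}{2184 (r_1+1)},$$ and, to ten decimal places, $r_0\approx 0.1622776602$ and $r_1\approx 0.2317626315$. Moreover, for every integer $n\ge 2$: (1) if $0<r\le r_0$, then $\beta_n$ is an optimal set of $n$-means for $P$ (for $n\geq 3$: $\beta_n(I)$ is an optimal set of $n$-means for every admissible $I$); (2) if $r_0\le r\le r_1$, then $\gamma_n$ is an optimal set of $n$-means for $P$ (for $n\ge 3$: $\gamma_n(I)$ is an optimal set of $n$-means for every admissible $I$).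
   Context: For $0<r<\frac13$ and $j\in\{1,2,3\}$ let $S_j(x)=rx+\frac{j-1}{2}(1-r)$, $x\in\mathbb R$. Let $P$ be the unique Borel probability measure on $\mathbb R$ with $P=\frac13\sum_{j=1}^3 P\circ S_j^{-1}$, and let $X$ be a random variable with distribution $P$. For a word $\sigma=\sigma_1\cdots\sigma_k\in\{1,2,3\}^k$ put $S_\sigma=S_{\sigma_1}\circ\cdots\circ S_{\sigma_k}$ ($S_\emptyset$ is the identity), $J_\sigma=S_\sigma([0,1])$, $a(\sigma)=S_\sigma(\frac12)$. For words $\sigma,\tau,\dots,\rho$ put $a(\sigma,\tau,\dots,\rho)=E(X\mid X\in J_\sigma\cup J_\tau\cup\cdots\cup J_\rho)$. Strings of digits such as $21$, $22$ denote words. For a finite set $\alpha\subset\mathbb R$ let $V(P;\alpha)=\int\min_{a\in\alpha}(x-a)^2\,dP(x)$, and $V_n=\inf\{V(P;\alpha):\alpha\subset\mathbb R,\ \mathrm{card}(\alpha)\le n\}$. A set $\alpha$ with $\mathrm{card}(\alpha)\le n$ is an optimal set of $n$-means for $P$ if $V(P;\alpha)=V_n$. For $n\ge3$ let $\ell(n)$ be the unique natural number with $3^{\ell(n)}\le n<3^{\ell(n)+1}$. A set $I\subseteq\{1,2,3\}^{\ell(n)}$ is called admissible (for $n$) if $\mathrm{card}(I)=n-3^{\ell(n)}$ when $3^{\ell(n)}\le n\le 2\cdot3^{\ell(n)}$, and $\mathrm{card}(I)=n-2\cdot3^{\ell(n)}$ when $2\cdot3^{\ell(n)}<n<3^{\ell(n)+1}$.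 Let $\beta_2=\{a(1),a(2,3)\}$, $\gamma_2=\{a(1,21),a(22,23,3)\}$, $\beta_3=\gamma_3=\{a(1),a(2),a(3)\}$. For $n\ge3$, admissible $I$, and $\theta\in\{\beta,\gamma\}$, the set $\theta_n=\theta_n(I)$ is $$\theta_n(I)=\{a(\omega):\omega\in\{1,2,3\}^{\ell(n)}\setminus I\}\cup\bigcup_{\omega\in I}S_\omega(\theta_2)\quad\text{if }3^{\ell(n)}\le n\le2\cdot3^{\ell(n)},$$ $$\theta_n(I)=\bigcup_{\omega\in\{1,2,3\}^{\ell(n)}\setminus I}S_\omega(\theta_2)\cup\bigcup_{\omega\in I}S_\omega(\theta_3)\quad\text{if }2\cdot3^{\ell(n)}<n<3^{\ell(n)+1}.$$ *)

theory Defs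
  imports "HOL-Probability.Probability"
begin

definition S :: "real \<Rightarrow> nat \<Rightarrow> real \<Rightarrow> real" where
  "S r j x = r * x + (real j - 1) / 2 * (1 - r)"

definition self_similar_distribution :: "real \<Rightarrow> real measure \<Rightarrow> bool" where
  "self_similar_distribution r P \<longleftrightarrow>
     prob_space P \<and> sets P = sets borel \<and>
     (\<forall>A\<in>sets borel. measure P A = 1 / 3 * (\<Sum>j\<in>{1, 2, 3}. measure P (S r j -` A)))"

definition words :: "nat \<Rightarrow> nat list set" where
  "words k = {w. length w = k \<and> set w \<subseteq> {1, 2, 3}}"

definition S_word :: "real \<Rightarrow> nat list \<Rightarrow> real \<Rightarrow> real" where
  "S_word r w = foldr (\<lambda>j f. S r j \<circ> f) w id"

definition J :: "real \<Rightarrow> nat list \<Rightarrow> real set" where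
  "J r w = S_word r w ` {0..1}"

definition a :: "real \<Rightarrow> nat list \<Rightarrow> real" where
  "a r w = S_word r w (1 / 2)"

(* E(X | X \<in> A) for X with distribution P: uniform_measure P A is the law of X
   conditioned on the event X \<in> A. *)
definition cond_mean :: "real measure \<Rightarrow> real set \<Rightarrow> real" where
  "cond_mean P A = (LINT x|uniform_measure P A. x)"

(* a(\<sigma>, \<tau>, ..., \<rho>), with the words collected in the set W *)
definition a_union :: "real measure \<Rightarrow> real \<Rightarrow> nat list set \<Rightarrow> real" where
  "a_union P r W = cond_mean P (\<Union>w\<in>W. J r w)"

definition V :: "real measure \<Rightarrow> real set \<Rightarrow> real" where
  "V P \<alpha> = (LINT x|P. Min ((\<lambda>c. (x - c)\<^sup>2) ` \<alpha>))"

(* The empty set is excluded because Min {} is unspecified; mathematically its distortion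
   is infinite, so it affects neither the infimum nor the optimal sets. *)
definition candidates :: "nat \<Rightarrow> real set set" where
  "candidates n = {\<alpha>. finite \<alpha> \<and> \<alpha> \<noteq> {} \<and> card \<alpha> \<le> n}"

definition V_inf :: "real measure \<Rightarrow> nat \<Rightarrow> real" where
  "V_inf P n = (INF \<alpha>\<in>candidates n. V P \<alpha>)"

definition optimal_n_means :: "real measure \<Rightarrow> nat \<Rightarrow> real set \<Rightarrow> bool" where
  "optimal_n_means P n \<alpha> \<longleftrightarrow> \<alpha> \<in> candidates n \<and> V P \<alpha> = V_inf P n"

definition ell :: "nat \<Rightarrow> nat" where
  "ell n = (THE l. 3 ^ l \<le> n \<and> n < 3 ^ (l + 1))"

definition admissible :: "nat \<Rightarrow> nat list set \<Rightarrow> bool" where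
  "admissible n I \<longleftrightarrow> I \<subseteq> words (ell n) \<and>
     card I = (if n \<le> 2 * 3 ^ ell n then n - 3 ^ ell n else n - 2 * 3 ^ ell n)"

definition beta2 :: "real measure \<Rightarrow> real \<Rightarrow> real set" where
  "beta2 P r = {a r [1], a_union P r {[2], [3]}}"

definition gamma2 :: "real measure \<Rightarrow> real \<Rightarrow> real set" where
  "gamma2 P r = {a_union P r {[1], [2, 1]}, a_union P r {[2, 2], [2, 3], [3]}}"

definition theta3 :: "real \<Rightarrow> real set" where
  "theta3 r = {a r [1], a r [2], a r [3]}"

(* common construction of \<beta>\<^sub>n(I) and \<gamma>\<^sub>n(I) from the two-point set \<theta>2 and the
   three-point set \<theta>3 *)
definition theta :: "real \<Rightarrow> real set \<Rightarrow> real set \<Rightarrow> nat \<Rightarrow> nat list set \<Rightarrow> real set" where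
  "theta r \<theta>2 \<theta>3 n I =
     (if n \<le> 2 * 3 ^ ell n
      then a r ` (words (ell n) - I) \<union> (\<Union>w\<in>I. S_word r w ` \<theta>2)
      else (\<Union>w\<in>words (ell n) - I. S_word r w ` \<theta>2) \<union> (\<Union>w\<in>I. S_word r w ` \<theta>3))"

definition beta :: "real measure \<Rightarrow> real \<Rightarrow> nat \<Rightarrow> nat list set \<Rightarrow> real set" where
  "beta P r n I = theta r (beta2 P r) (theta3 r) n I"

definition gamma :: "real measure \<Rightarrow> real \<Rightarrow> nat \<Rightarrow> nat list set \<Rightarrow> real set" where
  "gamma P r n I = theta r (gamma2 P r) (theta3 r) n I"

definition r0_equation :: "real \<Rightarrow> bool" where
  "r0_equation r \<longleftrightarrow>
     - ((3 * r^5 + 15 * r^4 + 6 * r^3 - 42 * r^2 + 31 * r - 13) / (240 * (r + 1)))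
   = - ((3 * r^3 - 3 * r^2 + r - 1) / (24 * (r + 1)))"

definition r1_equation :: "real \<Rightarrow> bool" where
  "r1_equation r \<longleftrightarrow>
     - ((3 * r^5 + 15 * r^4 + 6 * r^3 - 42 * r^2 + 31 * r - 13) / (240 * (r + 1)))
   = - ((3 * r^7 + 15 * r^6 + 60 * r^5 + 66 * r^4 + 18 * r^3 - 324 * r^2 + 283 * r - 121)
        / (2184 * (r + 1)))"

end

theory Submission
  imports Defs
begin

text \<open>
  Put \<open>u(t) = P(X \<le> t)\<close> and \<open>M(t) = E((1/2 - X) 1\<^bsub>X \<le> t\<^esub>)\<close>. Two points whose Voronoi cells meet
  at \<open>t\<close> have error at least \<open>Var X - M\<^sup>2 / (u (1 - u))\<close>, and self-similarity gives a recursion for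
  the curve \<open>(u, M)\<close>. For \<open>r \<le> r\<^sub>1\<close> the recursion bounds \<open>M\<^sup>2 / (u (1 - u))\<close> by its value at the cut
  between \<open>J\<^sub>1\<close> and \<open>J\<^sub>2\<close> or at the cut between \<open>J\<^bsub>21\<^esub>\<close> and \<open>J\<^bsub>22\<^esub>\<close>, whichever is larger; the
  two are equal at \<open>r\<^sub>0\<close>. This is the case \<open>n = 2\<close>.

  For larger \<open>n\<close> the optimal error is convex and piecewise linear in \<open>n\<close>, so it suffices to show a
  Lagrangian bound \<open>V(\<alpha>) + \<nu> card \<alpha> \<ge> \<Phi>\<close> for each of its slopes \<open>\<nu>\<close>. Since a cell can also be
  served by points outside it, the bound is shown for \<open>\<alpha>\<close> enlarged, free of charge, by the two
  points at half a gap width from \<open>[0, 1]\<close>. These dominate all points beyond the midpoints of the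
  gaps, so the enlarged bound is inherited from one level of cells to the next finer one. At the
  initial level the points inside a gap are charged to the two neighbouring cells together.\<close>

section \<open>The Lorenz curve\<close>

text \<open>The entries of \<open>gain\<close> are m^2 / (u (1 - u)) at the cuts (1/3, 2/9) and
  (4/9, 2/9 (1 + r/3)). The obstacle is that for r > 1/5 foreign points really help: the point half
  a gap width beyond an end of a cell is nearer to that end than the centre is. So a cell cannot be
  bounded by its own points alone. Most estimates of this help use only m \<le> u (1 - u) and m^2
  \<le> g u (1 - u), with rational constants obtained from r < 0.23177. Up to the factor (r^2/3)^l
  there are two slopes: c^2 g, the drop from one to two points in a cell, and \<open>D3\<close>, the
  drop from two to three. With the enlarging points free of charge, the bound for the first slope is
  false on a single cell when r > 1/5 (take the set {1/2}), so it is started one level deeper. The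
  bound for the second slope does start on a single cell, but its case of two points requires that
  the enlarging points are useless to two means in [0, 1]. This is the most delicate estimate, and
  the one place where the help is again studied through the recursion of the curve.\<close>

definition gain :: "real \<Rightarrow> real" where
  "gain r = max (2 / 9) ((1 + r / 3)\<^sup>2 / 5)"

text \<open>A point \<open>(u, m)\<close> stands for \<open>(u(t), M(t) / width r)\<close>; the three alternatives correspond to \<open>t\<close> lying
  left, in the middle or right. The scaling makes the value at the cut between \<open>J\<^sub>1\<close> and \<open>J\<^sub>2\<close>
  equal to \<open>2 / 9\<close>, independently of \<open>r\<close>.\<close>
definition lorenz_set :: "real \<Rightarrow> (real \<times> real) set \<Rightarrow> bool" where
  "lorenz_set r X \<longleftrightarrow> (\<forall>(u, m)\<in>X. 0 \<le> u \<and> u \<le> 1 \<and> 0 \<le> m \<and> m \<le> u * (1 - u) \<and>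
     (\<exists>(v, k)\<in>X. (u = v / 3 \<and> m = 2 / 9 * v + r / 3 * k) \<or>
        (u = (1 + v) / 3 \<and> m = 2 / 9 + r / 3 * k) \<or>
        (u = (2 + v) / 3 \<and> m = 2 / 9 * (1 - v) + r / 3 * k)))"

lemma lorenz_setD:
  assumes "lorenz_set r X" "(u, m) \<in> X"
  shows "0 \<le> u" "u \<le> 1" "0 \<le> m" "m \<le> u * (1 - u)"
  using assms unfolding lorenz_set_def by fast+

lemma lorenz_set_cases:
  assumes "lorenz_set r X" "(u, m) \<in> X"
  obtains (left) v k where "(v, k) \<in> X" "u = v / 3" "m = 2 / 9 * v + r / 3 * k"
    | (middle) v k where "(v, k) \<in> X" "u = (1 + v) / 3" "m = 2 / 9 + r / 3 * k"
    | (right) v k where "(v, k) \<in> X" "u = (2 + v) / 3" "m = 2 / 9 * (1 - v) + r / 3 * k"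
  using assms unfolding lorenz_set_def by fast

lemma lorenz_set_reflect:
  assumes "lorenz_set r X"
  shows "lorenz_set r ((\<lambda>(u, m). (1 - u, m)) ` X)"
proof -
  have "\<exists>(v', k')\<in>(\<lambda>(u, m). (1 - u, m)) ` X.
      (1 - u = v' / 3 \<and> m = 2 / 9 * v' + r / 3 * k') \<or>
      (1 - u = (1 + v') / 3 \<and> m = 2 / 9 + r / 3 * k') \<or>
      (1 - u = (2 + v') / 3 \<and> m = 2 / 9 * (1 - v') + r / 3 * k')" if "(u, m) \<in> X" for u m
    using assms that
  proof (cases rule: lorenz_set_cases)
    case (left v k)
    then show ?thesis by (intro bexI[of _ "(1 - v, k)"]) (force simp: field_simps)+
  next
    case (middle v k)
    then show ?thesis by (intro bexI[of _ "(1 - v, k)"]) (force simp: field_simps)+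
  next
    case (right v k)
    then show ?thesis by (intro bexI[of _ "(1 - v, k)"]) (force simp: field_simps)+
  qed
  moreover have "0 \<le> u \<and> u \<le> 1 \<and> 0 \<le> m \<and> m \<le> u * (1 - u)" if "(u, m) \<in> X" for u m
    using lorenz_setD[OF assms that] by auto
  ultimately show ?thesis
    unfolding lorenz_set_def by (fastforce simp: algebra_simps)
qed

text \<open>Both sides are compared with their chords over a cell of length \<open>l\<close>: the parabola
  \<open>g u (1 - u)\<close> exceeds its chord by \<open>g l\<^sup>2 v (1 - v)\<close>, which beats the bump
  \<open>\<eta> v (1 - v)\<close> of the self-similar curve.\<close>
lemma gain_bound_on_cell:
  fixes g l u0 m0 m1 \<eta> v k :: real
  assumes v: "0 \<le> v" "v \<le> 1" and k: "0 \<le> k" "k \<le> v * (1 - v)" and "0 \<le> \<eta>" "0 \<le> m0" "m0 \<le> m1"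
    and e0: "m0\<^sup>2 \<le> g * (u0 * (1 - u0))"
    and e1: "m1\<^sup>2 \<le> g * ((u0 + l) * (1 - (u0 + l)))"
    and h: "2 * \<eta> * m1 + \<eta>\<^sup>2 / 4 \<le> g * l\<^sup>2 + (m1 - m0)\<^sup>2"
  shows "((1 - v) * m0 + v * m1 + \<eta> * k)\<^sup>2 \<le> g * ((u0 + v * l) * (1 - (u0 + v * l)))"
proof -
  define w where "w = v * (1 - v)"
  define lin where "lin = (1 - v) * m0 + v * m1"
  have w: "0 \<le> w" "w \<le> 1 / 4"
  proof -
    show "0 \<le> w" using v by (simp add: w_def)
    have "0 \<le> (2 * v - 1)\<^sup>2" by simp
    then show "w \<le> 1 / 4" by (simp add: w_def power2_eq_square algebra_simps)
  qed
  have lin0: "0 \<le> lin" unfolding lin_def using v assms(6,7) by simp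
  have lin1: "lin \<le> m1"
    unfolding lin_def using v mult_left_mono[OF assms(7), of "1 - v"] by (simp add: algebra_simps)
  have "(lin + \<eta> * k)\<^sup>2 \<le> (lin + \<eta> * w)\<^sup>2"
    using lin0 k \<open>0 \<le> \<eta>\<close> by (intro power_mono add_left_mono mult_left_mono) (auto simp: w_def)
  \<comment> \<open>The square of an interpolated value is the interpolated square minus
    \<open>w * (m1 - m0)\<^sup>2\<close>.\<close>
  also have "\<dots> = (1 - v) * m0\<^sup>2 + v * m1\<^sup>2 - w * (m1 - m0)\<^sup>2 + w * (2 * \<eta> * lin + \<eta>\<^sup>2 * w)"
    unfolding lin_def w_def by (simp add: power2_eq_square) algebra
  also have "\<dots> \<le> (1 - v) * (g * (u0 * (1 - u0))) + v * (g * ((u0 + l) * (1 - (u0 + l))))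
      - w * (m1 - m0)\<^sup>2 + w * (g * l\<^sup>2 + (m1 - m0)\<^sup>2)"
  proof -
    have "2 * \<eta> * lin + \<eta>\<^sup>2 * w \<le> 2 * \<eta> * m1 + \<eta>\<^sup>2 * (1 / 4)"
      using lin1 \<open>0 \<le> \<eta>\<close> w by (intro add_mono mult_left_mono) auto
    with h have "2 * \<eta> * lin + \<eta>\<^sup>2 * w \<le> g * l\<^sup>2 + (m1 - m0)\<^sup>2" by simp
    then have "w * (2 * \<eta> * lin + \<eta>\<^sup>2 * w) \<le> w * (g * l\<^sup>2 + (m1 - m0)\<^sup>2)"
      using w by (intro mult_left_mono) auto
    moreover have "(1 - v) * m0\<^sup>2 \<le> (1 - v) * (g * (u0 * (1 - u0)))"
      using v e0 by (intro mult_left_mono) auto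
    moreover have "v * m1\<^sup>2 \<le> v * (g * ((u0 + l) * (1 - (u0 + l))))"
      using v e1 by (intro mult_left_mono) auto
    ultimately show ?thesis by linarith
  qed
  also have "\<dots> = g * ((u0 + v * l) * (1 - (u0 + v * l)))"
    unfolding w_def by (simp add: power2_eq_square) algebra
  finally show ?thesis unfolding lin_def .
qed

text \<open>\<open>r_le_r1\<close> is r \<le> r1 in polynomial form (see \<open>crit1_poly\<close>):
  it says that m^2 / (u (1 - u)) is no larger at the cut u = 13/27 than at u = 4/9.\<close>

locale ratio =
  fixes r :: real
  assumes r_pos: "0 < r"
    and r_le_r1: "10 * (9 + 3 * r + r\<^sup>2)\<^sup>2 \<le> 91 * (3 + r)\<^sup>2"
begin

lemma r_less: "r < 23177 / 100000"
proof (rule ccontr)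
  assume "\<not> ?thesis"
  then have r: "23177 / 100000 \<le> r" by simp
  \<comment> \<open>This is r^2 - e r - 3 e with e slightly above sqrt (91/10) - 3; the factor
    10055402333/10000000000 below is (3 + e) / 3, truncated.\<close>
  have "0 < r\<^sup>2 - (166207/10000000) * r - 498621/10000000"
  proof -
    have "0 \<le> (r - 23177 / 100000) * (r + 23177 / 100000 - 166207/10000000)"
      using r by (intro mult_nonneg_nonneg) auto
    also have "\<dots> = r\<^sup>2 - (166207/10000000) * r
        - 23177 / 100000 * (23177 / 100000 - 166207/10000000)"
      by (simp add: power2_eq_square field_simps)
    finally show ?thesis by simp
  qed
  then have "10055402333/10000000000 * (9 + 3 * r) * 1 < 9 + 3 * r + r\<^sup>2" using r_pos by simp
  then have "(10055402333/10000000000 * (9 + 3 * r))\<^sup>2 < (9 + 3 * r + r\<^sup>2)\<^sup>2"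
    using r_pos by (intro power_strict_mono) auto
  moreover have "91 / 10 * (3 + r)\<^sup>2 \<le> (10055402333/10000000000 * (9 + 3 * r))\<^sup>2"
  proof -
    have "(10055402333/10000000000 * (9 + 3 * r))\<^sup>2 = (10055402333/10000000000)\<^sup>2 * 9 * (3 + r)\<^sup>2"
      by (simp add: power2_eq_square algebra_simps)
    moreover have "91 / 10 \<le> (10055402333/10000000000)\<^sup>2 * (9::real)" by (simp add: power2_eq_square)
    moreover have "91 / 10 * (3 + r)\<^sup>2 \<le> (10055402333/10000000000)\<^sup>2 * 9 * (3 + r)\<^sup>2"
      using calculation(2) by (intro mult_right_mono) auto
    ultimately show ?thesis by simp
  qed
  ultimately show False using r_le_r1 by simp
qed

lemma gain_bounds: "2 / 9 \<le> gain r" "(1 + r / 3)\<^sup>2 / 5 \<le> gain r" "gain r \<le> 1 / 4"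
proof -
  have "(1 + r / 3)\<^sup>2 \<le> (1 + 1 / 10)\<^sup>2" using r_pos r_less by (intro power_mono) auto
  then have "(1 + r / 3)\<^sup>2 / 5 \<le> 1 / 4" by (simp add: power_divide)
  then show "2 / 9 \<le> gain r" "(1 + r / 3)\<^sup>2 / 5 \<le> gain r" "gain r \<le> 1 / 4"
    unfolding gain_def by linarith+
qed

lemma r_sq: "0 < r\<^sup>2" "r\<^sup>2 < 53718 / 1000000" and r_cube: "r ^ 3 < 12451 / 1000000" "0 < r ^ 3"
proof -
  show "0 < r\<^sup>2" "0 < r ^ 3" using r_pos by auto
  have "r\<^sup>2 < (23177 / 100000)\<^sup>2" using r_pos r_less by (intro power_strict_mono) auto
  then show "r\<^sup>2 < 53718 / 1000000" by (simp add: power_divide)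
  have "r ^ 3 < (23177 / 100000) ^ 3" using r_pos r_less by (intro power_strict_mono) auto
  then show "r ^ 3 < 12451 / 1000000" by (simp add: power_divide)
qed

lemma gain_end1: "(2 / 9)\<^sup>2 \<le> gain r * (1 / 3 * (1 - 1 / 3))"
  using gain_bounds(1) by (simp add: power2_eq_square)

lemma gain_end2: "(2 / 9 * (1 + r / 3))\<^sup>2 \<le> gain r * (4 / 9 * (1 - 4 / 9))"
proof -
  have "(2 / 9 * (1 + r / 3))\<^sup>2 = (1 + r / 3)\<^sup>2 / 5 * (20 / 81)"
    by (simp add: power2_eq_square field_simps)
  then show ?thesis using gain_bounds(2) by simp
qed

text \<open>At \<open>r = r\<^sub>1\<close> the cut between \<open>J\<^bsub>21\<^esub>\<close> and \<open>J\<^bsub>22\<^esub>\<close> and the cut between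
  \<open>J\<^bsub>221\<^esub>\<close> and \<open>J\<^bsub>222\<^esub>\<close> are equally good; this is the only tight use of \<open>r \<le> r\<^sub>1\<close>.\<close>
lemma gain_end3: "(2 / 9 * (1 + r / 3 + r\<^sup>2 / 9))\<^sup>2 \<le> gain r * (13 / 27 * (1 - 13 / 27))"
proof -
  have "(2 / 9 * (1 + r / 3 + r\<^sup>2 / 9))\<^sup>2 = 4 / 6561 * (9 + 3 * r + r\<^sup>2)\<^sup>2"
    by (simp add: power2_eq_square algebra_simps)
  also have "\<dots> \<le> 4 / 6561 * (91 / 10 * (3 + r)\<^sup>2)" using r_le_r1 by simp
  also have "\<dots> = (1 + r / 3)\<^sup>2 / 5 * (13 / 27 * (1 - 13 / 27))"
    by (simp add: power2_eq_square algebra_simps)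
  also have "\<dots> \<le> gain r * (13 / 27 * (1 - 13 / 27))"
    using gain_bounds(2) by (intro mult_right_mono) auto
  finally show ?thesis .
qed

text \<open>For u \<le> 1/3 the parabola suffices, since u (1 - u) \<le> 2/9 there. The rest is
  covered by the cells between 1/3, 4/9, 13/27 and 14/27, where \<open>gain_bound_on_cell\<close>
  reduces the claim to the ends. The cell [4/9, 5/9] is subdivided because at r1 the bound is
  attained inside it, at 13/27.\<close>

lemma lorenz_set_gain_half:
  assumes X: "lorenz_set r X" and um: "(u, m) \<in> X" and "u \<le> 1 / 2"
  shows "m\<^sup>2 \<le> gain r * (u * (1 - u))"
  using X um
proof (cases rule: lorenz_set_cases)
  case (left v k)
  have u: "0 \<le> u" "u \<le> 1 / 3" using lorenz_setD[OF X left(1)] left by auto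
  have "u * (1 - u) \<le> 2 / 9"
  proof -
    have "0 \<le> (1 / 3 - u) * (2 / 3 - u)" using u by (intro mult_nonneg_nonneg) auto
    also have "\<dots> = 2 / 9 - u * (1 - u)" by (simp add: field_simps)
    finally show ?thesis by simp
  qed
  then have *: "u * (1 - u) \<le> gain r" using gain_bounds by simp
  have "m\<^sup>2 \<le> (u * (1 - u))\<^sup>2"
    using lorenz_setD[OF X um] by (intro power_mono) auto
  also have "\<dots> \<le> gain r * (u * (1 - u))"
    unfolding power2_eq_square using * u by (intro mult_right_mono) auto
  finally show ?thesis .
next
  case (right v k)
  then show ?thesis using lorenz_setD[OF X right(1)] assms by simp
next
  case (middle v k)
  note vk = lorenz_setD[OF X middle(1)]
  from X middle(1) show ?thesis
  proof (cases rule: lorenz_set_cases)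
    case (left w k2)
    note wk = lorenz_setD[OF X left(1)]
    have "((1 - w) * (2 / 9) + w * (2 / 9 * (1 + r / 3)) + r\<^sup>2 / 9 * k2)\<^sup>2
        \<le> gain r * ((1 / 3 + w * (1 / 9)) * (1 - (1 / 3 + w * (1 / 9))))"
    proof (rule gain_bound_on_cell)
      have "r * r\<^sup>2 \<le> 23177 / 100000 * r\<^sup>2" using r_less r_sq by (intro mult_right_mono) auto
      moreover have "r\<^sup>2 * r\<^sup>2 \<le> 53718 / 1000000 * r\<^sup>2" using r_sq by (intro mult_right_mono) auto
      moreover have "2 * (r\<^sup>2 / 9) * (2 / 9 * (1 + r / 3)) + (r\<^sup>2 / 9)\<^sup>2 / 4
          = 4 / 81 * r\<^sup>2 + 4 / 243 * (r * r\<^sup>2) + (r\<^sup>2 * r\<^sup>2) / 324"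
        by (simp add: power2_eq_square field_simps)
      moreover have "(2 * r / 27)\<^sup>2 = 4 / 729 * r\<^sup>2" by (simp add: power_mult_distrib power_divide)
      ultimately have "2 * (r\<^sup>2 / 9) * (2 / 9 * (1 + r / 3)) + (r\<^sup>2 / 9)\<^sup>2 / 4
          \<le> 2 / 9 / 81 + (2 * r / 27)\<^sup>2"
        using r_sq by linarith
      moreover have "(2 / 9 * (1 + r / 3) - 2 / 9)\<^sup>2 = (2 * r / 27)\<^sup>2"
        by (simp add: power2_eq_square algebra_simps)
      ultimately show "2 * (r\<^sup>2 / 9) * (2 / 9 * (1 + r / 3)) + (r\<^sup>2 / 9)\<^sup>2 / 4
          \<le> gain r * (1 / 9)\<^sup>2 + (2 / 9 * (1 + r / 3) - 2 / 9)\<^sup>2"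
        using gain_bounds(1) by (simp add: power2_eq_square)
    qed (use wk r_pos gain_end1 gain_end2 in auto)
    moreover have "u = 1 / 3 + w * (1 / 9)"
      unfolding middle(2) left(2) by (simp add: field_simps)
    moreover have "m = (1 - w) * (2 / 9) + w * (2 / 9 * (1 + r / 3)) + r\<^sup>2 / 9 * k2"
      unfolding middle(3) left(3) by (simp add: field_simps power2_eq_square)
    ultimately show ?thesis by simp
  next
    case (right w k2)
    then show ?thesis using lorenz_setD[OF X right(1)] middle assms by simp
  next
    case inner: (middle w k2)
    note wk = lorenz_setD[OF X inner(1)]
    have small: "2 * (r ^ 3 / 27) * (2 / 9 * (1 + r / 3 + r\<^sup>2 / 9)) + (r ^ 3 / 27)\<^sup>2 / 4
        \<le> gain r * (1 / 27)\<^sup>2"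
    proof -
      have "2 * (r ^ 3 / 27) * (2 / 9 * (1 + r / 3 + r\<^sup>2 / 9)) \<le> 2 * (r ^ 3 / 27) * (2 / 9 * (109 / 100))"
        using r_cube r_sq r_less by (intro mult_left_mono) auto
      moreover have "r ^ 3 / 27 * (r ^ 3 / 27) \<le> r ^ 3 / 27 * (4 / 1000)"
        using r_cube by (intro mult_left_mono) auto
      then have "(r ^ 3 / 27)\<^sup>2 / 4 \<le> r ^ 3 / 27 * (1 / 1000)"
        unfolding power2_eq_square by linarith
      ultimately have "2 * (r ^ 3 / 27) * (2 / 9 * (1 + r / 3 + r\<^sup>2 / 9)) + (r ^ 3 / 27)\<^sup>2 / 4 \<le> 2 / 9 / 729"
        using r_cube by linarith
      also have "\<dots> \<le> gain r * (1 / 27)\<^sup>2" using gain_bounds(1) by (simp add: power2_eq_square)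
      finally show ?thesis .
    qed
    from X inner(1) show ?thesis
    proof (cases rule: lorenz_set_cases)
      case (left s k3)
      note sk = lorenz_setD[OF X left(1)]
      have "((1 - s) * (2 / 9 * (1 + r / 3)) + s * (2 / 9 * (1 + r / 3 + r\<^sup>2 / 9)) + r ^ 3 / 27 * k3)\<^sup>2
          \<le> gain r * ((4 / 9 + s * (1 / 27)) * (1 - (4 / 9 + s * (1 / 27))))"
      proof (rule gain_bound_on_cell)
        show "2 * (r ^ 3 / 27) * (2 / 9 * (1 + r / 3 + r\<^sup>2 / 9)) + (r ^ 3 / 27)\<^sup>2 / 4
          \<le> gain r * (1 / 27)\<^sup>2 + (2 / 9 * (1 + r / 3 + r\<^sup>2 / 9) - 2 / 9 * (1 + r / 3))\<^sup>2"
          using small by (simp add: add_increasing2)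
      qed (use sk r_pos gain_end2 gain_end3 in auto)
      moreover have "u = 4 / 9 + s * (1 / 27)"
        unfolding middle(2) inner(2) left(2) by (simp add: field_simps)
      moreover have "m = (1 - s) * (2 / 9 * (1 + r / 3)) + s * (2 / 9 * (1 + r / 3 + r\<^sup>2 / 9))
          + r ^ 3 / 27 * k3"
        unfolding middle(3) inner(3) left(3) by (simp add: field_simps power2_eq_square power3_eq_cube)
      ultimately show ?thesis by simp
    next
      case (right s k3)
      have False
        using lorenz_setD(1)[OF X right(1)] right(2) inner(2) middle(2) assms(3) by argo
      then show ?thesis ..
    next
      case deepest: (middle s k3)
      note sk = lorenz_setD[OF X deepest(1)]
      have "((1 - s) * (2 / 9 * (1 + r / 3 + r\<^sup>2 / 9)) + s * (2 / 9 * (1 + r / 3 + r\<^sup>2 / 9)) + r ^ 3 / 27 * k3)\<^sup>2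
          \<le> gain r * ((13 / 27 + s * (1 / 27)) * (1 - (13 / 27 + s * (1 / 27))))"
        by (rule gain_bound_on_cell) (use sk r_pos gain_end3 small in auto)
      moreover have "u = 13 / 27 + s * (1 / 27)"
        unfolding middle(2) inner(2) deepest(2) by (simp add: field_simps)
      moreover have "m = (1 - s) * (2 / 9 * (1 + r / 3 + r\<^sup>2 / 9))
          + s * (2 / 9 * (1 + r / 3 + r\<^sup>2 / 9)) + r ^ 3 / 27 * k3"
        unfolding middle(3) inner(3) deepest(3) by (simp add: field_simps power2_eq_square power3_eq_cube)
      ultimately show ?thesis by simp
    qed
  qed
qed

lemma lorenz_set_gain:
  assumes X: "lorenz_set r X" and um: "(u, m) \<in> X"
  shows "m\<^sup>2 \<le> gain r * (u * (1 - u))"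
proof (cases "u \<le> 1 / 2")
  case True
  then show ?thesis using lorenz_set_gain_half[OF X um] by simp
next
  case False
  have "(1 - u, m) \<in> (\<lambda>(u, m). (1 - u, m)) ` X" using um by force
  from lorenz_set_gain_half[OF lorenz_set_reflect[OF X] this] False
  show ?thesis by (simp add: mult.commute)
qed

end

section \<open>Gains from external points\<close>

text \<open>Of a point on the curve only these inequalities are kept, so that the suprema below
  depend on g and the position alone. All of them are symmetric under p -> 1 - p, so left and right
  need not be distinguished.\<close>

definition curve_point :: "real \<Rightarrow> real \<Rightarrow> real \<Rightarrow> bool" where
  "curve_point g p m \<longleftrightarrow> 0 \<le> p \<and> p \<le> 1 \<and> 0 \<le> m \<and> m \<le> p * (1 - p) \<and> m\<^sup>2 \<le> g * (p * (1 - p))"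

text \<open>In coordinates centred at the mean with unit \<open>width r\<close>, this is the drop
  below the error of one mean when mass p is served by z and the rest by b; see
  \<open>V_pair_gain\<close>.\<close>

definition pair_gain :: "real \<Rightarrow> real \<Rightarrow> real \<Rightarrow> real \<Rightarrow> real" where
  "pair_gain p m b z = 2 * (z - b) * m - p * z\<^sup>2 - (1 - p) * b\<^sup>2"

text \<open>The largest possible reduction of the one-point error caused by an additional point at
  distance \<open>z\<close> from the centre, when the first point may be moved freely.\<close>
definition ext_gain :: "real \<Rightarrow> real \<Rightarrow> real" where
  "ext_gain g z = Sup {pair_gain p m b z |p m b. curve_point g p m}"

lemma curve_point_reflect: "curve_point g p m \<Longrightarrow> curve_point g (1 - p) m"
  by (simp add: curve_point_def mult.commute)

text \<open>The best b is -m / (1 - p), the mean of the mass it serves; the square that remains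
  compares z with \<mu> = m / p, the mean of the other part. The main term m^2 / (p (1 - p)) is at
  most g and at most p (1 - p).\<close>

lemma pair_gain_le:
  assumes cp: "curve_point g p m" and "0 < p" "0 \<le> g"
  obtains \<mu> where "0 \<le> \<mu>" "\<mu> \<le> 1 - p" "pair_gain p m b z \<le> g - p * (z - \<mu>)\<^sup>2"
    "pair_gain p m b z \<le> p * (1 - p) - p * (z - \<mu>)\<^sup>2"
proof (cases "p = 1")
  case True
  have "m = 0" using True cp by (auto simp: curve_point_def)
  then show ?thesis by (intro that[of 0]) (use True \<open>0 \<le> g\<close> in \<open>auto simp: pair_gain_def\<close>)
next
  case False
  define n where "n = 1 - p"
  define \<mu> where "\<mu> = m / p"
  have n: "0 < n" using False cp by (simp add: n_def curve_point_def)
  have m: "m = \<mu> * p" "0 \<le> m" "m \<le> p * n" "m\<^sup>2 \<le> g * (p * n)"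
    using cp \<open>0 < p\<close> by (auto simp: curve_point_def \<mu>_def n_def)
  have "0 \<le> \<mu>" "\<mu> \<le> n" using m(2,3) \<open>0 < p\<close> by (auto simp: \<mu>_def field_simps)
  have "0 \<le> (n * b + m)\<^sup>2" by simp
  then have "n * (- n * b\<^sup>2 - 2 * b * m) \<le> m\<^sup>2" by (simp add: power2_eq_square algebra_simps)
  then have "- n * b\<^sup>2 - 2 * b * m \<le> m\<^sup>2 / n"
    using n by (simp add: pos_le_divide_eq mult.commute)
  moreover have "m\<^sup>2 / n = p * \<mu>\<^sup>2 * (p / n)" unfolding m(1) by (simp add: power2_eq_square)
  moreover have "p * \<mu>\<^sup>2 * (p / n) + p * \<mu>\<^sup>2 = m\<^sup>2 / (p * n)"
    unfolding m(1) using n \<open>0 < p\<close> by (simp add: power2_eq_square n_def field_simps)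
  moreover have "pair_gain p m b z = - n * b\<^sup>2 - 2 * b * m + p * \<mu>\<^sup>2 - p * (z - \<mu>)\<^sup>2"
    unfolding pair_gain_def m(1) n_def by (simp add: power2_eq_square algebra_simps)
  ultimately have *: "pair_gain p m b z \<le> m\<^sup>2 / (p * n) - p * (z - \<mu>)\<^sup>2" by linarith
  have "m\<^sup>2 / (p * n) \<le> g" using m(4) n \<open>0 < p\<close> by (simp add: pos_divide_le_eq)
  moreover have "m\<^sup>2 \<le> (p * n)\<^sup>2" using m by (intro power_mono) auto
  then have "m\<^sup>2 / (p * n) \<le> p * n" using n \<open>0 < p\<close> by (simp add: pos_divide_le_eq power2_eq_square)
  ultimately show ?thesis
    using * \<open>0 \<le> \<mu>\<close> \<open>\<mu> \<le> n\<close> that[of \<mu>] unfolding n_def by linarith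
qed

lemma pair_gain_0:
  assumes "curve_point g 0 m"
  shows "pair_gain 0 m b z \<le> 0"
  using assms by (simp add: curve_point_def pair_gain_def)

lemma pair_gain_le_gain:
  assumes cp: "curve_point g p m" and "0 \<le> g"
  shows "pair_gain p m b z \<le> g"
proof (cases "p = 0")
  case True
  then show ?thesis using pair_gain_0[of g m b z] cp \<open>0 \<le> g\<close> by simp
next
  case False
  then have p: "0 < p" using cp by (simp add: curve_point_def)
  obtain \<mu> where "pair_gain p m b z \<le> g - p * (z - \<mu>)\<^sup>2"
    using pair_gain_le[OF cp p \<open>0 \<le> g\<close>] by metis
  moreover have "0 \<le> p * (z - \<mu>)\<^sup>2" using p by simp
  ultimately show ?thesis by linarith
qed

lemma ext_gain_upper:
  assumes "curve_point g p m" "0 \<le> g"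
  shows "pair_gain p m b z \<le> ext_gain g z"
  unfolding ext_gain_def
proof (rule cSup_upper)
  show "bdd_above {pair_gain p m b z |p m b. curve_point g p m}"
    using pair_gain_le_gain[OF _ assms(2)] by (auto intro!: bdd_aboveI[of _ g])
qed (use assms in auto)

lemma ext_gain_least:
  assumes "\<And>p m b. curve_point g p m \<Longrightarrow> pair_gain p m b z \<le> B"
  shows "ext_gain g z \<le> B"
  unfolding ext_gain_def
proof (rule cSup_least)
  have "curve_point g 0 0" by (simp add: curve_point_def)
  then show "{pair_gain p m b z |p m b. curve_point g p m} \<noteq> {}" by blast
qed (use assms in auto)

lemma ext_gain_le_gain: "0 \<le> g \<Longrightarrow> ext_gain g z \<le> g"
  by (intro ext_gain_least pair_gain_le_gain)

text \<open>Only m \<le> p (1 - p) enters. At m = p (1 - p) the best b is -p, and completing the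
  square in z gives the bound.\<close>

lemma pair_gain_le_quadratic:
  assumes cp: "curve_point g p m" and "0 \<le> z" "0 \<le> g"
  shows "pair_gain p m b z \<le> p * ((1 - p) - (z - (1 - p))\<^sup>2)"
proof (cases "p = 0")
  case True
  then show ?thesis using pair_gain_0 cp by force
next
  case False
  then have p: "0 < p" using cp by (simp add: curve_point_def)
  define n where "n = 1 - p"
  have m: "0 \<le> n" "0 \<le> m" "m \<le> p * n"
    using cp by (auto simp: curve_point_def n_def)
  obtain \<nu> where \<nu>: "m = \<nu> * n" "0 \<le> \<nu>" "\<nu> \<le> p"
  proof (cases "n = 0")
    case True
    then show ?thesis using m p by (intro that[of 0]) auto
  next
    case False
    then have "0 < n" using m by simp
    then show ?thesis using m by (intro that[of "m / n"]) (auto simp: field_simps)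
  qed
  have "0 \<le> n * (b + \<nu>)\<^sup>2" using m by simp
  moreover have "n * \<nu>\<^sup>2 \<le> n * p\<^sup>2" using \<nu> m by (intro mult_left_mono power_mono) auto
  moreover have "z * m \<le> z * (p * n)" using m \<open>0 \<le> z\<close> by (intro mult_left_mono) auto
  moreover have "n * (b + \<nu>)\<^sup>2 = n * b\<^sup>2 + 2 * b * m + n * \<nu>\<^sup>2"
    unfolding \<nu>(1) by (simp add: power2_eq_square algebra_simps)
  moreover have "pair_gain p m b z = 2 * (z * m) - 2 * b * m - p * z\<^sup>2 - n * b\<^sup>2"
    unfolding pair_gain_def n_def by (simp add: power2_eq_square algebra_simps)
  ultimately have "pair_gain p m b z \<le> n * p\<^sup>2 + 2 * (z * (p * n)) - p * z\<^sup>2" by linarith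
  also have "\<dots> = p * ((1 - p) - (z - (1 - p))\<^sup>2)"
    unfolding n_def by (simp add: power2_eq_square algebra_simps)
  finally show ?thesis .
qed

lemma ext_gain_far:
  assumes "2 \<le> z" "0 \<le> g"
  shows "ext_gain g z \<le> 0"
proof (rule ext_gain_least)
  fix p m b assume cp: "curve_point g p m"
  then have p: "0 \<le> p" "p \<le> 1" by (auto simp: curve_point_def)
  have "1 \<le> (z - (1 - p))\<^sup>2" using p assms by (simp add: one_le_power)
  then have "(1 - p) - (z - (1 - p))\<^sup>2 \<le> 0" using p by linarith
  then have "p * ((1 - p) - (z - (1 - p))\<^sup>2) \<le> 0" using p by (simp add: mult_nonneg_nonpos)
  then show "pair_gain p m b z \<le> 0" using pair_gain_le_quadratic[OF cp, of z b] assms by linarith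
qed

text \<open>For 1 \<le> z < 2 and e = 2 - z the quadratic bound is at most p (E - p F), whose
  maximum over p is E^2 / (4 F); then (2 - e)^2 \<le> 4 F / 3 for e in [0, 1].\<close>

lemma ext_gain_le_square:
  assumes "0 \<le> z" "0 \<le> g" "g \<le> 1 / 4"
  shows "ext_gain g z \<le> (max 0 (2 - z))\<^sup>2 / 3"
proof -
  consider "2 \<le> z" | "z < 2" "1 \<le> z" | "z < 1" by linarith
  then show ?thesis
  proof cases
    case 1
    then show ?thesis using ext_gain_far[OF 1 assms(2)] by simp
  next
    case 3
    then have "1\<^sup>2 \<le> (2 - z)\<^sup>2" by (intro power_mono) auto
    moreover have "ext_gain g z \<le> 1 / 3" using ext_gain_le_gain[OF assms(2), of z] assms(3) by linarith
    moreover have "max 0 (2 - z) = 2 - z" using 3 by simp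
    ultimately show ?thesis by simp
  next
    case 2
    define e where "e = 2 - z"
    have e: "0 < e" "e \<le> 1" using 2 by (auto simp: e_def)
    have "ext_gain g z \<le> e\<^sup>2 / 3"
    proof (rule ext_gain_least)
      fix p m b assume cp: "curve_point g p m"
      define E F where "E = e * (2 - e)" and "F = 3 - 2 * e"
      have F: "0 < F" using e by (simp add: F_def)
      have p: "0 \<le> p" using cp by (simp add: curve_point_def)
      have "pair_gain p m b z \<le> p * ((1 - p) - (z - (1 - p))\<^sup>2)"
        by (rule pair_gain_le_quadratic[OF cp assms(1,2)])
      also have "\<dots> = p * (E - p * F) - p * p\<^sup>2"
        unfolding E_def F_def e_def by (simp add: power2_eq_square algebra_simps)
      finally have 1: "pair_gain p m b z \<le> p * (E - p * F)" using p by (smt (verit) zero_le_mult_iff zero_le_power2)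
      have "0 \<le> (E - 2 * F * p)\<^sup>2" by simp
      then have "4 * F * (p * (E - p * F)) \<le> E\<^sup>2" by (simp add: power2_eq_square algebra_simps)
      also have "\<dots> = e\<^sup>2 * (2 - e)\<^sup>2" by (simp add: E_def power_mult_distrib)
      also have "\<dots> \<le> e\<^sup>2 * (4 * F / 3)"
      proof (intro mult_left_mono)
        have "e * e \<le> e * 1" using e by (intro mult_left_mono) auto
        then show "(2 - e)\<^sup>2 \<le> 4 * F / 3" using e by (simp add: F_def power2_eq_square algebra_simps)
      qed simp
      also have "\<dots> = 4 * F * (e\<^sup>2 / 3)" by simp
      finally have "p * (E - p * F) \<le> e\<^sup>2 / 3" using F by (simp only: mult_le_cancel_left_pos)
      with 1 show "pair_gain p m b z \<le> e\<^sup>2 / 3" by linarith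
    qed
    then show ?thesis using e by (simp add: e_def)
  qed
qed

text \<open>p q / (p + q) is the minimum of p x^2 + q y^2 for x + y = 1, and 7/8 + p + q is what
  23/8 leaves when the two served means are at most 1 - p and 1 - q. For q \<le> 2/9 the bound 2/9
  is split into 4/81 and 14/81; otherwise the subtracted term outweighs p (1 - p) by itself.\<close>

lemma crossing_inequality:
  fixes p q :: real
  assumes "0 < p" "p \<le> q" "q \<le> 1"
  shows "p * (1 - p) + min g (q * (1 - q)) - p * q / (p + q) * (7 / 8 + p + q)\<^sup>2 \<le> max g (2 / 9)"
proof (cases "q \<le> 2 / 9")
  case True
  have "p / 2 * (7 / 8 + 2 * p)\<^sup>2 \<le> p * q / (p + q) * (7 / 8 + p + q)\<^sup>2"
    using assms by (intro mult_mono power_mono) (auto simp: field_simps)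
  moreover have "0 \<le> (2 / 9 - q) * (7 / 9 - q)" using True by (intro mult_nonneg_nonneg) auto
  then have "q * (1 - q) \<le> 14 / 81" by (simp add: field_simps)
  moreover have "p * (1 - p) - p / 2 * (7 / 8 + 2 * p)\<^sup>2 \<le> 4 / 81"
  proof -
    have "0 \<le> p * (2 * p\<^sup>2)" using assms by simp
    moreover have "0 \<le> 11 / 4 * (p - 79 / 704)\<^sup>2" by simp
    ultimately show ?thesis by (simp add: power2_eq_square field_simps)
  qed
  ultimately show ?thesis by linarith
next
  case False
  have c1: "- (3 / 10) \<le> 11 / 4 * q + 2 * q\<^sup>2 - 1"
  proof -
    have "2 / 9 * (2 / 9) \<le> q * q" using False by (intro mult_mono) auto
    then show ?thesis using False by (simp add: power2_eq_square)
  qed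
  have c2: "45 / 1000 \<le> q * (7 / 4 * q - 15 / 64 + q\<^sup>2)"
  proof -
    have "2 / 9 * (2 / 9) \<le> q * q" using False by (intro mult_mono) auto
    then have "45 / 1000 * (9 / 2) \<le> 7 / 4 * q - 15 / 64 + q\<^sup>2" using False by (simp add: power2_eq_square)
    then have "2 / 9 * (45 / 1000 * (9 / 2)) \<le> q * (7 / 4 * q - 15 / 64 + q\<^sup>2)"
      using False by (intro mult_mono) auto
    then show ?thesis by simp
  qed
  have "p * (- (3 / 10)) \<le> p * (11 / 4 * q + 2 * q\<^sup>2 - 1)" using c1 assms by (intro mult_left_mono) auto
  moreover have "0 \<le> (p - 3 / 20)\<^sup>2" by simp
  moreover have "0 \<le> q * p\<^sup>2" using assms by simp
  ultimately have "0 \<le> p\<^sup>2 * (1 + q) + p * (11 / 4 * q + 2 * q\<^sup>2 - 1) + q * (7 / 4 * q - 15 / 64 + q\<^sup>2)"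
    using c2 by (simp add: power2_eq_square algebra_simps)
  then have "(1 - p) * (p + q) \<le> q * (7 / 8 + p + q)\<^sup>2"
    by (simp add: power2_eq_square field_simps)
  then have "p * ((1 - p) * (p + q)) \<le> p * (q * (7 / 8 + p + q)\<^sup>2)"
    using assms by (intro mult_left_mono) auto
  then have "p * (1 - p) \<le> p * q / (p + q) * (7 / 8 + p + q)\<^sup>2"
    using assms by (simp add: pos_le_divide_eq mult.assoc)
  then show ?thesis by linarith
qed

text \<open>A point in the gap between two neighbouring cells cannot save more than a point that
  belongs to one of them: the sum of the two distances to the cell centres is \<open>\<rho>\<close>.\<close>
lemma pair_gain_crossing:
  assumes cp: "curve_point g p m" "curve_point g q k" and g: "2 / 9 \<le> g" and \<rho>: "23 / 8 \<le> \<rho>"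
    and "p \<le> q"
  shows "pair_gain p m b z + pair_gain q k b' (\<rho> - z) \<le> g"
proof (cases "p = 0")
  case True
  then show ?thesis
    using pair_gain_0[of g m b z] pair_gain_le_gain[OF cp(2), of b' "\<rho> - z"] cp(1) g by simp
next
  case False
  then have p: "0 < p" "0 < q" "q \<le> 1" using cp \<open>p \<le> q\<close> by (auto simp: curve_point_def)
  have g0: "0 \<le> g" using g by simp
  obtain \<mu> where \<mu>: "0 \<le> \<mu>" "\<mu> \<le> 1 - p" "pair_gain p m b z \<le> p * (1 - p) - p * (z - \<mu>)\<^sup>2"
    using pair_gain_le[OF cp(1) p(1) g0] by metis
  obtain \<nu> where \<nu>: "0 \<le> \<nu>" "\<nu> \<le> 1 - q" "pair_gain q k b' (\<rho> - z) \<le> g - q * (\<rho> - z - \<nu>)\<^sup>2"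
    "pair_gain q k b' (\<rho> - z) \<le> q * (1 - q) - q * (\<rho> - z - \<nu>)\<^sup>2"
    using pair_gain_le[OF cp(2) p(2) g0] by metis
  define x y where "x = z - \<mu>" and "y = \<rho> - z - \<nu>"
  have xy: "7 / 8 + p + q \<le> x + y" using \<mu> \<nu> \<rho> by (simp add: x_def y_def)
  have "0 \<le> (p * x - q * y)\<^sup>2" by simp
  then have "p * q * (x + y)\<^sup>2 \<le> (p + q) * (p * x\<^sup>2 + q * y\<^sup>2)"
    by (simp add: power2_eq_square algebra_simps)
  then have "p * q / (p + q) * (x + y)\<^sup>2 \<le> p * x\<^sup>2 + q * y\<^sup>2"
    using p by (simp add: pos_divide_le_eq mult.commute)
  moreover have "p * q / (p + q) * (7 / 8 + p + q)\<^sup>2 \<le> p * q / (p + q) * (x + y)\<^sup>2"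
    using p xy by (intro mult_left_mono power_mono) auto
  moreover have "p * (1 - p) + min g (q * (1 - q)) - p * q / (p + q) * (7 / 8 + p + q)\<^sup>2 \<le> max g (2 / 9)"
    using crossing_inequality p \<open>p \<le> q\<close> by blast
  moreover have "max g (2 / 9) = g" using g by simp
  ultimately show ?thesis using \<mu>(3) \<nu>(3,4) unfolding x_def y_def by linarith
qed

text \<open>The suprema are taken one after the other. The order p \<le> q is no restriction, since
  exchanging the cells exchanges z and \<rho> - z.\<close>

lemma ext_gain_crossing:
  assumes g: "2 / 9 \<le> g" and \<rho>: "23 / 8 \<le> \<rho>"
  shows "ext_gain g z + ext_gain g (\<rho> - z) \<le> g"
proof -
  have "ext_gain g z \<le> g - pair_gain q k b' (\<rho> - z)" if "curve_point g q k" for q k b'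
  proof (rule ext_gain_least)
    fix p m b assume cp: "curve_point g p m"
    show "pair_gain p m b z \<le> g - pair_gain q k b' (\<rho> - z)"
    proof (cases "p \<le> q")
      case True
      then show ?thesis using pair_gain_crossing[OF cp that g \<rho> True, of b z b'] by linarith
    next
      case False
      then show ?thesis using pair_gain_crossing[OF that cp g \<rho>, of b' "\<rho> - z" b] by simp
    qed
  qed
  then have "ext_gain g (\<rho> - z) \<le> g - ext_gain g z"
    by (intro ext_gain_least) (simp add: algebra_simps)
  then show ?thesis by simp
qed

text \<open>For a cell with one point and both points of \<open>E\<close>: one side is charged at
  its worst, the other as if the point were in the centre (b = 0). 23/16 is half of 23/8, and 4/27 =
  2 * 2/9 - 8/27 is the slack available in \<open>penalized_base2\<close>.\<close>

lemma ext_gain_half_gap: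
  assumes z: "23 / 16 \<le> z" and "0 \<le> g" "curve_point g p m"
  shows "ext_gain g z + pair_gain p m 0 z \<le> 4 / 27"
proof -
  define E where "E = z * (2 - z)"
  have E: "E \<le> 207 / 256"
  proof -
    have "0 \<le> (z - 23 / 16) * (z - 9 / 16)" using z by (intro mult_nonneg_nonneg) auto
    then show ?thesis by (simp add: E_def field_simps)
  qed
  have "ext_gain g z \<le> 8719 / 100000"
  proof (rule ext_gain_least)
    fix p m b assume cp: "curve_point g p m"
    have p: "0 \<le> p" using cp by (simp add: curve_point_def)
    have "pair_gain p m b z \<le> p * ((1 - p) - (z - (1 - p))\<^sup>2)"
      using z assms by (intro pair_gain_le_quadratic[OF cp]) auto
    also have "\<dots> = p * (E - p * (2 * z - 1) - p\<^sup>2)"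
      unfolding E_def by (simp add: power2_eq_square algebra_simps)
    also have "\<dots> \<le> p * (207 / 256 - p * (15 / 8))"
    proof (intro mult_left_mono p)
      have "p * (15 / 8) \<le> p * (2 * z - 1)" using p z by (intro mult_left_mono) auto
      then show "E - p * (2 * z - 1) - p\<^sup>2 \<le> 207 / 256 - p * (15 / 8)" using E by (smt (verit) zero_le_power2)
    qed
    also have "\<dots> \<le> 8719 / 100000"
    proof -
      have "0 \<le> 15 / 8 * (p - 207 / 960)\<^sup>2" by simp
      then show ?thesis by (simp add: power2_eq_square field_simps)
    qed
    finally show "pair_gain p m b z \<le> 8719 / 100000" .
  qed
  moreover have "pair_gain p m 0 z \<le> 5687 / 100000"
  proof -
    have p: "0 \<le> p" "m \<le> p * (1 - p)" using assms(3) by (auto simp: curve_point_def)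
    have "2 * z * m \<le> 2 * z * (p * (1 - p))" using p z by (intro mult_left_mono) auto
    then have "pair_gain p m 0 z \<le> 2 * z * (p * (1 - p)) - p * z\<^sup>2" by (simp add: pair_gain_def)
    also have "\<dots> = p * (E - p * (2 * z))"
      unfolding E_def by (simp add: power2_eq_square algebra_simps)
    also have "\<dots> \<le> p * (207 / 256 - p * (23 / 8))"
    proof (intro mult_left_mono p)
      have "p * (23 / 8) \<le> p * (2 * z)" using p z by (intro mult_left_mono) auto
      then show "E - p * (2 * z) \<le> 207 / 256 - p * (23 / 8)" using E by simp
    qed
    also have "\<dots> \<le> 5687 / 100000"
    proof -
      have "0 \<le> 23 / 8 * (p - 207 / 1472)\<^sup>2" by simp
      then show ?thesis by (simp add: power2_eq_square field_simps)
    qed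
    finally show ?thesis .
  qed
  ultimately show ?thesis by linarith
qed

text \<open>The income of a cell without own points from a point in an adjacent gap, which is shared
  with the cell on the other side of the gap.\<close>
definition gap_share :: "real \<Rightarrow> real \<Rightarrow> real \<Rightarrow> real" where
  "gap_share g \<rho> z = (if z < \<rho> / 2 then g - ext_gain g (\<rho> - z) else 0)"

text \<open>The right-hand sides are the excess over the variance, in squared units of
  \<open>width r\<close>, of a cell served only by two external points at distances x and x + d. Put
  m = p (1 - p) and minimise 2 p^2 - (2 - d) p; for d \<ge> 2 this is nonnegative.\<close>

lemma two_ext_lower:
  fixes p m x d :: real
  assumes "0 \<le> p" "m \<le> p * (1 - p)" "0 \<le> x" "0 \<le> d"
  shows "x\<^sup>2 - (2 * x + d) * (2 - d)\<^sup>2 / 8 \<le> p * (x + d)\<^sup>2 + (1 - p) * x\<^sup>2 - 2 * m * (x + (x + d))"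
    and "2 \<le> d \<Longrightarrow> x\<^sup>2 \<le> p * (x + d)\<^sup>2 + (1 - p) * x\<^sup>2 - 2 * m * (x + (x + d))"
proof -
  define T where "T = 2 * x + d"
  have T: "0 \<le> T" using assms by (simp add: T_def)
  have "2 * m * T \<le> 2 * (p * (1 - p)) * T" using T assms(2) by (intro mult_right_mono) auto
  moreover have "p * (x + d)\<^sup>2 + (1 - p) * x\<^sup>2 = x\<^sup>2 + T * (p * d)"
    unfolding T_def by (simp add: power2_eq_square algebra_simps)
  moreover have "x + (x + d) = T" by (simp add: T_def)
  ultimately have *: "x\<^sup>2 + T * (2 * p\<^sup>2 - (2 - d) * p)
      \<le> p * (x + d)\<^sup>2 + (1 - p) * x\<^sup>2 - 2 * m * (x + (x + d))"
    by (simp add: power2_eq_square algebra_simps)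
  have "0 \<le> (4 * p - (2 - d))\<^sup>2" by simp
  then have "- ((2 - d)\<^sup>2 / 8) \<le> 2 * p\<^sup>2 - (2 - d) * p" by (simp add: power2_eq_square field_simps)
  then have "T * - ((2 - d)\<^sup>2 / 8) \<le> T * (2 * p\<^sup>2 - (2 - d) * p)" using T by (rule mult_left_mono)
  then show "x\<^sup>2 - (2 * x + d) * (2 - d)\<^sup>2 / 8 \<le> p * (x + d)\<^sup>2 + (1 - p) * x\<^sup>2 - 2 * m * (x + (x + d))"
    using * unfolding T_def by (simp add: algebra_simps)
  show "x\<^sup>2 \<le> p * (x + d)\<^sup>2 + (1 - p) * x\<^sup>2 - 2 * m * (x + (x + d))" if "2 \<le> d"
  proof -
    have "(2 - d) * p \<le> 0" using that assms(1) by (simp add: mult_nonpos_nonneg)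
    then have "0 \<le> 2 * p\<^sup>2 - (2 - d) * p" by (smt (verit) zero_le_power2)
    then have "0 \<le> T * (2 * p\<^sup>2 - (2 - d) * p)" using T by simp
    then show ?thesis using * by linarith
  qed
qed

lemma two_minus_square_le: "0 \<le> d \<Longrightarrow> d \<le> 2 \<Longrightarrow> (2 - d)\<^sup>2 \<le> 2 * (2 - d)" for d :: real
  using mult_right_mono[of "2 - d" 2 "2 - d"] by (simp add: power2_eq_square)

text \<open>An empty cell avoids the price g of one point; its excess error and its income from both
  gaps must make up for that. Only points in the nearer half of a gap bring income, hence the cases.
  2/3 is a lower bound for the half length of a cell in units of \<open>width r\<close>.\<close>

lemma two_ext_gap_share_aux:
  assumes p: "0 \<le> p" "m \<le> p * (1 - p)" and x: "2 / 3 \<le> x" and d: "0 \<le> d"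
    and g: "2 / 9 \<le> g" "g \<le> 1 / 4" and \<rho>: "23 / 8 \<le> \<rho>"
  shows "g - gap_share g \<rho> x - gap_share g \<rho> (x + d)
    \<le> p * (x + d)\<^sup>2 + (1 - p) * x\<^sup>2 - 2 * m * (x + (x + d))" (is "_ \<le> ?v")
proof -
  define s where "s = x - 2 / 3"
  have s: "0 \<le> s" "x = 2 / 3 + s" using x by (auto simp: s_def)
  have lower: "x\<^sup>2 - (2 * x + d) * (2 - d)\<^sup>2 / 8 \<le> ?v" "2 \<le> d \<Longrightarrow> x\<^sup>2 \<le> ?v"
    using two_ext_lower[OF p, of x d] x d by auto
  have sq: "ext_gain g (\<rho> - z) \<le> (z - 2 / 3)\<^sup>2 / 3" if "2 / 3 \<le> z" "z < \<rho> / 2" for z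
  proof -
    have "ext_gain g (\<rho> - z) \<le> (max 0 (2 - (\<rho> - z)))\<^sup>2 / 3"
      using that g \<rho> by (intro ext_gain_le_square) auto
    also have "\<dots> \<le> (z - 2 / 3)\<^sup>2 / 3"
      using that \<rho> by (intro divide_right_mono power_mono) auto
    finally show ?thesis .
  qed
  have v: "x\<^sup>2 - (2 * x + d) * (2 - d)\<^sup>2 / 8
      = 4 / 9 + 4 / 3 * s + s\<^sup>2 - (4 / 3 + 2 * s + d) * (2 - d)\<^sup>2 / 8"
    unfolding s(2) by (simp add: power2_eq_square algebra_simps)
  have small: "(s\<^sup>2) / 3 \<le> x\<^sup>2"
    unfolding s(2) using s(1) by (simp add: power2_eq_square algebra_simps)
  consider "x + d < \<rho> / 2" "d \<le> 1" | "x + d < \<rho> / 2" "1 < d" | "x < \<rho> / 2" "\<rho> / 2 \<le> x + d" | "\<rho> / 2 \<le> x"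
    by linarith
  then show ?thesis
  proof cases
    case 1
    have d2: "d\<^sup>2 \<le> d" "d ^ 3 \<le> d"
      using d 1 power_le_one[of d 1] by (auto simp: power2_eq_square power3_eq_cube mult_le_one intro: mult_left_le mult_left_le_one_le)
    have "0 \<le> s * (1 / 3 + d / 3 - d\<^sup>2 / 4)" using s d d2 1 by (intro mult_nonneg_nonneg) auto
    moreover have "0 \<le> d / 6 - d ^ 3 / 8" using d d2 by simp
    moreover have "0 \<le> s\<^sup>2 / 3" by simp
    moreover have "x\<^sup>2 - (2 * x + d) * (2 - d)\<^sup>2 / 8 + 2 / 9
        = s\<^sup>2 / 3 + (s + d)\<^sup>2 / 3 + s\<^sup>2 / 3 + s * (1 / 3 + d / 3 - d\<^sup>2 / 4) + (d / 6 - d ^ 3 / 8)"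
      unfolding v by (simp add: power2_eq_square power3_eq_cube field_simps)
    ultimately have "s\<^sup>2 / 3 + (s + d)\<^sup>2 / 3 \<le> x\<^sup>2 - (2 * x + d) * (2 - d)\<^sup>2 / 8 + 2 / 9"
      by linarith
    moreover have "ext_gain g (\<rho> - x) \<le> s\<^sup>2 / 3" "ext_gain g (\<rho> - (x + d)) \<le> (s + d)\<^sup>2 / 3"
      using sq[of x] sq[of "x + d"] x d 1 by (auto simp: s_def algebra_simps)
    ultimately show ?thesis using lower(1) g 1 d by (simp add: gap_share_def)
  next
    case 2
    have "ext_gain g (\<rho> - x) \<le> s\<^sup>2 / 3" using sq[of x] x 2 d by (auto simp: s_def)
    moreover have "ext_gain g (\<rho> - (x + d)) \<le> g" using g by (intro ext_gain_le_gain) auto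
    moreover have "s\<^sup>2 / 3 \<le> ?v"
    proof (cases "2 \<le> d")
      case True
      then show ?thesis using lower(2) small by linarith
    next
      case False
      have "(4 / 3 + 2 * s + d) * (2 - d)\<^sup>2 \<le> (4 / 3 + 2 * s + 1) * 1"
      proof -
        define t where "t = d - 1"
        have t: "0 < t" "t < 1" using False 2 by (auto simp: t_def)
        define K where "K = 4 / 3 + 2 * s + 1"
        have K: "1 \<le> K" using s by (simp add: K_def)
        have "(4 / 3 + 2 * s + d) * (2 - d)\<^sup>2 = K * (1 - t)\<^sup>2 + t * (1 - t)\<^sup>2"
          unfolding t_def K_def by (simp add: power2_eq_square algebra_simps)
        also have "K * (1 - t)\<^sup>2 \<le> K * (1 - t)"
          using t K by (intro mult_left_mono) (auto simp: power2_eq_square mult_left_le)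
        also have "t * (1 - t)\<^sup>2 \<le> t * K"
          using t K power_le_one[of "1 - t" 2] by (intro mult_left_mono) auto
        also have "K * (1 - t) + t * K = K * 1" by (simp add: algebra_simps)
        finally show ?thesis by (simp add: K_def)
      qed
      then have "4 / 9 + 4 / 3 * s + s\<^sup>2 - (4 / 3 + 2 * s + 1) / 8
          \<le> 4 / 9 + 4 / 3 * s + s\<^sup>2 - (4 / 3 + 2 * s + d) * (2 - d)\<^sup>2 / 8"
        by (intro diff_left_mono divide_right_mono) auto
      also have "\<dots> \<le> ?v" using lower(1) unfolding v .
      finally have "4 / 9 + 4 / 3 * s + s\<^sup>2 - (4 / 3 + 2 * s + 1) / 8 \<le> ?v" .
      moreover have "s\<^sup>2 / 3 \<le> 4 / 9 + 4 / 3 * s + s\<^sup>2 - (4 / 3 + 2 * s + 1) / 8"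
        using s by (simp add: field_simps)
      ultimately show ?thesis by linarith
    qed
    ultimately show ?thesis using 2 d by (simp add: gap_share_def)
  next
    case 3
    have "ext_gain g (\<rho> - x) \<le> s\<^sup>2 / 3" using sq[of x] x 3 by (auto simp: s_def)
    moreover have "s\<^sup>2 / 3 \<le> ?v"
    proof -
      consider "2 \<le> d" | "d < 2" "23 / 16 \<le> x" | "d < 2" "x < 23 / 16" by linarith
      then show ?thesis
      proof cases
        case 1
        then show ?thesis using lower(2) small by linarith
      next
        case 2
        have "(2 * x + d) * (2 - d)\<^sup>2 \<le> 8 * x"
        proof -
          have "(2 * x + d) * (2 - d)\<^sup>2 \<le> (2 * x + d) * (2 * (2 - d))"
            using 2 d x two_minus_square_le by (intro mult_left_mono) auto
          also have "\<dots> = 8 * x - 4 * d * (x - 1) - 2 * d\<^sup>2" by (simp add: power2_eq_square algebra_simps)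
          also have "\<dots> \<le> 8 * x"
            using 2 d mult_nonneg_nonneg[of "4 * d" "x - 1"] zero_le_power2[of d] by linarith
          finally show ?thesis .
        qed
        then have "x\<^sup>2 - x \<le> ?v" using lower(1) by linarith
        moreover have "s\<^sup>2 / 3 \<le> x\<^sup>2 - x"
        proof -
          have "0 \<le> (x - 23 / 16) * (x - 1 / 16)" using 2 by (intro mult_nonneg_nonneg) auto
          then show ?thesis using 2 unfolding s_def by (simp add: power2_eq_square field_simps)
        qed
        ultimately show ?thesis by linarith
      next
        case 3
        \<comment> \<open>The second point lies in the farther half of its gap, so d \<ge> e. The
          lower bound increases with d, and at d = e only a polynomial in s is left.\<close>
        define e where "e = 23 / 16 - x"
        have e: "0 < e" "e \<le> d" using 3 \<open>\<rho> / 2 \<le> x + d\<close> \<rho> by (auto simp: e_def)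
        have mono: "(2 * x + d) * (2 - d)\<^sup>2 \<le> (2 * x + e) * (2 - e)\<^sup>2"
        proof -
          have "(2 - d)\<^sup>2 \<le> (2 - d) * (2 - e)" unfolding power2_eq_square
            using e 3 by (intro mult_left_mono) auto
          then have "(2 * x + d) * (2 - d)\<^sup>2 \<le> (2 * x + d) * ((2 - d) * (2 - e))"
            using x d by (intro mult_left_mono) auto
          also have "\<dots> = ((2 * x + d) * (2 - d)) * (2 - e)" by simp
          also have "\<dots> \<le> ((2 * x + e) * (2 - e)) * (2 - e)"
          proof (intro mult_right_mono)
            have "0 \<le> (d - e) * (2 * x + d + e - 2)" using e x 3(2) by (intro mult_nonneg_nonneg) (auto simp: e_def)
            then show "(2 * x + d) * (2 - d) \<le> (2 * x + e) * (2 - e)" by (simp add: algebra_simps)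
          qed (use e 3 in auto)
          finally show ?thesis by (simp add: power2_eq_square mult.assoc)
        qed
        have s1: "s < 4 / 5" using 3 by (simp add: s_def)
        have "s\<^sup>2 / 3 \<le> x\<^sup>2 - (2 * x + e) * (2 - e)\<^sup>2 / 8"
        proof -
          have eq: "x\<^sup>2 - (2 * x + e) * (2 - e)\<^sup>2 / 8 - s\<^sup>2 / 3
              = 41635 / 884736 + 3059 / 6144 * s + 37 / 384 * s\<^sup>2 - s ^ 3 / 8"
            unfolding e_def s(2) by (simp add: power2_eq_square power3_eq_cube field_simps)
          have "s ^ 3 \<le> s\<^sup>2" "0 \<le> s\<^sup>2" "s\<^sup>2 \<le> s"
            using s s1 by (auto simp: power2_eq_square power3_eq_cube mult_left_le)
          then have "0 \<le> x\<^sup>2 - (2 * x + e) * (2 - e)\<^sup>2 / 8 - s\<^sup>2 / 3"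
            unfolding eq using s(1) by linarith
          then show ?thesis by simp
        qed
        then show ?thesis using mono lower(1) by linarith
      qed
    qed
    ultimately show ?thesis using 3 by (simp add: gap_share_def)
  next
    case 4
    have "1 / 4 \<le> ?v"
    proof (cases "2 \<le> d")
      case True
      have "1 / 2 * (1 / 2) \<le> x * x" using x by (intro mult_mono) auto
      then show ?thesis using lower(2)[OF True] by (simp add: power2_eq_square)
    next
      case False
      have "(2 * x + d) * (2 - d)\<^sup>2 \<le> (2 * x + d) * (2 * (2 - d))"
        using False d x two_minus_square_le by (intro mult_left_mono) auto
      also have "\<dots> = 8 * x - 4 * d * (x - 1) - 2 * d\<^sup>2" by (simp add: power2_eq_square algebra_simps)
      also have "\<dots> \<le> 8 * x"
        using 4 \<rho> d mult_nonneg_nonneg[of "4 * d" "x - 1"] zero_le_power2[of d] by linarith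
      finally have "x\<^sup>2 - x \<le> ?v" using lower(1) by linarith
      moreover have "23 / 16 * (7 / 16) \<le> x * (x - 1)" using 4 \<rho> by (intro mult_mono) auto
      ultimately show ?thesis by (simp add: power2_eq_square algebra_simps)
    qed
    then show ?thesis using g 4 d by (simp add: gap_share_def)
  qed
qed

lemma two_ext_gap_share:
  assumes p: "0 \<le> p" "p \<le> 1" "m \<le> p * (1 - p)" and z: "2 / 3 \<le> zL" "2 / 3 \<le> zR"
    and g: "2 / 9 \<le> g" "g \<le> 1 / 4" and \<rho>: "23 / 8 \<le> \<rho>"
  shows "g - gap_share g \<rho> zL - gap_share g \<rho> zR
    \<le> p * zL\<^sup>2 + (1 - p) * zR\<^sup>2 - 2 * m * (zL + zR)"
proof (cases "zR \<le> zL")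
  case True
  then show ?thesis
    using two_ext_gap_share_aux[OF p(1) p(3) z(2) _ g \<rho>, of "zL - zR"] by (simp add: add.commute)
next
  case False
  then show ?thesis
    using two_ext_gap_share_aux[of "1 - p" m zL "zR - zL" g \<rho>] p z g \<rho>
    by (simp add: algebra_simps)
qed

section \<open>Self-similar measures\<close>

locale self_similar =
  fixes r :: real and P :: "real measure"
  assumes r0: "0 < r" and r3: "r < 1 / 3"
    and ssd: "self_similar_distribution r P"
begin

sublocale prob_space P
  using ssd by (simp add: self_similar_distribution_def)

lemma sets_P [measurable_cong, simp]: "sets P = sets borel"
  using ssd by (simp add: self_similar_distribution_def)

lemma space_P [simp]: "space P = UNIV"
  using sets_eq_imp_space_eq[OF sets_P] by simp

lemma borel_measurable_P: "borel_measurable P = borel_measurable borel"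
  by (rule measurable_cong_sets[OF sets_P refl])

lemma prob_UNIV [simp]: "measure P UNIV = 1"
  using prob_space by simp

lemma measurable_S [measurable]: "S r j \<in> borel_measurable borel"
  unfolding S_def by measurable

lemma measure_self_similar:
  assumes "A \<in> sets borel"
  shows "measure P A = 1 / 3 * (\<Sum>j\<in>{1, 2, 3}. measure P (S r j -` A))"
  using ssd assms unfolding self_similar_distribution_def by blast

lemma nn_integral_self_similar:
  assumes "f \<in> borel_measurable borel"
  shows "(\<integral>\<^sup>+x. f x \<partial>P) = ennreal (1 / 3) * (\<Sum>j\<in>{1, 2, 3}. \<integral>\<^sup>+x. f (S r j x) \<partial>P)"
  using assms
proof (induction rule: borel_measurable_induct)
  case (cong f g)
  then have "f = g" by auto
  with cong show ?case by simp
next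
  case (set A)
  then have vim: "S r j -` A \<in> sets borel" for j
    using measurable_sets[OF measurable_S, of A j] by simp
  have "(\<integral>\<^sup>+x. indicator A (S r j x) \<partial>P) = emeasure P (S r j -` A)" for j
  proof -
    have "(\<integral>\<^sup>+x. indicator A (S r j x) \<partial>P) = (\<integral>\<^sup>+x. indicator (S r j -` A) x \<partial>P)"
      by (intro nn_integral_cong) (simp add: indicator_def)
    also have "\<dots> = emeasure P (S r j -` A)" using vim by (intro nn_integral_indicator) simp
    finally show ?thesis .
  qed
  moreover have "emeasure P A = ennreal (1 / 3) * (\<Sum>j\<in>{1, 2, 3}. emeasure P (S r j -` A))"
    using set measure_self_similar[of A]
    by (simp add: emeasure_eq_measure flip: ennreal_plus ennreal_mult)
  ultimately show ?case using set by simp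
next
  case (mult u c)
  then show ?case by (simp add: nn_integral_cmult sum_distrib_left mult_ac distrib_left)
next
  case (add u v)
  then show ?case by (simp add: nn_integral_add distrib_left add_ac)
next
  case (seq U)
  have inc: "incseq (\<lambda>i. \<integral>\<^sup>+x. U i (S r j x) \<partial>P)" for j
    using \<open>incseq U\<close> by (auto simp: incseq_def le_fun_def intro!: nn_integral_mono)
  have "(\<integral>\<^sup>+x. (SUP i. U i) x \<partial>P) = (\<integral>\<^sup>+x. (SUP i. U i x) \<partial>P)"
    by (simp add: image_image SUP_apply)
  also have "\<dots> = (SUP i. \<integral>\<^sup>+x. U i x \<partial>P)"
    using seq(1) \<open>incseq U\<close> by (intro nn_integral_monotone_convergence_SUP) auto
  also have "\<dots> = (SUP i. ennreal (1 / 3) * (\<Sum>j\<in>{1, 2, 3}. \<integral>\<^sup>+x. U i (S r j x) \<partial>P))"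
    using seq.IH by simp
  also have "\<dots> = ennreal (1 / 3) * (SUP i. \<Sum>j\<in>{1, 2, 3}. \<integral>\<^sup>+x. U i (S r j x) \<partial>P)"
    by (simp only: SUP_mult_left_ennreal)
  also have "(SUP i. \<Sum>j\<in>{1, 2, 3}. \<integral>\<^sup>+x. U i (S r j x) \<partial>P)
      = (\<Sum>j\<in>{1, 2, 3}. SUP i. \<integral>\<^sup>+x. U i (S r j x) \<partial>P)"
    by (rule ennreal_SUP_sum) (use inc in auto)
  also have "\<dots> = (\<Sum>j\<in>{1, 2, 3}. \<integral>\<^sup>+x. (SUP i. U i (S r j x)) \<partial>P)"
  proof (intro sum.cong refl)
    fix j
    show "(SUP i. \<integral>\<^sup>+x. U i (S r j x) \<partial>P) = (\<integral>\<^sup>+x. (SUP i. U i (S r j x)) \<partial>P)"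
      using seq(1) \<open>incseq U\<close> by (intro nn_integral_monotone_convergence_SUP[symmetric]) (auto simp: incseq_def le_fun_def)
  qed
  also have "\<dots> = (\<Sum>j\<in>{1, 2, 3}. \<integral>\<^sup>+x. (SUP i. U i) (S r j x) \<partial>P)"
    by (simp add: image_image SUP_apply)
  finally show ?case .
qed

text \<open>Self-similarity makes the measures of the \<open>A n\<close> increase along a sequence
  that decreases to 0.\<close>

lemma measure_tail_eq_0:
  assumes A: "\<And>n. A n \<in> sets borel" and dec: "decseq A" and empty: "(\<Inter>n. A n) = {}"
    and pre: "\<And>n j. j \<in> {1, 2, 3} \<Longrightarrow> S r j -` A n \<subseteq> A (Suc n)"
  shows "measure P (A 0) = 0"
proof -
  have step: "measure P (A n) \<le> measure P (A (Suc n))" for n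
  proof -
    have "measure P (S r j -` A n) \<le> measure P (A (Suc n))" if "j \<in> {1, 2, 3}" for j
      using pre[OF that] A by (intro finite_measure_mono) auto
    then have "(\<Sum>j\<in>{1, 2, 3::nat}. measure P (S r j -` A n)) \<le> (\<Sum>j\<in>{1, 2, 3::nat}. measure P (A (Suc n)))"
      by (intro sum_mono) auto
    then show ?thesis using measure_self_similar[OF A[of n]] by simp
  qed
  have "measure P (A 0) \<le> measure P (A n)" for n
  proof (induction n)
    case (Suc n)
    then show ?case using step[of n] by linarith
  qed simp
  moreover have "(\<lambda>n. measure P (A n)) \<longlonglongrightarrow> measure P (\<Inter>n. A n)"
    using A dec by (intro finite_Lim_measure_decseq) auto
  then have "(\<lambda>n. measure P (A n)) \<longlonglongrightarrow> 0" by (simp add: empty)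
  ultimately have "measure P (A 0) \<le> 0"
    by (intro LIMSEQ_le_const) auto
  then show ?thesis using measure_nonneg[of P "A 0"] by linarith
qed

lemma three_power_unbounded:
  assumes "0 < e"
  shows "\<exists>n. (x::real) < e * 3 ^ n"
proof -
  obtain n where "x / e < 3 ^ n" using real_arch_pow[of 3 "x / e"] by auto
  then show ?thesis using assms by (auto simp: divide_less_eq mult.commute)
qed

text \<open>Pulling back under \<open>S r j\<close> multiplies the excess of a point over [0, 1] by
  at least 1 / r > 3, which is why the tails start at distance e * 3^n.\<close>

lemma AE_support: "AE x in P. x \<in> {0..1}"
proof -
  have up: "AE x in P. x \<le> 1 + e" if "0 < e" for e
  proof -
    have "measure P {x. 1 + e * 3 ^ 0 < x} = 0"
    proof (rule measure_tail_eq_0[where A = "\<lambda>n. {x. 1 + e * 3 ^ n < x}"])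
      show "decseq (\<lambda>n. {x. 1 + e * 3 ^ n < x})"
        unfolding decseq_def
      proof (intro allI impI subsetI)
        fix m n :: nat and x assume "m \<le> n" "x \<in> {x. 1 + e * 3 ^ n < x}"
        moreover have "e * 3 ^ m \<le> e * 3 ^ n"
          using \<open>m \<le> n\<close> that by (intro mult_left_mono power_increasing) auto
        ultimately show "x \<in> {x. 1 + e * 3 ^ m < x}" by simp
      qed
      have "\<exists>n. \<not> 1 + e * 3 ^ n < x" for x
      proof -
        obtain n where "x < e * 3 ^ n" using three_power_unbounded[OF \<open>0 < e\<close>] by blast
        then show ?thesis by (intro exI[of _ n]) linarith
      qed
      then show "(\<Inter>n. {x. 1 + e * 3 ^ n < x}) = {}" by blast
      show "S r j -` {x. 1 + e * 3 ^ n < x} \<subseteq> {x. 1 + e * 3 ^ Suc n < x}" if "j \<in> {1, 2, 3}" for n j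
      proof
        fix x assume "x \<in> S r j -` {x. 1 + e * 3 ^ n < x}"
        then have *: "1 + e * 3 ^ n < S r j x" by simp
        have "S r j x \<le> r * x + (1 - r)"
          using that r0 r3 by (auto simp: S_def)
        with * have "e * 3 ^ n < r * (x - 1)" by (simp add: algebra_simps)
        moreover have "0 < e * 3 ^ n" using \<open>0 < e\<close> by simp
        ultimately have "0 < x - 1" using r0 by (smt (verit) mult_nonneg_nonpos)
        then have "r * (x - 1) \<le> 1 / 3 * (x - 1)" using r3 by (intro mult_right_mono) auto
        with \<open>e * 3 ^ n < r * (x - 1)\<close> show "x \<in> {x. 1 + e * 3 ^ Suc n < x}" by simp
      qed
    qed auto
    then have "{x. 1 + e < x} \<in> null_sets P" by (intro null_setsI) (auto simp: emeasure_eq_measure)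
    from AE_not_in[OF this] show ?thesis by (simp add: not_less)
  qed
  have low: "AE x in P. - e \<le> x" if "0 < e" for e
  proof -
    have "measure P {x. x < - (e * 3 ^ 0)} = 0"
    proof (rule measure_tail_eq_0[where A = "\<lambda>n. {x. x < - (e * 3 ^ n)}"])
      show "decseq (\<lambda>n. {x. x < - (e * 3 ^ n)})"
        unfolding decseq_def
      proof (intro allI impI subsetI)
        fix m n :: nat and x assume "m \<le> n" "x \<in> {x. x < - (e * 3 ^ n)}"
        moreover have "e * 3 ^ m \<le> e * 3 ^ n"
          using \<open>m \<le> n\<close> that by (intro mult_left_mono power_increasing) auto
        ultimately show "x \<in> {x. x < - (e * 3 ^ m)}" by simp
      qed
      show "(\<Inter>n. {x. x < - (e * 3 ^ n)}) = {}"
      proof -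
        have "\<exists>n. \<not> x < - (e * 3 ^ n)" for x
        proof -
          obtain n where "- x < e * 3 ^ n" using three_power_unbounded[OF \<open>0 < e\<close>] by blast
          then show ?thesis by (intro exI[of _ n]) linarith
        qed
        then show ?thesis by blast
      qed
      show "S r j -` {x. x < - (e * 3 ^ n)} \<subseteq> {x. x < - (e * 3 ^ Suc n)}" if "j \<in> {1, 2, 3}" for n j
      proof
        fix x assume "x \<in> S r j -` {x. x < - (e * 3 ^ n)}"
        then have *: "S r j x < - (e * 3 ^ n)" by simp
        have "r * x \<le> S r j x" using that r0 r3 by (auto simp: S_def)
        with * have "e * 3 ^ n < r * (- x)" by simp
        moreover have "0 < e * 3 ^ n" using \<open>0 < e\<close> by simp
        ultimately have "0 < - x" using r0 by (smt (verit) mult_nonneg_nonpos)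
        then have "r * (- x) \<le> 1 / 3 * (- x)" using r3 by (intro mult_right_mono) auto
        with \<open>e * 3 ^ n < r * (- x)\<close> show "x \<in> {x. x < - (e * 3 ^ Suc n)}" by simp
      qed
    qed auto
    then have "{x. x < - e} \<in> null_sets P" by (intro null_setsI) (auto simp: emeasure_eq_measure)
    from AE_not_in[OF this] show ?thesis by (simp add: not_less)
  qed
  have "AE x in P. \<forall>n::nat. - inverse (real (Suc n)) \<le> x \<and> x \<le> 1 + inverse (real (Suc n))"
    unfolding AE_all_countable using up low by (auto intro!: AE_conjI simp del: of_nat_Suc)
  then show ?thesis
  proof eventually_elim
    case (elim x)
    have "0 \<le> x"
    proof (rule ccontr)
      assume "\<not> 0 \<le> x"
      then obtain n where "inverse (real (Suc n)) < - x" using reals_Archimedean[of "- x"] by auto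
      then show False using elim[rule_format, of n] by linarith
    qed
    moreover have "x \<le> 1"
    proof (rule ccontr)
      assume "\<not> x \<le> 1"
      then obtain n where "inverse (real (Suc n)) < x - 1" using reals_Archimedean[of "x - 1"] by auto
      then show False using elim[rule_format, of n] by linarith
    qed
    ultimately show ?case by simp
  qed
qed

lemma S_unit_interval:
  assumes "j \<in> {1, 2, 3}" "x \<in> {0..1}"
  shows "S r j x \<in> {0..1}"
proof -
  define y where "y = r * x"
  have "0 \<le> y" "y \<le> r" using assms r0 by (auto simp: y_def mult_left_le)
  moreover have "S r j x = y + (real j - 1) / 2 * (1 - r)" by (simp add: S_def y_def)
  ultimately show ?thesis using assms(1) r0 r3 by (auto simp: field_simps)
qed

lemma integrable_bounded_on:
  fixes f :: "real \<Rightarrow> real"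
  assumes [measurable]: "f \<in> borel_measurable borel" and "\<And>x. x \<in> {0..1} \<Longrightarrow> \<bar>f x\<bar> \<le> B"
  shows "integrable P f"
proof (rule integrable_const_bound[where B = B])
  show "AE x in P. norm (f x) \<le> B"
    using AE_support by eventually_elim (use assms(2) in auto)
  show "f \<in> borel_measurable P" unfolding borel_measurable_P by (rule assms(1))
qed

lemma integral_self_similar:
  fixes f :: "real \<Rightarrow> real"
  assumes f [measurable]: "f \<in> borel_measurable borel" and bd: "\<And>x. x \<in> {0..1} \<Longrightarrow> \<bar>f x\<bar> \<le> B"
  shows "(LINT x|P. f x) = ((LINT x|P. f (S r 1 x)) + (LINT x|P. f (S r 2 x)) + (LINT x|P. f (S r 3 x))) / 3"
proof -
  have int: "integrable P f" by (rule integrable_bounded_on[OF f bd])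
  have intS: "integrable P (\<lambda>x. f (S r j x))" if "j \<in> {1, 2, 3}" for j
  proof (rule integrable_bounded_on)
    show "(\<lambda>x. f (S r j x)) \<in> borel_measurable borel" by measurable
    show "\<bar>f (S r j x)\<bar> \<le> B" if "x \<in> {0..1}" for x
      using bd[OF S_unit_interval[OF \<open>j \<in> {1, 2, 3}\<close> that]] .
  qed
  \<comment> \<open>Adding B makes the integrands nonnegative on the support, where the nonnegative
    integral applies.\<close>
  define I where "I j = (LINT x|P. f (S r j x) + B)" for j
  have I: "(\<integral>\<^sup>+x. ennreal (f (S r j x) + B) \<partial>P) = ennreal (I j)" "0 \<le> I j" if "j \<in> {1, 2, 3}" for j
  proof -
    have "AE x in P. 0 \<le> f (S r j x) + B"
      using AE_support
    proof eventually_elim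
      case (elim x)
      then show ?case using bd[OF S_unit_interval[OF that elim]] by linarith
    qed
    note ae = this
    have "integrable P (\<lambda>x. f (S r j x) + B)" using intS[OF that] by simp
    from nn_integral_eq_integral[OF this ae]
    show "(\<integral>\<^sup>+x. ennreal (f (S r j x) + B) \<partial>P) = ennreal (I j)" unfolding I_def .
    show "0 \<le> I j" unfolding I_def by (rule integral_nonneg_AE[OF ae])
  qed
  have ae: "AE x in P. 0 \<le> f x + B"
    using AE_support
  proof eventually_elim
    case (elim x)
    then show ?case using bd[OF elim] by linarith
  qed
  have "ennreal (LINT x|P. f x + B) = (\<integral>\<^sup>+x. ennreal (f x + B) \<partial>P)"
    using int ae by (intro nn_integral_eq_integral[symmetric]) auto
  also have "\<dots> = ennreal (1 / 3) * (\<Sum>j\<in>{1, 2, 3}. \<integral>\<^sup>+x. ennreal (f (S r j x) + B) \<partial>P)"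
    by (rule nn_integral_self_similar) simp
  also have "(\<Sum>j\<in>{1, 2, 3}. \<integral>\<^sup>+x. ennreal (f (S r j x) + B) \<partial>P) = ennreal (I 1 + I 2 + I 3)"
    using I[of 1] I[of 2] I[of 3] by (simp add: add_ac)
  also have "ennreal (1 / 3) * ennreal (I 1 + I 2 + I 3) = ennreal ((I 1 + I 2 + I 3) / 3)"
    using I(2)[of 1] I(2)[of 2] I(2)[of 3] by (subst ennreal_mult[symmetric]) auto
  finally have "(LINT x|P. f x + B) = (I 1 + I 2 + I 3) / 3"
    using I(2)[of 1] I(2)[of 2] I(2)[of 3] integral_nonneg_AE[OF ae] by (simp add: ennreal_inj)
  moreover have "(LINT x|P. f x + B) = (LINT x|P. f x) + B"
    using int by (subst Bochner_Integration.integral_add) auto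
  moreover have "I j = (LINT x|P. f (S r j x)) + B" if "j \<in> {1, 2, 3}" for j
    unfolding I_def using intS[OF that] by (subst Bochner_Integration.integral_add) auto
  ultimately show ?thesis by simp
qed

section \<open>Mean and variance of \<open>P\<close>\<close>

definition variance0 :: real where "variance0 = (1 - r) / (6 * (1 + r))"

lemma integrable_id: "integrable P (\<lambda>x. x)"
  by (rule integrable_bounded_on[where B = 1]) auto

lemma integrable_square: "integrable P (\<lambda>x. (x - c)\<^sup>2)"
proof (rule integrable_bounded_on[where B = "(1 + \<bar>c\<bar>)\<^sup>2"])
  fix x :: real assume "x \<in> {0..1}"
  then have "\<bar>x - c\<bar> \<le> 1 + \<bar>c\<bar>" by auto
  then have "\<bar>x - c\<bar>\<^sup>2 \<le> (1 + \<bar>c\<bar>)\<^sup>2" by (rule power_mono) simp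
  then show "\<bar>(x - c)\<^sup>2\<bar> \<le> (1 + \<bar>c\<bar>)\<^sup>2" by simp
qed simp

lemma mean: "(LINT x|P. x) = 1 / 2"
proof -
  define m where "m = (LINT x|P. x)"
  have *: "(LINT x|P. S r j x) = r * m + (real j - 1) / 2 * (1 - r)" for j
    unfolding S_def m_def using integrable_id by (subst Bochner_Integration.integral_add) auto
  have "m = ((LINT x|P. S r 1 x) + (LINT x|P. S r 2 x) + (LINT x|P. S r 3 x)) / 3"
    unfolding m_def by (rule integral_self_similar[where B = 1]) auto
  also have "\<dots> = r * m + (1 - r) / 2" unfolding * by (simp add: field_simps)
  finally have "(1 - r) * m = (1 - r) * (1 / 2)" by (simp add: field_simps)
  then show ?thesis using r3 unfolding m_def by simp
qed

lemma mean_centered: "(LINT x|P. 1 / 2 - x) = 0"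
  using integrable_id mean by (subst Bochner_Integration.integral_diff) auto

lemma variance_eq: "(LINT x|P. (x - 1 / 2)\<^sup>2) = variance0"
proof -
  define w where "w = (LINT x|P. (x - 1 / 2)\<^sup>2)"
  have i1: "integrable P (\<lambda>x. 1 / 2 - x)" using integrable_id by auto
  have *: "(LINT x|P. (S r j x - 1 / 2)\<^sup>2) = r\<^sup>2 * w + ((real j - 2) / 2 * (1 - r))\<^sup>2" for j
  proof -
    define k where "k = (real j - 2) / 2 * (1 - r)"
    have "S r j x - 1 / 2 = r * (x - 1 / 2) + k" for x
      by (simp add: S_def k_def field_simps)
    then have "(S r j x - 1 / 2)\<^sup>2 = r\<^sup>2 * (x - 1 / 2)\<^sup>2 + (- 2 * r * k) * (1 / 2 - x) + k\<^sup>2" for x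
      by (simp only:) (simp add: power2_eq_square field_simps)
    then have "(LINT x|P. (S r j x - 1 / 2)\<^sup>2)
        = (LINT x|P. r\<^sup>2 * (x - 1 / 2)\<^sup>2 + (- 2 * r * k) * (1 / 2 - x) + k\<^sup>2)" by simp
    also have "\<dots> = r\<^sup>2 * (LINT x|P. (x - 1 / 2)\<^sup>2) + (- 2 * r * k) * (LINT x|P. 1 / 2 - x) + k\<^sup>2"
      using integrable_square[of "1 / 2"] i1
      by simp
    finally show ?thesis unfolding mean_centered w_def k_def by simp
  qed
  have "w = ((LINT x|P. (S r 1 x - 1 / 2)\<^sup>2) + (LINT x|P. (S r 2 x - 1 / 2)\<^sup>2)
      + (LINT x|P. (S r 3 x - 1 / 2)\<^sup>2)) / 3"
    unfolding w_def
  proof (rule integral_self_similar[where B = 1])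
    fix x :: real assume "x \<in> {0..1}"
    then have "\<bar>x - 1 / 2\<bar> \<le> 1" by (auto simp: abs_le_iff)
    then show "\<bar>(x - 1 / 2)\<^sup>2\<bar> \<le> 1" by (simp add: abs_square_le_1)
  qed simp
  also have "\<dots> = r\<^sup>2 * w + (1 - r)\<^sup>2 / 6"
    unfolding * by (simp add: power2_eq_square field_simps)
  finally have "(1 - r) * (w * (6 * (1 + r))) = (1 - r) * (1 - r)"
    by (simp add: power2_eq_square field_simps)
  then have "w * (6 * (1 + r)) = 1 - r" using r3 by simp
  then show ?thesis unfolding variance0_def w_def[symmetric] using r0 by (simp add: field_simps)
qed

end

section \<open>Cuts and quantization errors\<close>

text \<open>In this unit the cut (1/3, 2/9) lies on the parabola u (1 - u), which then dominates the
  whole curve; in the limit r = 1/3, the uniform distribution, the curve is the parabola.\<close>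

definition width :: "real \<Rightarrow> real" where "width r = 3 * (1 - r) / 4"

context self_similar
begin

lemma width_pos: "0 < width r"
  using r3 by (simp add: width_def)

definition cut_mass :: "real \<Rightarrow> real" where
  "cut_mass t = (LINT x|P. indicator {..t} x)"

definition cut_moment :: "real \<Rightarrow> real" where
  "cut_moment t = (LINT x|P. indicator {..t} x * (1 / 2 - x))"

lemma integrable_cut_mass: "integrable P (indicator {..t} :: real \<Rightarrow> real)"
  by (rule integrable_bounded_on[where B = 1]) (auto simp: indicator_def)

lemma integrable_cut_moment: "integrable P (\<lambda>x. indicator {..t} x * (1 / 2 - x) :: real)"
  by (rule integrable_bounded_on[where B = 1]) (auto simp: indicator_def)

lemma cut_low: assumes "t < 0" shows "cut_mass t = 0" "cut_moment t = 0"
proof -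
  have "AE x in P. indicator {..t} x = (0::real)"
    using AE_support by eventually_elim (use assms in \<open>auto simp: indicator_def\<close>)
  then have *: "AE x in P. indicator {..t} x = (0::real)" "AE x in P. indicator {..t} x * (1 / 2 - x) = 0"
    by auto
  show "cut_mass t = 0" unfolding cut_mass_def by (rule integral_eq_zero_AE[OF *(1)])
  show "cut_moment t = 0" unfolding cut_moment_def by (rule integral_eq_zero_AE[OF *(2)])
qed

lemma cut_high: assumes "1 \<le> t" shows "cut_mass t = 1" "cut_moment t = 0"
proof -
  have ae: "AE x in P. indicator {..t} x = (1::real)"
    using AE_support by eventually_elim (use assms in \<open>auto simp: indicator_def\<close>)
  have "cut_mass t = (LINT x|P. 1)"
    unfolding cut_mass_def by (rule integral_cong_AE) (use ae in \<open>auto simp: borel_measurable_P\<close>)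
  then show "cut_mass t = 1" by simp
  have "cut_moment t = (LINT x|P. 1 / 2 - x)"
    unfolding cut_moment_def by (rule integral_cong_AE) (use ae in \<open>auto simp: borel_measurable_P\<close>)
  then show "cut_moment t = 0" using mean_centered by simp
qed

lemma cut_mass_bounds: "0 \<le> cut_mass t" "cut_mass t \<le> 1"
proof -
  show "0 \<le> cut_mass t" unfolding cut_mass_def by (rule Bochner_Integration.integral_nonneg) (auto simp: indicator_def)
  have "cut_mass t \<le> (LINT x|P. 1)"
    unfolding cut_mass_def by (rule integral_mono) (auto simp: integrable_cut_mass indicator_def)
  then show "cut_mass t \<le> 1" by simp
qed

lemma cut_moment_nonneg: "0 \<le> cut_moment t"
proof (cases "t \<le> 1 / 2")
  case True
  then show ?thesis unfolding cut_moment_def by (intro Bochner_Integration.integral_nonneg) (auto simp: indicator_def)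
next
  case False
  have "cut_moment t = (LINT x|P. indicator {..t} x * (1 / 2 - x) - (1 / 2 - x))"
    unfolding cut_moment_def using mean_centered integrable_cut_moment[of t] integrable_id
    by (subst Bochner_Integration.integral_diff) (auto simp: cut_moment_def)
  also have "0 \<le> \<dots>" using False by (intro Bochner_Integration.integral_nonneg) (auto simp: indicator_def)
  finally show ?thesis .
qed

lemma cut_moment_le: "cut_moment t \<le> 1"
proof -
  have "cut_moment t \<le> (LINT x|P. 1)"
    unfolding cut_moment_def
  proof (rule integral_mono_AE)
    show "AE x in P. indicator {..t} x * (1 / 2 - x) \<le> 1"
      using AE_support by eventually_elim (auto simp: indicator_def)
  qed (auto simp: integrable_cut_moment)
  then show ?thesis by simp
qed

lemma S_le_iff: "S r j x \<le> t \<longleftrightarrow> x \<le> (t - (real j - 1) / 2 * (1 - r)) / r"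
  using r0 by (simp add: S_def field_simps)

lemma cut_mass_rec:
  "cut_mass t = (cut_mass (t / r) + cut_mass ((t - (1 - r) / 2) / r) + cut_mass ((t - (1 - r)) / r)) / 3"
proof -
  have *: "(LINT x|P. indicator {..t} (S r j x)) = cut_mass ((t - (real j - 1) / 2 * (1 - r)) / r)" for j
    unfolding cut_mass_def by (intro Bochner_Integration.integral_cong) (auto simp: indicator_def S_le_iff)
  have "cut_mass t = ((LINT x|P. indicator {..t} (S r 1 x)) + (LINT x|P. indicator {..t} (S r 2 x))
      + (LINT x|P. indicator {..t} (S r 3 x))) / 3"
    unfolding cut_mass_def by (rule integral_self_similar[where B = 1]) (auto simp: indicator_def)
  then show ?thesis unfolding * by simp
qed

lemma cut_moment_rec:
  "cut_moment t = (r * cut_moment (t / r) + (1 - r) / 2 * cut_mass (t / r)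
     + r * cut_moment ((t - (1 - r) / 2) / r)
     + r * cut_moment ((t - (1 - r)) / r) - (1 - r) / 2 * cut_mass ((t - (1 - r)) / r)) / 3"
proof -
  have *: "(LINT x|P. indicator {..t} (S r j x) * (1 / 2 - S r j x))
      = r * cut_moment ((t - (real j - 1) / 2 * (1 - r)) / r)
        + (2 - real j) / 2 * (1 - r) * cut_mass ((t - (real j - 1) / 2 * (1 - r)) / r)" for j
  proof -
    define s where "s = (t - (real j - 1) / 2 * (1 - r)) / r"
    have "indicator {..t} (S r j x) * (1 / 2 - S r j x)
        = r * (indicator {..s} x * (1 / 2 - x)) + (2 - real j) / 2 * (1 - r) * indicator {..s} x" for x
      using S_le_iff[of j x t] unfolding s_def[symmetric]
      by (auto simp: indicator_def S_def field_simps)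
    then have "(LINT x|P. indicator {..t} (S r j x) * (1 / 2 - S r j x))
        = (LINT x|P. r * (indicator {..s} x * (1 / 2 - x)) + (2 - real j) / 2 * (1 - r) * indicator {..s} x)"
      by simp
    also have "\<dots> = r * cut_moment s + (2 - real j) / 2 * (1 - r) * cut_mass s"
      unfolding cut_moment_def cut_mass_def
      using integrable_cut_moment[of s] integrable_cut_mass[of s]
      by (subst Bochner_Integration.integral_add) auto
    finally show ?thesis unfolding s_def .
  qed
  have "cut_moment t = ((LINT x|P. indicator {..t} (S r 1 x) * (1 / 2 - S r 1 x))
      + (LINT x|P. indicator {..t} (S r 2 x) * (1 / 2 - S r 2 x))
      + (LINT x|P. indicator {..t} (S r 3 x) * (1 / 2 - S r 3 x))) / 3"
    unfolding cut_moment_def by (rule integral_self_similar[where B = 1]) (auto simp: indicator_def)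
  then show ?thesis unfolding * by (simp add: algebra_simps)
qed

definition cut_m :: "real \<Rightarrow> real" where "cut_m t = cut_moment t / width r"

lemma cut_moment_eq: "cut_moment t = width r * cut_m t"
  using width_pos by (simp add: cut_m_def)

lemma width_2_9: "(1 - r) / 6 = width r * (2 / 9)"
  by (simp add: width_def)

lemma cut_left:
  assumes "t < (1 - r) / 2"
  shows "cut_mass t = cut_mass (t / r) / 3"
    "cut_m t = 2 / 9 * cut_mass (t / r) + r / 3 * cut_m (t / r)"
proof -
  have "(t - (1 - r) / 2) / r < 0" "(t - (1 - r)) / r < 0"
    using assms r0 r3 by (auto simp: divide_less_0_iff)
  note low = cut_low[OF this(1)] cut_low[OF this(2)]
  show "cut_mass t = cut_mass (t / r) / 3" using cut_mass_rec[of t] low by simp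
  have "cut_moment t = r / 3 * cut_moment (t / r) + (1 - r) / 6 * cut_mass (t / r)"
    using cut_moment_rec[of t] low by simp
  then have "width r * cut_m t = width r * (2 / 9 * cut_mass (t / r) + r / 3 * cut_m (t / r))"
    unfolding width_2_9 cut_moment_eq by (simp add: algebra_simps)
  then show "cut_m t = 2 / 9 * cut_mass (t / r) + r / 3 * cut_m (t / r)" using width_pos by simp
qed

lemma cut_middle:
  assumes "(1 - r) / 2 \<le> t" "t < 1 - r"
  shows "cut_mass t = (1 + cut_mass ((t - (1 - r) / 2) / r)) / 3"
    "cut_m t = 2 / 9 + r / 3 * cut_m ((t - (1 - r) / 2) / r)"
proof -
  have "1 \<le> t / r" "(t - (1 - r)) / r < 0"
    using assms r0 r3 by (auto simp: divide_less_0_iff le_divide_eq)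
  note low = cut_high[OF this(1)] cut_low[OF this(2)]
  show "cut_mass t = (1 + cut_mass ((t - (1 - r) / 2) / r)) / 3" using cut_mass_rec[of t] low by simp
  have "cut_moment t = r / 3 * cut_moment ((t - (1 - r) / 2) / r) + (1 - r) / 6"
    using cut_moment_rec[of t] low by (simp add: add_divide_distrib)
  then have "width r * cut_m t = width r * (2 / 9 + r / 3 * cut_m ((t - (1 - r) / 2) / r))"
    unfolding width_2_9 cut_moment_eq by (simp add: algebra_simps)
  then show "cut_m t = 2 / 9 + r / 3 * cut_m ((t - (1 - r) / 2) / r)" using width_pos by simp
qed

lemma cut_right:
  assumes "1 - r \<le> t"
  shows "cut_mass t = (2 + cut_mass ((t - (1 - r)) / r)) / 3"
    "cut_m t = 2 / 9 * (1 - cut_mass ((t - (1 - r)) / r)) + r / 3 * cut_m ((t - (1 - r)) / r)"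
proof -
  have "1 \<le> t / r" "1 \<le> (t - (1 - r) / 2) / r"
    using assms r0 r3 by (auto simp: le_divide_eq field_simps)
  note high = cut_high[OF this(1)] cut_high[OF this(2)]
  show "cut_mass t = (2 + cut_mass ((t - (1 - r)) / r)) / 3" using cut_mass_rec[of t] high by simp
  have "cut_moment t = r / 3 * cut_moment ((t - (1 - r)) / r) + (1 - r) / 6 * (1 - cut_mass ((t - (1 - r)) / r))"
    using cut_moment_rec[of t] high by (simp add: field_simps)
  then have "width r * cut_m t
      = width r * (2 / 9 * (1 - cut_mass ((t - (1 - r)) / r)) + r / 3 * cut_m ((t - (1 - r)) / r))"
    unfolding width_2_9 cut_moment_eq by (simp add: field_simps)
  then show "cut_m t = 2 / 9 * (1 - cut_mass ((t - (1 - r)) / r)) + r / 3 * cut_m ((t - (1 - r)) / r)"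
    using width_pos by simp
qed

lemma cut_cases:
  obtains s where "cut_mass t = cut_mass s / 3" "cut_m t = 2 / 9 * cut_mass s + r / 3 * cut_m s"
  | s where "cut_mass t = (1 + cut_mass s) / 3" "cut_m t = 2 / 9 + r / 3 * cut_m s"
  | s where "cut_mass t = (2 + cut_mass s) / 3" "cut_m t = 2 / 9 * (1 - cut_mass s) + r / 3 * cut_m s"
  using cut_left[of t] cut_middle[of t] cut_right[of t] by (meson linorder_not_le)

text \<open>The excess over the parabola contracts by the factor \<open>r / 3\<close> under each of the three
  recursion rules, so its supremum cannot be positive.\<close>
lemma cut_m_le_parabola: "cut_m t \<le> cut_mass t * (1 - cut_mass t)"
proof -
  define D where "D t = cut_m t - cut_mass t * (1 - cut_mass t)" for t
  have par: "r / 3 * (u * (1 - u)) \<le> u * (1 - u) / 9" if "0 \<le> u" "u \<le> 1" for u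
    using r3 that mult_right_mono[of "r / 3" "1 / 9" "u * (1 - u)"] by simp
  have scale: "r / 3 * D s = r / 3 * cut_m s - r / 3 * (cut_mass s * (1 - cut_mass s))" for s
    unfolding D_def by (simp add: algebra_simps)
  have step: "\<exists>s. D t \<le> r / 3 * D s" for t
  proof (rule cut_cases[of t])
    fix s assume *: "cut_mass t = cut_mass s / 3" "cut_m t = 2 / 9 * cut_mass s + r / 3 * cut_m s"
    have "D t = r / 3 * cut_m s - cut_mass s * (1 - cut_mass s) / 9"
      unfolding D_def * by (simp add: field_simps)
    then show ?thesis using par[OF cut_mass_bounds[of s]] scale[of s]
      by (intro exI[of _ s]) linarith
  next
    fix s assume *: "cut_mass t = (1 + cut_mass s) / 3" "cut_m t = 2 / 9 + r / 3 * cut_m s"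
    have "D t = r / 3 * cut_m s - cut_mass s * (1 - cut_mass s) / 9"
      unfolding D_def * by (simp add: field_simps)
    then show ?thesis using par[OF cut_mass_bounds[of s]] scale[of s]
      by (intro exI[of _ s]) linarith
  next
    fix s assume *: "cut_mass t = (2 + cut_mass s) / 3"
      "cut_m t = 2 / 9 * (1 - cut_mass s) + r / 3 * cut_m s"
    have "D t = r / 3 * cut_m s - cut_mass s * (1 - cut_mass s) / 9"
      unfolding D_def * by (simp add: field_simps)
    then show ?thesis using par[OF cut_mass_bounds[of s]] scale[of s]
      by (intro exI[of _ s]) linarith
  qed
  have bdd: "bdd_above (range D)"
  proof (rule bdd_aboveI2)
    fix t
    have "cut_m t \<le> 1 / width r"
      unfolding cut_m_def using cut_moment_le width_pos by (intro divide_right_mono) auto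
    moreover have "0 \<le> cut_mass t * (1 - cut_mass t)" using cut_mass_bounds[of t] by simp
    ultimately show "D t \<le> 1 / width r" unfolding D_def by linarith
  qed
  have "D t \<le> r / 3 * (SUP t. D t)" for t
  proof -
    obtain s where "D t \<le> r / 3 * D s" using step by blast
    moreover have "r / 3 * D s \<le> r / 3 * (SUP t. D t)"
      using r0 cSUP_upper[OF _ bdd, of s] by (intro mult_left_mono) auto
    ultimately show ?thesis by linarith
  qed
  then have "(SUP t. D t) \<le> r / 3 * (SUP t. D t)" by (intro cSUP_least) auto
  then have "(1 - r / 3) * (SUP t. D t) \<le> 0" by (simp add: algebra_simps)
  then have "(SUP t. D t) \<le> 0" using r3 by (simp add: mult_le_0_iff)
  moreover have "D t \<le> (SUP t. D t)" by (rule cSUP_upper[OF _ bdd]) simp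
  ultimately show ?thesis unfolding D_def by linarith
qed

lemma lorenz_set_cut: "lorenz_set r (range (\<lambda>t. (cut_mass t, cut_m t)))"
proof -
  have "\<exists>s. (cut_mass t = cut_mass s / 3 \<and> cut_m t = 2 / 9 * cut_mass s + r / 3 * cut_m s) \<or>
      (cut_mass t = (1 + cut_mass s) / 3 \<and> cut_m t = 2 / 9 + r / 3 * cut_m s) \<or>
      (cut_mass t = (2 + cut_mass s) / 3 \<and> cut_m t = 2 / 9 * (1 - cut_mass s) + r / 3 * cut_m s)" for t
    by (rule cut_cases[of t]) blast+
  moreover have "0 \<le> cut_m t" for t
    using cut_moment_nonneg width_pos by (simp add: cut_m_def)
  ultimately show ?thesis
    unfolding lorenz_set_def using cut_mass_bounds cut_m_le_parabola by auto
qed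

section \<open>Errors of one and two points in terms of cuts\<close>

lemma Min_square_nonneg: "finite \<alpha> \<Longrightarrow> \<alpha> \<noteq> {} \<Longrightarrow> 0 \<le> Min ((\<lambda>c. (x - c)\<^sup>2) ` \<alpha>)" for x :: real
  by (subst Min_ge_iff) auto

lemma integrable_V:
  assumes "finite \<alpha>" "\<alpha> \<noteq> {}"
  shows "integrable P (\<lambda>x. Min ((\<lambda>c. (x - c)\<^sup>2) ` \<alpha>))"
proof -
  obtain c where c: "c \<in> \<alpha>" using assms by blast
  show ?thesis
  proof (rule integrable_bounded_on[where B = "(1 + \<bar>c\<bar>)\<^sup>2"])
    show "(\<lambda>x. Min ((\<lambda>c. (x - c)\<^sup>2) ` \<alpha>)) \<in> borel_measurable borel"
      using assms by (intro borel_measurable_Min) auto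
    fix x :: real assume "x \<in> {0..1}"
    then have "\<bar>x - c\<bar>\<^sup>2 \<le> (1 + \<bar>c\<bar>)\<^sup>2" by (intro power_mono) auto
    moreover have "Min ((\<lambda>c. (x - c)\<^sup>2) ` \<alpha>) \<le> (x - c)\<^sup>2" using assms c by (intro Min_le) auto
    ultimately show "\<bar>Min ((\<lambda>c. (x - c)\<^sup>2) ` \<alpha>)\<bar> \<le> (1 + \<bar>c\<bar>)\<^sup>2"
      using Min_square_nonneg[OF assms, of x] by simp
  qed
qed

lemma V_nonneg: "finite \<alpha> \<Longrightarrow> \<alpha> \<noteq> {} \<Longrightarrow> 0 \<le> V P \<alpha>"
  unfolding V_def by (intro Bochner_Integration.integral_nonneg Min_square_nonneg)

lemma V_mono:
  assumes \<alpha>: "finite \<alpha>" "\<alpha> \<noteq> {}" and \<beta>: "finite \<beta>" "\<beta> \<noteq> {}"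
    and le: "\<And>x a. x \<in> {0..1} \<Longrightarrow> a \<in> \<alpha> \<Longrightarrow> \<exists>b\<in>\<beta>. (x - b)\<^sup>2 \<le> (x - a)\<^sup>2"
  shows "V P \<beta> \<le> V P \<alpha>"
  unfolding V_def
proof (rule integral_mono_AE[OF integrable_V[OF \<beta>] integrable_V[OF \<alpha>]])
  show "AE x in P. Min ((\<lambda>c. (x - c)\<^sup>2) ` \<beta>) \<le> Min ((\<lambda>c. (x - c)\<^sup>2) ` \<alpha>)"
    using AE_support
  proof eventually_elim
    case (elim x)
    have "Min ((\<lambda>c. (x - c)\<^sup>2) ` \<beta>) \<le> (x - a)\<^sup>2" if a: "a \<in> \<alpha>" for a
    proof -
      obtain b where "b \<in> \<beta>" "(x - b)\<^sup>2 \<le> (x - a)\<^sup>2" using le[OF elim a] by blast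
      moreover have "Min ((\<lambda>c. (x - c)\<^sup>2) ` \<beta>) \<le> (x - b)\<^sup>2" using \<beta> \<open>b \<in> \<beta>\<close> by (intro Min_le) auto
      ultimately show ?thesis by linarith
    qed
    then show ?case using \<alpha> by (subst Min_ge_iff) auto
  qed
qed

lemma V_antimono: "finite \<beta> \<Longrightarrow> \<alpha> \<noteq> {} \<Longrightarrow> \<alpha> \<subseteq> \<beta> \<Longrightarrow> V P \<beta> \<le> V P \<alpha>"
  by (intro V_mono) (auto intro: finite_subset)

lemma V_singleton: "V P {c} = variance0 + (c - 1 / 2)\<^sup>2"
proof -
  have "V P {c} = (LINT x|P. (x - 1 / 2)\<^sup>2 + 2 * (c - 1 / 2) * (1 / 2 - x) + (c - 1 / 2)\<^sup>2)"
    unfolding V_def by (intro Bochner_Integration.integral_cong) (auto simp: power2_eq_square algebra_simps)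
  also have "\<dots> = (LINT x|P. (x - 1 / 2)\<^sup>2) + 2 * (c - 1 / 2) * (LINT x|P. 1 / 2 - x) + (c - 1 / 2)\<^sup>2"
    using integrable_square[of "1 / 2"] integrable_id by simp
  finally show ?thesis using mean_centered variance_eq by simp
qed

lemma V_pair_integral:
  "(LINT x|P. (if x \<le> t then (x - b)\<^sup>2 else (x - d)\<^sup>2))
    = variance0 + cut_mass t * (b - 1 / 2)\<^sup>2 + (1 - cut_mass t) * (d - 1 / 2)\<^sup>2 - 2 * (d - b) * cut_moment t"
proof -
  have "(LINT x|P. (if x \<le> t then (x - b)\<^sup>2 else (x - d)\<^sup>2))
      = (LINT x|P. (x - 1 / 2)\<^sup>2 + 2 * (d - 1 / 2) * (1 / 2 - x) + (d - 1 / 2)\<^sup>2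
          + ((b - 1 / 2)\<^sup>2 - (d - 1 / 2)\<^sup>2) * indicator {..t} x
          + (2 * (b - d)) * (indicator {..t} x * (1 / 2 - x)))"
    by (intro Bochner_Integration.integral_cong)
      (auto simp: power2_eq_square algebra_simps indicator_def)
  also have "\<dots> = (LINT x|P. (x - 1 / 2)\<^sup>2) + 2 * (d - 1 / 2) * (LINT x|P. 1 / 2 - x) + (d - 1 / 2)\<^sup>2
          + ((b - 1 / 2)\<^sup>2 - (d - 1 / 2)\<^sup>2) * cut_mass t + (2 * (b - d)) * cut_moment t"
    unfolding cut_mass_def cut_moment_def
    using integrable_square[of "1 / 2"] integrable_id integrable_cut_mass[of t] integrable_cut_moment[of t]
    by simp
  finally show ?thesis using mean_centered variance_eq by (simp add: algebra_simps)
qed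

lemma integrable_pair: "integrable P (\<lambda>x. if x \<le> t then (x - b)\<^sup>2 else (x - d)\<^sup>2)"
proof -
  have eq: "(\<lambda>x. if x \<le> t then (x - b)\<^sup>2 else (x - d)\<^sup>2)
    = (\<lambda>x. (x - d)\<^sup>2 + ((b - 1 / 2)\<^sup>2 - (d - 1 / 2)\<^sup>2) * indicator {..t} x
          + (2 * (b - d)) * (indicator {..t} x * (1 / 2 - x)))"
    by (auto simp: power2_eq_square algebra_simps indicator_def fun_eq_iff)
  show ?thesis unfolding eq
    using integrable_square[of d] integrable_cut_mass[of t] integrable_cut_moment[of t] by simp
qed

text \<open>Any threshold t yields an upper bound; equality holds at the Voronoi boundary, see
  \<open>V_pair\<close>.\<close>

lemma V_pair_le:
  "V P {b, d} \<le> variance0 + cut_mass t * (b - 1 / 2)\<^sup>2 + (1 - cut_mass t) * (d - 1 / 2)\<^sup>2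
     - 2 * (d - b) * cut_moment t"
  unfolding V_pair_integral[symmetric] V_def
  by (rule integral_mono) (use integrable_V[of "{b, d}"] integrable_pair in auto)

lemma V_pair:
  assumes "b \<le> d"
  shows "V P {b, d} = variance0 + cut_mass ((b + d) / 2) * (b - 1 / 2)\<^sup>2
     + (1 - cut_mass ((b + d) / 2)) * (d - 1 / 2)\<^sup>2 - 2 * (d - b) * cut_moment ((b + d) / 2)"
  unfolding V_pair_integral[symmetric] V_def
proof (intro Bochner_Integration.integral_cong refl)
  fix x
  show "Min ((\<lambda>c. (x - c)\<^sup>2) ` {b, d}) = (if x \<le> (b + d) / 2 then (x - b)\<^sup>2 else (x - d)\<^sup>2)"
  proof (cases "x \<le> (b + d) / 2")
    case True
    have "0 \<le> (d - b) * (b + d - 2 * x)" using True assms by (intro mult_nonneg_nonneg) auto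
    then have "(x - b)\<^sup>2 \<le> (x - d)\<^sup>2" by (simp add: power2_eq_square algebra_simps)
    then show ?thesis using True by simp
  next
    case False
    have "0 \<le> (d - b) * (2 * x - b - d)" using False assms by (intro mult_nonneg_nonneg) auto
    then have "(x - d)\<^sup>2 \<le> (x - b)\<^sup>2" by (simp add: power2_eq_square algebra_simps)
    then show ?thesis using False by simp
  qed
qed

section \<open>Scaling, reflection and savings from additional points\<close>

lemma V_scale:
  assumes A: "finite A" "A \<noteq> {}"
  shows "V P A = r\<^sup>2 / 3 * (\<Sum>j\<in>{1, 2, 3}. V P ((\<lambda>a. (a - (real j - 1) / 2 * (1 - r)) / r) ` A))"
proof -
  define f where "f x = Min ((\<lambda>c. (x - c)\<^sup>2) ` A)" for x
  have fS: "f (S r j x) = r\<^sup>2 * Min ((\<lambda>c. (x - c)\<^sup>2) ` (\<lambda>a. (a - (real j - 1) / 2 * (1 - r)) / r) ` A)" for j x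
  proof -
    define g where "g a = (a - (real j - 1) / 2 * (1 - r)) / r" for a
    have "(S r j x - a)\<^sup>2 = r\<^sup>2 * (x - g a)\<^sup>2" for a
    proof -
      have "S r j x - a = r * (x - g a)" using r0 by (simp add: S_def g_def field_simps)
      then show ?thesis by (simp add: power_mult_distrib)
    qed
    then have "(\<lambda>c. (S r j x - c)\<^sup>2) ` A = (\<lambda>y. r\<^sup>2 * y) ` (\<lambda>c. (x - c)\<^sup>2) ` g ` A" by (auto simp: image_image)
    moreover have "Min ((\<lambda>y. r\<^sup>2 * y) ` (\<lambda>c. (x - c)\<^sup>2) ` g ` A) = r\<^sup>2 * Min ((\<lambda>c. (x - c)\<^sup>2) ` g ` A)"
      using A by (intro mono_Min_commute[symmetric]) (auto simp: mono_def mult_left_mono)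
    ultimately show ?thesis unfolding f_def g_def by simp
  qed
  obtain c where c: "c \<in> A" using A by blast
  have "V P A = ((LINT x|P. f (S r 1 x)) + (LINT x|P. f (S r 2 x)) + (LINT x|P. f (S r 3 x))) / 3"
    unfolding V_def f_def[symmetric]
  proof (rule integral_self_similar[where B = "(1 + \<bar>c\<bar>)\<^sup>2"])
    show "f \<in> borel_measurable borel"
      unfolding f_def using A by (intro borel_measurable_Min) auto
    fix x :: real assume "x \<in> {0..1}"
    then have "\<bar>x - c\<bar>\<^sup>2 \<le> (1 + \<bar>c\<bar>)\<^sup>2" by (intro power_mono) auto
    moreover have "f x \<le> (x - c)\<^sup>2" unfolding f_def using A c by (intro Min_le) auto
    ultimately show "\<bar>f x\<bar> \<le> (1 + \<bar>c\<bar>)\<^sup>2"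
      using Min_square_nonneg[OF A, of x] unfolding f_def by simp
  qed
  moreover define G where "G j = V P ((\<lambda>a. (a - (real j - 1) / 2 * (1 - r)) / r) ` A)" for j
  have "(LINT x|P. f (S r j x)) = r\<^sup>2 * G j" for j
    unfolding fS G_def V_def by simp
  ultimately have "V P A = r\<^sup>2 / 3 * (\<Sum>j\<in>{1, 2, 3}. G j)" by (simp add: field_simps)
  then show ?thesis unfolding G_def .
qed

text \<open>The reflection exchanges \<open>S r 1\<close> and \<open>S r 3\<close>. Mirror cases can
  thus be settled by interpreting the locale for the reflected measure.\<close>

lemma reflected_self_similar: "self_similar r (distr P borel (\<lambda>x. 1 - x))"
proof
  have m: "(\<lambda>x::real. 1 - x) \<in> measurable P borel" by (simp add: borel_measurable_P)
  interpret Q: prob_space "distr P borel (\<lambda>x. 1 - x)" by (rule prob_space_distr[OF m])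
  have mQ: "measure (distr P borel (\<lambda>x. 1 - x)) A = measure P ((\<lambda>x. 1 - x) -` A)" if "A \<in> sets borel" for A
    using measure_distr[OF m that] by simp
  have "measure (distr P borel (\<lambda>x. 1 - x)) A
      = 1 / 3 * (\<Sum>j\<in>{1, 2, 3}. measure (distr P borel (\<lambda>x. 1 - x)) (S r j -` A))" if A: "A \<in> sets borel" for A
  proof -
    have vim: "(\<lambda>x. 1 - x) -` A \<in> sets borel"
      using measurable_sets[of "\<lambda>x::real. 1 - x" borel borel A] A by simp
    have SA: "S r j -` A \<in> sets borel" for j using measurable_sets[OF measurable_S A, of j] by simp
    have "(\<lambda>x. 1 - x) -` (S r j -` A) = S r (4 - j) -` ((\<lambda>x. 1 - x) -` A)" if "j \<in> {1, 2, 3}" for j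
      using that by (auto simp: S_def of_nat_diff field_simps)
    then have "measure (distr P borel (\<lambda>x. 1 - x)) (S r j -` A)
        = measure P (S r (4 - j) -` ((\<lambda>x. 1 - x) -` A))" if "j \<in> {1, 2, 3}" for j
      using mQ[OF SA] that by simp
    then show ?thesis using mQ[OF A] measure_self_similar[OF vim] by simp
  qed
  then show "self_similar_distribution r (distr P borel (\<lambda>x. 1 - x))"
    unfolding self_similar_distribution_def using Q.prob_space_axioms by simp
qed (use r0 r3 in auto)

lemma V_reflected:
  assumes "finite \<alpha>" "\<alpha> \<noteq> {}"
  shows "V (distr P borel (\<lambda>x. 1 - x)) \<alpha> = V P ((\<lambda>x. 1 - x) ` \<alpha>)"
proof -
  have "V (distr P borel (\<lambda>x. 1 - x)) \<alpha> = (LINT x|P. Min ((\<lambda>c. ((1 - x) - c)\<^sup>2) ` \<alpha>))"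
    unfolding V_def
    by (rule integral_distr) (use assms in \<open>auto simp: borel_measurable_P intro!: borel_measurable_Min\<close>)
  also have "\<dots> = V P ((\<lambda>x. 1 - x) ` \<alpha>)"
  proof -
    have "((1 - x) - c)\<^sup>2 = (x - (1 - c))\<^sup>2" for x c :: real by (simp add: power2_eq_square algebra_simps)
    then show ?thesis unfolding V_def image_image by simp
  qed
  finally show ?thesis .
qed

text \<open>What an additional point y saves over b alone (\<open>V_pair_loss\<close>). Pointwise,
  several points save at most the sum of their losses; this gives \<open>V_single_two_ext\<close>,
  \<open>V_pair_two_ext\<close> and \<open>V_chain_ext\<close>.\<close>

definition loss :: "real \<Rightarrow> real \<Rightarrow> real" where
  "loss b y = (LINT x|P. max 0 ((x - b)\<^sup>2 - (x - y)\<^sup>2))"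

lemma integrable_loss: "integrable P (\<lambda>x. max 0 ((x - b)\<^sup>2 - (x - y)\<^sup>2))"
  using integrable_square[of b] integrable_square[of y] by simp

lemma V_pair_loss: "V P {b, y} = V P {b} - loss b y"
proof -
  have "V P {b, y} = (LINT x|P. (x - b)\<^sup>2 - max 0 ((x - b)\<^sup>2 - (x - y)\<^sup>2))"
    unfolding V_def by (intro Bochner_Integration.integral_cong) auto
  then show ?thesis
    using integrable_square[of b] integrable_loss[of b y] by (simp add: V_def loss_def)
qed

text \<open>The integrand is the positive part of (y - b) (2 x - b - y), and both factors shrink as
  b moves towards y.\<close>

lemma loss_right_antimono:
  assumes "b' \<le> b" "b \<le> y"
  shows "loss b y \<le> loss b' y"
  unfolding loss_def
proof (rule integral_mono[OF integrable_loss integrable_loss])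
  fix x
  have eq: "(x - c)\<^sup>2 - (x - y)\<^sup>2 = (y - c) * (2 * x - c - y)" for c
    by (simp add: power2_eq_square algebra_simps)
  show "max 0 ((x - b)\<^sup>2 - (x - y)\<^sup>2) \<le> max 0 ((x - b')\<^sup>2 - (x - y)\<^sup>2)"
  proof (cases "2 * x - b - y \<le> 0")
    case True
    then have "(y - b) * (2 * x - b - y) \<le> 0" using assms by (simp add: mult_nonneg_nonpos)
    then show ?thesis unfolding eq by simp
  next
    case False
    then have "(y - b) * (2 * x - b - y) \<le> (y - b') * (2 * x - b' - y)"
      using assms by (intro mult_mono) auto
    then show ?thesis unfolding eq by simp
  qed
qed

lemma loss_left_mono:
  assumes "y \<le> b" "b \<le> b'"
  shows "loss b y \<le> loss b' y"
  unfolding loss_def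
proof (rule integral_mono[OF integrable_loss integrable_loss])
  fix x
  have eq: "(x - c)\<^sup>2 - (x - y)\<^sup>2 = (c - y) * (c + y - 2 * x)" for c
    by (simp add: power2_eq_square algebra_simps)
  show "max 0 ((x - b)\<^sup>2 - (x - y)\<^sup>2) \<le> max 0 ((x - b')\<^sup>2 - (x - y)\<^sup>2)"
  proof (cases "b + y - 2 * x \<le> 0")
    case True
    then have "(b - y) * (b + y - 2 * x) \<le> 0" using assms by (simp add: mult_nonneg_nonpos)
    then show ?thesis unfolding eq by simp
  next
    case False
    then have "(b - y) * (b + y - 2 * x) \<le> (b' - y) * (b' + y - 2 * x)"
      using assms by (intro mult_mono) auto
    then show ?thesis unfolding eq by simp
  qed
qed

lemma V_single_two_ext: "V P {b} - loss b y - loss b z \<le> V P {b, y, z}"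
proof -
  have "V P {b} - loss b y - loss b z
      = (LINT x|P. (x - b)\<^sup>2 - max 0 ((x - b)\<^sup>2 - (x - y)\<^sup>2) - max 0 ((x - b)\<^sup>2 - (x - z)\<^sup>2))"
    using integrable_square[of b] integrable_loss by (simp add: V_def loss_def)
  also have "\<dots> \<le> V P {b, y, z}"
    unfolding V_def
    by (rule integral_mono) (use integrable_square integrable_loss integrable_V[of "{b, y, z}"] in \<open>auto simp: min_def\<close>)
  finally show ?thesis .
qed

lemma V_pair_two_ext: "V P {b, d} - loss b y - loss d z \<le> V P {b, d, y, z}"
proof -
  have i: "integrable P (\<lambda>x. min ((x - b)\<^sup>2) ((x - d)\<^sup>2))" using integrable_V[of "{b, d}"] by simp
  have "V P {b, d} - loss b y - loss d z
      = (LINT x|P. min ((x - b)\<^sup>2) ((x - d)\<^sup>2) - max 0 ((x - b)\<^sup>2 - (x - y)\<^sup>2) - max 0 ((x - d)\<^sup>2 - (x - z)\<^sup>2))"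
    using i integrable_loss by (simp add: V_def loss_def)
  also have "\<dots> \<le> V P {b, d, y, z}"
    unfolding V_def
    by (rule integral_mono) (use i integrable_loss integrable_V[of "{b, d, y, z}"] in \<open>auto simp: min_def\<close>)
  finally show ?thesis .
qed

text \<open>Mass is handed on from d to b and from b to y, so y is charged against b and not against
  the more distant d.\<close>

lemma V_chain_ext: "V P {d, z} - loss d b - loss b y \<le> V P {b, d, y, z}"
proof -
  have i: "integrable P (\<lambda>x. min ((x - d)\<^sup>2) ((x - z)\<^sup>2))" using integrable_V[of "{d, z}"] by simp
  have "V P {d, z} - loss d b - loss b y
      = (LINT x|P. min ((x - d)\<^sup>2) ((x - z)\<^sup>2) - max 0 ((x - d)\<^sup>2 - (x - b)\<^sup>2) - max 0 ((x - b)\<^sup>2 - (x - y)\<^sup>2))"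
    using i integrable_loss by (simp add: V_def loss_def)
  also have "\<dots> \<le> V P {b, d, y, z}"
    unfolding V_def
    by (rule integral_mono) (use i integrable_loss integrable_V[of "{b, d, y, z}"] in \<open>auto simp: min_def\<close>)
  finally show ?thesis .
qed

end

section \<open>Charging points in gaps to cells\<close>

locale small_ratio = ratio r + self_similar r P for r P
begin

abbreviation "c \<equiv> width r"
abbreviation "g \<equiv> gain r"
text \<open>Distance of neighbouring cell centres: (1 - r) / (2 r) when cells have length 1
  (\<open>c_rho\<close>), here in units of c.\<close>

definition rho :: real where "rho = 2 / (3 * r)"
definition V2 :: real where "V2 = variance0 - c\<^sup>2 * g"

lemma g_bounds: "0 \<le> g" "2 / 9 \<le> g" "g \<le> 1 / 4"
  using gain_bounds by auto

text \<open>The source of 23/8, which is just below 2 / (3 * 0.23177).\<close>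

lemma rho_ge: "23 / 8 \<le> rho"
  using r_pos r_less by (simp add: rho_def field_simps)

lemma c_rho: "c * rho = (1 - r) / (2 * r)"
  using r_pos by (simp add: rho_def width_def field_simps)

lemma half_over_c: "2 / 3 \<le> 1 / (2 * c)"
  using r_pos r3 by (simp add: width_def field_simps)

lemma curve_cut: "curve_point g (cut_mass t) (cut_m t)"
proof -
  have X: "(cut_mass t, cut_m t) \<in> range (\<lambda>t. (cut_mass t, cut_m t))" by blast
  show ?thesis
    unfolding curve_point_def
    using lorenz_setD[OF lorenz_set_cut X] lorenz_set_gain[OF lorenz_set_cut X] by simp
qed

text \<open>Two readings of one error: the right point, or after mirroring the left one, plays the
  part of z in \<open>pair_gain\<close>.\<close>

lemma V_pair_gain:
  assumes "\<beta> \<le> \<zeta>"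
  defines "t \<equiv> ((1 / 2 + c * \<beta>) + (1 / 2 + c * \<zeta>)) / 2"
  shows "V P {1 / 2 + c * \<beta>, 1 / 2 + c * \<zeta>} = variance0 - c\<^sup>2 * pair_gain (1 - cut_mass t) (cut_m t) \<beta> \<zeta>"
    and "V P {1 / 2 + c * \<beta>, 1 / 2 + c * \<zeta>} = variance0 - c\<^sup>2 * pair_gain (cut_mass t) (cut_m t) (- \<zeta>) (- \<beta>)"
proof -
  have "1 / 2 + c * \<beta> \<le> 1 / 2 + c * \<zeta>" using assms width_pos by simp
  from V_pair[OF this, folded t_def]
  have *: "V P {1 / 2 + c * \<beta>, 1 / 2 + c * \<zeta>} = variance0 + cut_mass t * (c * \<beta>)\<^sup>2
      + (1 - cut_mass t) * (c * \<zeta>)\<^sup>2 - 2 * (c * \<zeta> - c * \<beta>) * (c * cut_m t)"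
    unfolding cut_moment_eq by simp
  show "V P {1 / 2 + c * \<beta>, 1 / 2 + c * \<zeta>} = variance0 - c\<^sup>2 * pair_gain (1 - cut_mass t) (cut_m t) \<beta> \<zeta>"
    "V P {1 / 2 + c * \<beta>, 1 / 2 + c * \<zeta>} = variance0 - c\<^sup>2 * pair_gain (cut_mass t) (cut_m t) (- \<zeta>) (- \<beta>)"
    unfolding * pair_gain_def by (simp_all add: power2_eq_square algebra_simps)
qed

lemma centered: obtains \<beta> where "b = 1 / 2 + c * \<beta>"
  using width_pos by (intro that[of "(b - 1 / 2) / c"]) simp

lemma V_two_ge: "V2 \<le> V P {b, d}"
proof -
  have aux: "V2 \<le> V P {b, d}" if bd: "b \<le> d" for b d
  proof -
    obtain \<beta> where \<beta>: "b = 1 / 2 + c * \<beta>" by (rule centered)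
    obtain \<zeta> where \<zeta>: "d = 1 / 2 + c * \<zeta>" by (rule centered)
    have "\<beta> \<le> \<zeta>" using bd width_pos unfolding \<beta> \<zeta> by simp
    have "c\<^sup>2 * pair_gain (1 - cut_mass ((b + d) / 2)) (cut_m ((b + d) / 2)) \<beta> \<zeta> \<le> c\<^sup>2 * g"
      by (intro mult_left_mono pair_gain_le_gain curve_point_reflect curve_cut g_bounds) simp
    then show ?thesis
      using V_pair_gain(1)[OF \<open>\<beta> \<le> \<zeta>\<close>, folded \<beta> \<zeta>] unfolding V2_def by simp
  qed
  show ?thesis
    using aux[of b d] aux[of d b] by (cases "b \<le> d") (auto simp: insert_commute)
qed

lemma V_ext_right:
  assumes "b \<le> 1 / 2 + c * \<zeta>"
  shows "variance0 - c\<^sup>2 * ext_gain g \<zeta> \<le> V P {b, 1 / 2 + c * \<zeta>}"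
proof -
  obtain \<beta> where \<beta>: "b = 1 / 2 + c * \<beta>" by (rule centered)
  have "\<beta> \<le> \<zeta>" using assms width_pos unfolding \<beta> by simp
  define t where "t = ((1 / 2 + c * \<beta>) + (1 / 2 + c * \<zeta>)) / 2"
  have "c\<^sup>2 * pair_gain (1 - cut_mass t) (cut_m t) \<beta> \<zeta> \<le> c\<^sup>2 * ext_gain g \<zeta>"
    by (intro mult_left_mono ext_gain_upper curve_point_reflect curve_cut g_bounds) simp
  then show ?thesis using V_pair_gain(1)[OF \<open>\<beta> \<le> \<zeta>\<close>] unfolding \<beta> t_def by simp
qed

lemma V_ext_left:
  assumes "1 / 2 - c * \<zeta> \<le> b"
  shows "variance0 - c\<^sup>2 * ext_gain g \<zeta> \<le> V P {b, 1 / 2 - c * \<zeta>}"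
proof -
  obtain \<beta> where \<beta>: "b = 1 / 2 + c * \<beta>" by (rule centered)
  have le: "- \<zeta> \<le> \<beta>"
  proof -
    have "c * (- \<zeta>) \<le> c * \<beta>" using assms unfolding \<beta> by simp
    then show ?thesis using width_pos by (simp only: mult_le_cancel_left_pos)
  qed
  define t where "t = ((1 / 2 + c * - \<zeta>) + (1 / 2 + c * \<beta>)) / 2"
  have "c\<^sup>2 * pair_gain (cut_mass t) (cut_m t) (- \<beta>) \<zeta> \<le> c\<^sup>2 * ext_gain g \<zeta>"
    by (intro mult_left_mono ext_gain_upper curve_cut g_bounds) simp
  then show ?thesis using V_pair_gain(2)[OF le] unfolding \<beta> t_def by (simp add: insert_commute)
qed

lemma ext_gain_nonneg: "0 \<le> ext_gain g z"
proof -
  have "curve_point g 0 0" by (simp add: curve_point_def)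
  from ext_gain_upper[OF this g_bounds(1), of 0 z] show ?thesis by (simp add: pair_gain_def)
qed

text \<open>What a cell with \<open>k\<close> points of its own can save at one of its ends, where the nearest external
  point is at distance \<open>z\<close> from the centre of the cell.\<close>
definition claim :: "nat \<Rightarrow> real \<Rightarrow> real" where
  "claim k z = (if k = 0 then gap_share g rho z else ext_gain g z)"

lemma claim_le: "claim k z \<le> g"
  using ext_gain_le_gain[OF g_bounds(1), of z] ext_gain_nonneg[of "rho - z"] g_bounds
  by (simp add: claim_def gap_share_def)

text \<open>If both cells have points, this is \<open>ext_gain_crossing\<close>. If one is empty,
  \<open>gap_share\<close> was defined as what the other cell leaves of g. If both are empty, at
  most one of z and rho - z is below rho / 2.\<close>

lemma claim_crossing: "claim k z + claim k' (rho - z) \<le> g"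
  using ext_gain_crossing[OF g_bounds(2) rho_ge, of z] ext_gain_le_gain[OF g_bounds(1), of z]
    ext_gain_le_gain[OF g_bounds(1), of "rho - z"] ext_gain_nonneg[of z] ext_gain_nonneg[of "rho - z"] g_bounds
  by (auto simp: claim_def gap_share_def)

text \<open>rho - 1 / (2 c) is the distance from a centre to the near end of the neighbouring cell.
  By \<open>ext_gain_far\<close>, points of that cell are therefore worthless to a cell with points
  of its own.\<close>

lemma far_point: "2 \<le> rho - 1 / (2 * c)" "rho / 2 \<le> rho - 1 / (2 * c)"
proof -
  have "5 * r - 3 * r\<^sup>2 \<le> 1"
  proof -
    have "0 \<le> (23177 / 100000 - r) * (5 - 3 * (r + 23177 / 100000))"
      using r_pos r_less by (intro mult_nonneg_nonneg) auto
    then show ?thesis by (simp add: power2_eq_square field_simps)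
  qed
  then have "c * 2 \<le> c * rho - 1 / 2"
    unfolding c_rho using r_pos by (simp add: width_def power2_eq_square field_simps)
  moreover have "c * (rho - 1 / (2 * c)) = c * rho - 1 / 2"
    using width_pos by (simp add: right_diff_distrib)
  ultimately have "c * 2 \<le> c * (rho - 1 / (2 * c))" by simp
  then show "2 \<le> rho - 1 / (2 * c)" using width_pos by (simp only: mult_le_cancel_left_pos)
  have "1 \<le> c * rho" unfolding c_rho using r_pos r3 by (simp add: field_simps)
  then have "1 / (2 * c) \<le> rho / 2" using width_pos by (simp add: field_simps)
  then show "rho / 2 \<le> rho - 1 / (2 * c)" by simp
qed

lemma claim_far: "claim k (rho - 1 / (2 * c)) \<le> 0"
  using ext_gain_far[OF far_point(1) g_bounds(1)] far_point(2) by (simp add: claim_def gap_share_def)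

lemma variance_le: "variance0 \<le> 2 * (c\<^sup>2 * g)"
proof -
  have "variance0 \<le> 2 * (c\<^sup>2 * (2 / 9))"
  proof -
    have "r\<^sup>2 \<le> 1 / 3" using r_sq by simp
    then have "0 \<le> (1 - r) * (1 / 3 - r\<^sup>2)" using r3 by simp
    then show ?thesis
      using r_pos by (simp add: variance0_def width_def power2_eq_square field_simps)
  qed
  also have "\<dots> \<le> 2 * (c\<^sup>2 * g)" using g_bounds by (intro mult_left_mono) auto
  finally show ?thesis .
qed

lemma V_two_ext:
  assumes z: "1 / (2 * c) \<le> zL" "1 / (2 * c) \<le> zR"
  shows "variance0 + c\<^sup>2 * (g - gap_share g rho zL - gap_share g rho zR)
    \<le> V P {1 / 2 - c * zL, 1 / 2 + c * zR}"
proof -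
  have z': "2 / 3 \<le> zL" "2 / 3 \<le> zR" using z half_over_c by linarith+
  then have le: "- zL \<le> zR" by simp
  define t where "t = ((1 / 2 + c * - zL) + (1 / 2 + c * zR)) / 2"
  have cp: "curve_point g (cut_mass t) (cut_m t)" by (rule curve_cut)
  have "g - gap_share g rho zL - gap_share g rho zR
      \<le> cut_mass t * zL\<^sup>2 + (1 - cut_mass t) * zR\<^sup>2 - 2 * cut_m t * (zL + zR)"
    using two_ext_gap_share[OF _ _ _ z' g_bounds(2,3) rho_ge] cp by (simp add: curve_point_def)
  then have "c\<^sup>2 * (g - gap_share g rho zL - gap_share g rho zR)
      \<le> c\<^sup>2 * (cut_mass t * zL\<^sup>2 + (1 - cut_mass t) * zR\<^sup>2 - 2 * cut_m t * (zL + zR))"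
    by (rule mult_left_mono) simp
  then show ?thesis
    using V_pair_gain(1)[OF le, folded t_def] by (simp add: pair_gain_def algebra_simps)
qed

lemma loss_half_right:
  assumes "1 / 2 \<le> b" "b \<le> 1 / 2 + c * \<zeta>"
  shows "loss b (1 / 2 + c * \<zeta>) \<le> c\<^sup>2 * ext_gain g \<zeta>"
proof -
  have "loss b (1 / 2 + c * \<zeta>) \<le> loss (1 / 2) (1 / 2 + c * \<zeta>)"
    using assms by (intro loss_right_antimono)
  also have "\<dots> = variance0 - V P {1 / 2, 1 / 2 + c * \<zeta>}"
    using V_pair_loss[of "1 / 2" "1 / 2 + c * \<zeta>"] by (simp add: V_singleton)
  also have "\<dots> \<le> c\<^sup>2 * ext_gain g \<zeta>" using V_ext_right[of "1 / 2" \<zeta>] assms by simp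
  finally show ?thesis .
qed

lemma loss_half_left:
  assumes "b \<le> 1 / 2" "1 / 2 - c * \<zeta> \<le> b"
  shows "loss b (1 / 2 - c * \<zeta>) \<le> c\<^sup>2 * ext_gain g \<zeta>"
proof -
  have "loss b (1 / 2 - c * \<zeta>) \<le> loss (1 / 2) (1 / 2 - c * \<zeta>)"
    using assms by (intro loss_left_mono)
  also have "\<dots> = variance0 - V P {1 / 2, 1 / 2 - c * \<zeta>}"
    using V_pair_loss[of "1 / 2" "1 / 2 - c * \<zeta>"] by (simp add: V_singleton)
  also have "\<dots> \<le> c\<^sup>2 * ext_gain g \<zeta>" using V_ext_left[of \<zeta> "1 / 2"] assms by simp
  finally show ?thesis .
qed

lemma loss_half_le: "loss (1 / 2) b \<le> c\<^sup>2 * g"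
  using V_pair_loss[of "1 / 2" b] V_two_ge[of "1 / 2" b] by (simp add: V_singleton V2_def)

text \<open>On the side of the centre where b lies, b loses no more than a point in the centre
  would; the other side is a plain two-point bound.\<close>

lemma V_one_inner:
  assumes b: "0 \<le> b" "b \<le> 1" and z: "1 / (2 * c) \<le> zL" "1 / (2 * c) \<le> zR"
  shows "variance0 - c\<^sup>2 * ext_gain g zL - c\<^sup>2 * ext_gain g zR \<le> V P {b, 1 / 2 - c * zL, 1 / 2 + c * zR}"
proof -
  have cz: "1 / 2 \<le> c * zL" "1 / 2 \<le> c * zR" using z width_pos by (auto simp: field_simps)
  note * = V_single_two_ext[of b "1 / 2 - c * zL" "1 / 2 + c * zR"]
    V_pair_loss[of b "1 / 2 - c * zL"] V_pair_loss[of b "1 / 2 + c * zR"]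
  show ?thesis
  proof (cases "1 / 2 \<le> b")
    case True
    then show ?thesis using * loss_half_right[of b zR] V_ext_left[of zL b] b cz by linarith
  next
    case False
    then show ?thesis using * loss_half_left[of b zL] V_ext_right[of b zR] b cz by linarith
  qed
qed

text \<open>If both points lie in the same half, the outer one counts as an addition to the inner
  one, worth at most g, and the external point behind it is charged against the outer one.\<close>

lemma V_two_inner:
  assumes b: "0 \<le> b" "b \<le> d" "d \<le> 1" and z: "1 / (2 * c) \<le> zL" "1 / (2 * c) \<le> zR"
  shows "V2 - c\<^sup>2 * ext_gain g zL - c\<^sup>2 * ext_gain g zR \<le> V P {b, d, 1 / 2 - c * zL, 1 / 2 + c * zR}"
proof -
  have cz: "1 / 2 \<le> c * zL" "1 / 2 \<le> c * zR" using z width_pos by (auto simp: field_simps)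
  consider "b \<le> 1 / 2" "1 / 2 \<le> d" | "d \<le> 1 / 2" | "1 / 2 \<le> b" by linarith
  then show ?thesis
  proof cases
    case 1
    then show ?thesis
      using V_pair_two_ext[of b d "1 / 2 - c * zL" "1 / 2 + c * zR"] loss_half_left[of b zL]
        loss_half_right[of d zR] V_two_ge[of b d] b cz by linarith
  next
    case 2
    have "loss d b \<le> c\<^sup>2 * g"
      using loss_left_mono[of b d "1 / 2"] loss_half_le[of b] 2 b by linarith
    then show ?thesis
      using V_chain_ext[of d "1 / 2 + c * zR" b "1 / 2 - c * zL"] loss_half_left[of b zL]
        V_ext_right[of d zR] 2 b cz unfolding V2_def by linarith
  next
    case 3
    have "loss b d \<le> c\<^sup>2 * g"
      using loss_right_antimono[of "1 / 2" b d] loss_half_le[of d] 3 b by linarith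
    moreover have "{d, b, 1 / 2 + c * zR, 1 / 2 - c * zL} = {b, d, 1 / 2 - c * zL, 1 / 2 + c * zR}" by auto
    ultimately show ?thesis
      using V_chain_ext[of b "1 / 2 - c * zL" d "1 / 2 + c * zR"] loss_half_right[of d zR]
        V_ext_left[of zL b] 3 b cz unfolding V2_def by simp
  qed
qed

text \<open>At the price c^2 g per point, one and two points make a cell equally expensive. No point
  is the case of \<open>V_two_ext\<close>, and three or more pay enough by
  \<open>variance_le\<close>. The claims are left to be paid by the external points.\<close>

lemma cell_bound:
  assumes N: "finite N" "N \<subseteq> {0..1}" and z: "1 / (2 * c) \<le> zL" "1 / (2 * c) \<le> zR"
  shows "variance0 + c\<^sup>2 * g \<le> V P (N \<union> {1 / 2 - c * zL, 1 / 2 + c * zR}) + c\<^sup>2 * g * card N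
    + c\<^sup>2 * (claim (card N) zL + claim (card N) zR)"
proof -
  consider "card N = 0" | "card N = 1" | "card N = 2" | "3 \<le> card N" by linarith
  then show ?thesis
  proof cases
    case 1
    then have "N = {}" using N by simp
    then show ?thesis using V_two_ext[OF z] by (simp add: claim_def algebra_simps)
  next
    case 2
    then obtain b where b: "N = {b}" by (auto simp: card_1_singleton_iff)
    then have "N \<union> {1 / 2 - c * zL, 1 / 2 + c * zR} = {b, 1 / 2 - c * zL, 1 / 2 + c * zR}" by auto
    then show ?thesis using V_one_inner[of b, OF _ _ z] N b by (simp add: claim_def distrib_left)
  next
    case 3
    then obtain x y where xy: "N = {x, y}" "x \<noteq> y" by (auto simp: card_2_iff)
    obtain b d where b: "N = {b, d}" "b \<le> d"
      using xy by (metis insert_commute linear)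
    then have N_eq: "N \<union> {1 / 2 - c * zL, 1 / 2 + c * zR} = {b, d, 1 / 2 - c * zL, 1 / 2 + c * zR}" by auto
    have "c\<^sup>2 * (claim (card N) zL + claim (card N) zR) = c\<^sup>2 * ext_gain g zL + c\<^sup>2 * ext_gain g zR"
      using 3 by (simp add: claim_def distrib_left)
    moreover have "c\<^sup>2 * g * card N = 2 * (c\<^sup>2 * g)" using 3 by simp
    moreover have "variance0 - c\<^sup>2 * g - c\<^sup>2 * ext_gain g zL - c\<^sup>2 * ext_gain g zR
        \<le> V P {b, d, 1 / 2 - c * zL, 1 / 2 + c * zR}"
      using V_two_inner[of b d, OF _ b(2) _ z] N b unfolding V2_def by auto
    ultimately show ?thesis unfolding N_eq by linarith
  next
    case 4
    have "c\<^sup>2 * g * 3 \<le> c\<^sup>2 * g * card N" using 4 g_bounds by (intro mult_left_mono) auto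
    moreover have "0 \<le> V P (N \<union> {1 / 2 - c * zL, 1 / 2 + c * zR})" using N by (intro V_nonneg) auto
    moreover have "0 \<le> c\<^sup>2 * (claim (card N) zL + claim (card N) zR)"
      using 4 ext_gain_nonneg by (auto simp: claim_def)
    ultimately show ?thesis using variance_le by linarith
  qed
qed

text \<open>The two points at half a gap width from \<open>[0, 1]\<close>, in coordinates in which a cell is
  \<open>[0, 1]\<close>.\<close>
definition E :: "real set" where "E = {1 / 2 - c * (rho / 2), 1 / 2 + c * (rho / 2)}"

section \<open>Lagrangian bounds and their inheritance by finer levels\<close>

definition penalized :: "real \<Rightarrow> real \<Rightarrow> bool" where
  "penalized \<nu> \<Phi> \<longleftrightarrow> (\<forall>\<alpha>. finite \<alpha> \<longrightarrow> \<Phi> \<le> V P (\<alpha> \<union> E) + \<nu> * card \<alpha>)"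

lemma E_eq: "E = {- (1 - 3 * r) / (4 * r), (1 + r) / (4 * r)}"
proof -
  have *: "c * (rho / 2) = (1 - r) / (4 * r)" using c_rho by simp
  have "1 / 2 - (1 - r) / (4 * r) = - (1 - 3 * r) / (4 * r)"
    "1 / 2 + (1 - r) / (4 * r) = (1 + r) / (4 * r)"
    using r_pos by (simp_all add: field_simps)
  then show ?thesis unfolding E_def * by metis
qed

definition rescale :: "nat \<Rightarrow> real \<Rightarrow> real" where
  "rescale j x = (x - (real j - 1) / 2 * (1 - r)) / r"

lemma V_rescale:
  assumes "finite A" "A \<noteq> {}"
  shows "V P A = r\<^sup>2 / 3 * (V P (rescale 1 ` A) + V P (rescale 2 ` A) + V P (rescale 3 ` A))"
  using V_scale[OF assms] unfolding rescale_def[symmetric] by (simp add: algebra_simps)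

lemma nearer_left: "a \<le> e \<Longrightarrow> e \<le> x \<Longrightarrow> (x - e)\<^sup>2 \<le> (x - a)\<^sup>2" for a e x :: real
  by (intro power_mono) auto

lemma nearer_right: "e \<le> a \<Longrightarrow> x \<le> e \<Longrightarrow> (x - e)\<^sup>2 \<le> (x - a)\<^sup>2" for a e x :: real
  using nearer_left[of "- a" "- e" "- x"] by (simp add: power2_commute)

lemma E_outside: "- (1 - 3 * r) / (4 * r) \<le> 0" "1 \<le> (1 + r) / (4 * r)"
  using r_pos r3 by (auto simp: field_simps)

lemma V_mono_ends:
  assumes A: "finite A" and B: "finite B" "e1 \<in> B" "e2 \<in> B" "e1 \<le> 0" "1 \<le> e2"
    and "A \<noteq> {}" and cover: "\<And>a. a \<in> A \<Longrightarrow> a \<in> B \<or> a \<le> e1 \<or> e2 \<le> a"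
  shows "V P B \<le> V P A"
proof (rule V_mono)
  fix x a :: real assume x: "x \<in> {0..1}" and a: "a \<in> A"
  consider "a \<in> B" | "a \<le> e1" | "e2 \<le> a" using cover[OF a] by blast
  then show "\<exists>b\<in>B. (x - b)\<^sup>2 \<le> (x - a)\<^sup>2"
  proof cases
    case 2
    then show ?thesis using nearer_left[of a e1 x] x B by (intro bexI[of _ e1]) auto
  next
    case 3
    then show ?thesis using nearer_right[of e2 a x] x B by (intro bexI[of _ e2]) auto
  qed blast
qed (use assms in auto)

lemma penalized_step:
  assumes "penalized \<nu> \<Phi>" "0 \<le> \<nu>"
  shows "penalized (r\<^sup>2 / 3 * \<nu>) (r\<^sup>2 * \<Phi>)"
  unfolding penalized_def
proof (intro allI impI)
  fix \<alpha> :: "real set" assume fin: "finite \<alpha>"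
  \<comment> \<open>The cuts (1 + r) / 4 and (3 - r) / 4 are the midpoints of the gaps.
    \<open>rescale\<close> sends them to the points of \<open>E\<close>, which can therefore replace
    all points assigned to other cells.\<close>
  define A1 A2 A3 where "A1 = {a \<in> \<alpha>. a \<le> (1 + r) / 4}"
    and "A2 = {a \<in> \<alpha>. (1 + r) / 4 < a \<and> a \<le> (3 - r) / 4}" and "A3 = {a \<in> \<alpha>. (3 - r) / 4 < a}"
  have finA: "finite A1" "finite A2" "finite A3" using fin by (auto simp: A1_def A2_def A3_def)
  have "\<alpha> = A1 \<union> A2 \<union> A3" by (auto simp: A1_def A2_def A3_def)
  have "(1 + r) / 4 \<le> (3 - r) / 4" using r3 by simp
  then have card: "card \<alpha> = card A1 + card A2 + card A3"
    unfolding \<open>\<alpha> = A1 \<union> A2 \<union> A3\<close> using finA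
    by (subst card_Un_disjoint, auto simp: A1_def A2_def A3_def)+
  define e1 e2 where "e1 = - (1 - 3 * r) / (4 * r)" and "e2 = (1 + r) / (4 * r)"
  have E: "E = {e1, e2}" by (simp add: E_eq e1_def e2_def)
  have e: "e1 \<le> 0" "1 \<le> e2" using E_outside by (auto simp: e1_def e2_def)
  have part: "\<Phi> \<le> V P (rescale j ` (\<alpha> \<union> E)) + \<nu> * card B"
    if fB: "finite B" and cover: "\<And>a. a \<in> \<alpha> \<union> E \<Longrightarrow> a \<in> B \<or> rescale j a \<le> e1 \<or> e2 \<le> rescale j a" for j B
  proof -
    have "V P (rescale j ` B \<union> E) \<le> V P (rescale j ` (\<alpha> \<union> E))"
      by (rule V_mono_ends[of _ _ e1 e2]) (use fB fin e cover in \<open>auto simp: E\<close>)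
    moreover have "\<Phi> \<le> V P (rescale j ` B \<union> E) + \<nu> * card (rescale j ` B)"
      using assms(1) fB by (simp add: penalized_def)
    moreover have "\<nu> * card (rescale j ` B) \<le> \<nu> * card B"
      using fB assms(2) by (intro mult_left_mono) (auto intro: card_image_le)
    ultimately show ?thesis by linarith
  qed
  have p1: "\<Phi> \<le> V P (rescale 1 ` (\<alpha> \<union> E)) + \<nu> * card A1"
  proof (rule part[OF finA(1)])
    fix a assume "a \<in> \<alpha> \<union> E"
    consider "a \<in> A1" | "(1 + r) / 4 < a" | "a = e1"
      using \<open>a \<in> \<alpha> \<union> E\<close> e r3 unfolding E A1_def by force
    then show "a \<in> A1 \<or> rescale 1 a \<le> e1 \<or> e2 \<le> rescale 1 a"
    proof cases
      case 2
      then have "(1 + r) / 4 / r \<le> a / r" using r_pos by (intro divide_right_mono) auto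
      then show ?thesis by (simp add: rescale_def e2_def)
    next
      case 3
      \<comment> \<open>Rescaling moves the old e1 outwards, so the new e1 dominates it.\<close>
      then have "a / r \<le> a / 1" using e r_pos r3 by (intro divide_left_mono_neg) auto
      then show ?thesis using 3 by (simp add: rescale_def)
    qed blast
  qed
  have p2: "\<Phi> \<le> V P (rescale 2 ` (\<alpha> \<union> E)) + \<nu> * card A2"
  proof (rule part[OF finA(2)])
    fix a assume "a \<in> \<alpha> \<union> E"
    consider "a \<in> A2" | "a \<le> (1 + r) / 4" | "(3 - r) / 4 < a"
      using \<open>a \<in> \<alpha> \<union> E\<close> e r3 r_pos unfolding E A2_def by force
    then show "a \<in> A2 \<or> rescale 2 a \<le> e1 \<or> e2 \<le> rescale 2 a"
    proof cases
      case 2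
      then have "rescale 2 a \<le> ((1 + r) / 4 - (1 - r) / 2) / r"
        using r_pos unfolding rescale_def by (intro divide_right_mono) auto
      also have "\<dots> = e1" using r_pos by (simp add: e1_def field_simps)
      finally show ?thesis by blast
    next
      case 3
      have "e2 = ((3 - r) / 4 - (1 - r) / 2) / r" using r_pos by (simp add: e2_def field_simps)
      also have "\<dots> \<le> rescale 2 a"
        using 3 r_pos unfolding rescale_def by (intro divide_right_mono) auto
      finally show ?thesis by blast
    qed blast
  qed
  have p3: "\<Phi> \<le> V P (rescale 3 ` (\<alpha> \<union> E)) + \<nu> * card A3"
  proof (rule part[OF finA(3)])
    fix a assume "a \<in> \<alpha> \<union> E"
    consider "a \<in> A3" | "a \<le> (3 - r) / 4" | "a = e2"
      using \<open>a \<in> \<alpha> \<union> E\<close> e r3 unfolding E A3_def by force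
    then show "a \<in> A3 \<or> rescale 3 a \<le> e1 \<or> e2 \<le> rescale 3 a"
    proof cases
      case 2
      then have "rescale 3 a \<le> ((3 - r) / 4 - (1 - r)) / r"
        using r_pos unfolding rescale_def by (intro divide_right_mono) auto
      also have "\<dots> = e1" using r_pos by (simp add: e1_def field_simps)
      finally show ?thesis by blast
    next
      case 3
      have "0 \<le> (e2 - 1) * (1 - r)" using e r3 by simp
      then have "e2 \<le> rescale 3 e2" using r_pos by (simp add: rescale_def field_simps)
      then show ?thesis using 3 by simp
    qed blast
  qed
  have "3 * \<Phi> \<le> V P (rescale 1 ` (\<alpha> \<union> E)) + V P (rescale 2 ` (\<alpha> \<union> E)) + V P (rescale 3 ` (\<alpha> \<union> E))
      + \<nu> * card \<alpha>"
    using p1 p2 p3 unfolding card by (simp add: algebra_simps)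
  then have "r\<^sup>2 / 3 * (3 * \<Phi>) \<le> r\<^sup>2 / 3 * (V P (rescale 1 ` (\<alpha> \<union> E)) + V P (rescale 2 ` (\<alpha> \<union> E))
      + V P (rescale 3 ` (\<alpha> \<union> E)) + \<nu> * card \<alpha>)"
    by (rule mult_left_mono) simp
  then show "r\<^sup>2 * \<Phi> \<le> V P (\<alpha> \<union> E) + r\<^sup>2 / 3 * \<nu> * card \<alpha>"
    using V_rescale[of "\<alpha> \<union> E"] fin by (simp add: E distrib_left)
qed

lemma penalized_iterate:
  assumes "penalized \<nu> \<Phi>" "0 \<le> \<nu>"
  shows "penalized ((r\<^sup>2 / 3) ^ l * \<nu>) ((r\<^sup>2) ^ l * \<Phi>)"
proof (induction l)
  case (Suc l)
  then show ?case
    using penalized_step[OF Suc] assms(2) by (simp add: mult.assoc)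
qed (use assms in simp)

lemma penalizedD:
  assumes "penalized \<nu> \<Phi>" "finite \<alpha>" "\<alpha> \<noteq> {}"
  shows "\<Phi> \<le> V P \<alpha> + \<nu> * card \<alpha>"
proof -
  have "\<Phi> \<le> V P (\<alpha> \<union> E) + \<nu> * card \<alpha>" using assms by (simp add: penalized_def)
  moreover have "V P (\<alpha> \<union> E) \<le> V P \<alpha>" using assms by (intro V_antimono) (auto simp: E_def)
  ultimately show ?thesis by linarith
qed

lemma far_edges:
  "1 / (2 * c) \<le> rho - 1 / (2 * c)" "r * (c * (rho - 1 / (2 * c))) = (1 - r) / 2 - r / 2"
  "c * (1 / (2 * c)) = 1 / 2"
proof -
  show h: "c * (1 / (2 * c)) = 1 / 2" using width_pos by simp
  have "r * (c * rho) = (1 - r) / 2" using c_rho r_pos by simp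
  then show eq: "r * (c * (rho - 1 / (2 * c))) = (1 - r) / 2 - r / 2"
    using h by (simp add: algebra_simps)
  have "r * (c * (1 / (2 * c))) \<le> r * (c * (rho - 1 / (2 * c)))" unfolding eq h using r3 by simp
  then show "1 / (2 * c) \<le> rho - 1 / (2 * c)"
    using r_pos width_pos by (simp only: mult_le_cancel_left_pos)
qed

text \<open>In the following lemma \<open>C\<close> is the centre of a cell and \<open>C + (1 - r) / 2\<close> the centre of
  its right neighbour.\<close>
lemma gap_claims:
  fixes C :: real and A :: "real set"
  assumes fin: "finite A"
  defines "G \<equiv> {a \<in> A. C + r / 2 < a \<and> a < C + (1 - r) / 2 - r / 2}"
  obtains z z' where "1 / (2 * c) \<le> z" "1 / (2 * c) \<le> z'" "claim k z + claim k' z' \<le> g * card G"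
    "\<forall>a\<in>A. a \<le> C + r / 2 \<or> C + r * (c * z) \<le> a"
    "\<forall>a\<in>A. C + (1 - r) / 2 - r / 2 \<le> a \<or> a \<le> C + (1 - r) / 2 - r * (c * z')"
proof -
  have half: "c * (1 / (2 * c)) = 1 / 2" using width_pos by simp
  have cr: "r * (c * rho) = (1 - r) / 2" using c_rho r_pos by simp
  note le = far_edges(1)
  have finG: "finite G" using fin by (simp add: G_def)
  consider "card G = 0" | "card G = 1" | "2 \<le> card G" by linarith
  then show ?thesis
  proof cases
    case 1
    then have "G = {}" using finG by simp
    \<comment> \<open>If the gap is empty, the nearest foreign point is at best the near end of the
      neighbouring cell.\<close>
    have "r * (c * (rho - 1 / (2 * c))) = (1 - r) / 2 - r / 2"
      using cr half by (simp add: algebra_simps)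
    then show ?thesis
      using \<open>G = {}\<close> le claim_far[of k] claim_far[of k']
      by (intro that[of "rho - 1 / (2 * c)" "rho - 1 / (2 * c)"]) (force simp: G_def)+
  next
    case 2
    then obtain d where d: "G = {d}" by (auto simp: card_1_singleton_iff)
    then have d': "C + r / 2 < d" "d < C + (1 - r) / 2 - r / 2" by (auto simp: G_def)
    \<comment> \<open>A single point d is external to both cells, at distances z and rho -
      z.\<close>
    define z where "z = (d - C) / (r * c)"
    have rc: "0 < r * c" using r_pos width_pos by simp
    have z: "r * (c * z) = d - C" unfolding z_def using r_pos width_pos by simp
    have "r * (c * (rho - z)) = r * (c * rho) - r * (c * z)" by (simp add: algebra_simps)
    then have z': "r * (c * (rho - z)) = (1 - r) / 2 - (d - C)" unfolding z cr .
    have rhalf: "r * c * (1 / (2 * c)) = r / 2" using width_pos by simp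
    have "r * c * (1 / (2 * c)) \<le> r * c * z" unfolding rhalf mult.assoc[of r c z] z using d' by simp
    then have "1 / (2 * c) \<le> z" using rc by (simp only: mult_le_cancel_left_pos)
    moreover have "r * c * (1 / (2 * c)) \<le> r * c * (rho - z)"
      unfolding rhalf mult.assoc[of r c "rho - z"] z' using d' by argo
    then have "1 / (2 * c) \<le> rho - z" using rc by (simp only: mult_le_cancel_left_pos)
    moreover have "a \<le> C + r / 2 \<or> d \<le> a" "C + (1 - r) / 2 - r / 2 \<le> a \<or> a \<le> d" if "a \<in> A" for a
    proof -
      have "a \<le> C + r / 2 \<or> C + (1 - r) / 2 - r / 2 \<le> a \<or> a = d"
        using that d unfolding G_def by (metis (mono_tags, lifting) mem_Collect_eq not_le singletonD)
      then show "a \<le> C + r / 2 \<or> d \<le> a" "C + (1 - r) / 2 - r / 2 \<le> a \<or> a \<le> d" using d' by auto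
    qed
    ultimately show ?thesis
      using claim_crossing[of k z k'] 2
      by (intro that[of z "rho - z"]) (auto simp: z z')
  next
    case 3
    \<comment> \<open>Two points pay g to each cell, so both may be placed at the cell ends.\<close>
    have "claim k (1 / (2 * c)) + claim k' (1 / (2 * c)) \<le> g * 2"
      using claim_le[of k] claim_le[of k'] by (smt (verit))
    also have "\<dots> \<le> g * card G" using 3 g_bounds by (intro mult_left_mono) auto
    finally show ?thesis
      using width_pos by (intro that[of "1 / (2 * c)" "1 / (2 * c)"]) auto
  qed
qed

text \<open>A point inside a cell pays for itself in \<open>cell_bound\<close>; points in a gap pay
  the claims of the two adjacent cells by \<open>gap_claims\<close>. Points outside [0, 1] have only
  one claimant, and one of them covers it.\<close>

lemma penalized_base1: "penalized (r\<^sup>2 / 3 * (c\<^sup>2 * g)) (r\<^sup>2 * (variance0 + c\<^sup>2 * g))"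
  unfolding penalized_def
proof (intro allI impI)
  fix \<alpha> :: "real set" assume fin: "finite \<alpha>"
  define A where "A = \<alpha> \<union> E"
  have finA: "finite A" using fin by (simp add: A_def E_def)
  define e1 e2 where "e1 = - (1 - 3 * r) / (4 * r)" and "e2 = (1 + r) / (4 * r)"
  have E: "E = {e1, e2}" by (simp add: E_eq e1_def e2_def)
  have e: "e1 < 0" "1 < e2" using r_pos r3 by (auto simp: e1_def e2_def field_simps)
  define N1 N2 N3 where "N1 = {a \<in> \<alpha>. 0 \<le> a \<and> a \<le> r}"
    and "N2 = {a \<in> \<alpha>. (1 - r) / 2 \<le> a \<and> a \<le> (1 + r) / 2}" and "N3 = {a \<in> \<alpha>. 1 - r \<le> a \<and> a \<le> 1}"
  define G0 G1 G2 G3 where "G0 = {a \<in> \<alpha>. a < 0}" and "G1 = {a \<in> \<alpha>. r < a \<and> a < (1 - r) / 2}"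
    and "G2 = {a \<in> \<alpha>. (1 + r) / 2 < a \<and> a < 1 - r}" and "G3 = {a \<in> \<alpha>. 1 < a}"
  note defs = N1_def N2_def N3_def G0_def G1_def G2_def G3_def
  have card: "card \<alpha> = card G0 + card N1 + card G1 + card N2 + card G2 + card N3 + card G3"
  proof -
    have "\<alpha> = G0 \<union> (N1 \<union> (G1 \<union> (N2 \<union> (G2 \<union> (N3 \<union> G3)))))" by (auto simp: defs)
    also have "card \<dots> = card G0 + (card N1 + (card G1 + (card N2 + (card G2 + (card N3 + card G3)))))"
      using fin r_pos r3 by (subst card_Un_disjoint, simp add: defs, simp add: defs, force simp: defs)+ simp
    finally show ?thesis by simp
  qed
  define k1 k2 k3 where "k1 = card N1" and "k2 = card N2" and "k3 = card N3"
  note far = far_edges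
  obtain z0 where z0: "1 / (2 * c) \<le> z0" "claim k1 z0 \<le> g * card G0"
    "\<And>a. a \<in> A \<Longrightarrow> 0 \<le> a \<or> a \<le> r / 2 - r * (c * z0)"
  proof (cases "G0 = {}")
    case True
    \<comment> \<open>Only e1 is left below 0. It is at least as far away as the end of a
      neighbouring cell would be, so \<open>claim_far\<close> applies.\<close>
    have "e1 \<le> r / 2 - r * (c * (rho - 1 / (2 * c)))"
    proof -
      have "0 \<le> (1 - 3 * r) * (1 - 2 * r)" using r3 by simp
      then show ?thesis unfolding far(2) e1_def using r_pos by (simp add: field_simps)
    qed
    moreover have "0 \<le> a" if "a \<in> \<alpha>" for a using True that by (auto simp: G0_def not_less)
    ultimately have "0 \<le> a \<or> a \<le> r / 2 - r * (c * (rho - 1 / (2 * c)))" if "a \<in> A" for a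
      using that e unfolding A_def E by auto
    then show ?thesis
      using True far(1) claim_far[of k1] by (intro that[of "rho - 1 / (2 * c)"]) auto
  next
    case False
    then have "1 \<le> card G0" using fin by (simp add: G0_def card_gt_0_iff Suc_le_eq)
    then have "g * 1 \<le> g * card G0" using g_bounds by (intro mult_left_mono) auto
    then show ?thesis using claim_le[of k1 "1 / (2 * c)"] far(3)
      by (intro that[of "1 / (2 * c)"]) auto
  qed
  obtain z3 where z3: "1 / (2 * c) \<le> z3" "claim k3 z3 \<le> g * card G3"
    "\<And>a. a \<in> A \<Longrightarrow> a \<le> 1 \<or> 1 - r / 2 + r * (c * z3) \<le> a"
  proof (cases "G3 = {}")
    case True
    have "1 - r / 2 + r * (c * (rho - 1 / (2 * c))) \<le> e2"
    proof -
      have "0 \<le> (1 - 3 * r) * (1 - 2 * r)" using r3 by simp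
      then show ?thesis unfolding far(2) e2_def using r_pos by (simp add: field_simps)
    qed
    moreover have "a \<le> 1" if "a \<in> \<alpha>" for a using True that by (auto simp: G3_def not_less)
    ultimately have "a \<le> 1 \<or> 1 - r / 2 + r * (c * (rho - 1 / (2 * c))) \<le> a" if "a \<in> A" for a
      using that e unfolding A_def E by auto
    then show ?thesis
      using True far(1) claim_far[of k3] by (intro that[of "rho - 1 / (2 * c)"]) auto
  next
    case False
    then have "1 \<le> card G3" using fin by (simp add: G3_def card_gt_0_iff Suc_le_eq)
    then have "g * 1 \<le> g * card G3" using g_bounds by (intro mult_left_mono) auto
    then show ?thesis using claim_le[of k3 "1 / (2 * c)"] far(3)
      by (intro that[of "1 / (2 * c)"]) auto
  qed
  have eq1: "r / 2 + r / 2 = r" "r / 2 + (1 - r) / 2 = 1 / 2" "1 / 2 - r / 2 = (1 - r) / 2"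
    by (simp_all add: field_simps)
  have G1: "{a \<in> A. r / 2 + r / 2 < a \<and> a < r / 2 + (1 - r) / 2 - r / 2} = G1"
    unfolding eq1 A_def E G1_def using e r_pos r3 by auto
  obtain z1 z1' where z1: "1 / (2 * c) \<le> z1" "1 / (2 * c) \<le> z1'"
    "claim k1 z1 + claim k2 z1' \<le> g * card G1"
    "\<forall>a\<in>A. a \<le> r / 2 + r / 2 \<or> r / 2 + r * (c * z1) \<le> a"
    "\<forall>a\<in>A. r / 2 + (1 - r) / 2 - r / 2 \<le> a \<or> a \<le> r / 2 + (1 - r) / 2 - r * (c * z1')"
    by (rule gap_claims[OF finA, where C = "r / 2" and k = k1 and k' = k2, unfolded G1])
  note z1 = z1[unfolded eq1]
  have eq2: "1 / 2 + r / 2 = (1 + r) / 2" "1 / 2 + (1 - r) / 2 = 1 - r / 2" "1 - r / 2 - r / 2 = 1 - r"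
    by (simp_all add: field_simps)
  have G2: "{a \<in> A. 1 / 2 + r / 2 < a \<and> a < 1 / 2 + (1 - r) / 2 - r / 2} = G2"
    unfolding eq2 A_def E G2_def using e r_pos r3 by auto
  obtain z2 z2' where z2: "1 / (2 * c) \<le> z2" "1 / (2 * c) \<le> z2'"
    "claim k2 z2 + claim k3 z2' \<le> g * card G2"
    "\<forall>a\<in>A. a \<le> 1 / 2 + r / 2 \<or> 1 / 2 + r * (c * z2) \<le> a"
    "\<forall>a\<in>A. 1 / 2 + (1 - r) / 2 - r / 2 \<le> a \<or> a \<le> 1 / 2 + (1 - r) / 2 - r * (c * z2')"
    by (rule gap_claims[OF finA, where C = "1 / 2" and k = k2 and k' = k3, unfolded G2])
  note z2 = z2[unfolded eq2]
  have cell: "variance0 + c\<^sup>2 * g \<le> V P (rescale j ` A) + c\<^sup>2 * g * card N + c\<^sup>2 * (claim (card N) zL + claim (card N) zR)"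
    if N: "N = {a \<in> \<alpha>. C - r / 2 \<le> a \<and> a \<le> C + r / 2}" and C: "C = (real j - 1) / 2 * (1 - r) + r / 2"
      and z: "1 / (2 * c) \<le> zL" "1 / (2 * c) \<le> zR" and bd: "0 \<le> C - r / 2" "C + r / 2 \<le> 1"
      and L: "\<And>a. a \<in> A \<Longrightarrow> C - r / 2 \<le> a \<or> a \<le> C - r * (c * zL)"
      and R: "\<And>a. a \<in> A \<Longrightarrow> a \<le> C + r / 2 \<or> C + r * (c * zR) \<le> a" for N C j zL zR
  proof -
    have resc: "rescale j a = 1 / 2 + (a - C) / r" for a
      using r_pos by (simp add: rescale_def C field_simps)
    have cz: "1 / 2 \<le> c * zL" "1 / 2 \<le> c * zR" using z width_pos by (auto simp: field_simps)
    have finN: "finite N" using fin by (simp add: N)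
    have inj: "inj_on (rescale j) N" using r_pos by (auto simp: inj_on_def resc)
    have sub: "rescale j ` N \<subseteq> {0..1}" using r_pos by (auto simp: N resc field_simps)
    have "V P (rescale j ` N \<union> {1 / 2 - c * zL, 1 / 2 + c * zR}) \<le> V P (rescale j ` A)"
    proof (rule V_mono_ends[of _ _ "1 / 2 - c * zL" "1 / 2 + c * zR"])
      fix b assume "b \<in> rescale j ` A"
      then obtain a where a: "a \<in> A" "b = rescale j a" by blast
      consider "a \<in> N" | "a \<le> C - r * (c * zL)" | "C + r * (c * zR) \<le> a"
        using L[OF a(1)] R[OF a(1)] a(1) e bd unfolding A_def E N by force
      then show "b \<in> rescale j ` N \<union> {1 / 2 - c * zL, 1 / 2 + c * zR} \<or> b \<le> 1 / 2 - c * zL \<or> 1 / 2 + c * zR \<le> b"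
      proof cases
        case 2
        then have "(a - C) / r \<le> - (c * zL)" using r_pos by (simp add: field_simps)
        then show ?thesis using a resc by simp
      next
        case 3
        then have "c * zR \<le> (a - C) / r" using r_pos by (simp add: field_simps)
        then show ?thesis using a resc by simp
      qed (use a in blast)
    qed (use finA finN cz in \<open>auto simp: A_def E\<close>)
    moreover have "variance0 + c\<^sup>2 * g \<le> V P (rescale j ` N \<union> {1 / 2 - c * zL, 1 / 2 + c * zR})
        + c\<^sup>2 * g * card (rescale j ` N) + c\<^sup>2 * (claim (card (rescale j ` N)) zL + claim (card (rescale j ` N)) zR)"
      using finN sub z by (intro cell_bound) auto
    ultimately show ?thesis unfolding card_image[OF inj] by linarith
  qed
  have c1: "variance0 + c\<^sup>2 * g \<le> V P (rescale 1 ` A) + c\<^sup>2 * g * k1 + c\<^sup>2 * (claim k1 z0 + claim k1 z1)"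
    unfolding k1_def
    by (rule cell[of _ "r / 2"]) (use z0 z1 r_pos r3 in \<open>auto simp: N1_def k1_def\<close>)
  have c2: "variance0 + c\<^sup>2 * g \<le> V P (rescale 2 ` A) + c\<^sup>2 * g * k2 + c\<^sup>2 * (claim k2 z1' + claim k2 z2)"
    unfolding k2_def
    by (rule cell[of _ "1 / 2"]) (use z1 z2 r_pos r3 in \<open>auto simp: N2_def k2_def field_simps\<close>)
  have c3: "variance0 + c\<^sup>2 * g \<le> V P (rescale 3 ` A) + c\<^sup>2 * g * k3 + c\<^sup>2 * (claim k3 z2' + claim k3 z3)"
    unfolding k3_def
    by (rule cell[of _ "1 - r / 2"]) (use z2 z3 r_pos r3 in \<open>auto simp: N3_def k3_def field_simps\<close>)
  have "c\<^sup>2 * (claim k1 z0 + (claim k1 z1 + claim k2 z1') + (claim k2 z2 + claim k3 z2') + claim k3 z3)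
      \<le> c\<^sup>2 * (g * card G0 + g * card G1 + g * card G2 + g * card G3)"
    using z0(2) z1(3) z2(3) z3(2) by (intro mult_left_mono add_mono) auto
  then have "3 * (variance0 + c\<^sup>2 * g)
      \<le> V P (rescale 1 ` A) + V P (rescale 2 ` A) + V P (rescale 3 ` A) + c\<^sup>2 * g * card \<alpha>"
    using c1 c2 c3 unfolding card k1_def[symmetric] k2_def[symmetric] k3_def[symmetric]
    by (simp add: algebra_simps)
  then have "r\<^sup>2 / 3 * (3 * (variance0 + c\<^sup>2 * g))
      \<le> r\<^sup>2 / 3 * (V P (rescale 1 ` A) + V P (rescale 2 ` A) + V P (rescale 3 ` A) + c\<^sup>2 * g * card \<alpha>)"
    by (rule mult_left_mono) simp
  then show "r\<^sup>2 * (variance0 + c\<^sup>2 * g) \<le> V P (\<alpha> \<union> E) + r\<^sup>2 / 3 * (c\<^sup>2 * g) * card \<alpha>"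
    using V_rescale[OF finA] by (simp add: A_def E distrib_left)
qed

end

section \<open>Uselessness of external points for two means\<close>

lemma quadratic_lower:
  fixes x m X u :: real
  assumes "0 \<le> u" "0 \<le> X" "m\<^sup>2 \<le> X * u"
  shows "- X \<le> u * x\<^sup>2 + 2 * m * x"
proof (cases "u = 0")
  case True
  then show ?thesis using assms by simp
next
  case False
  then have u: "0 < u" using assms by simp
  have "0 \<le> (u * x + m)\<^sup>2" by simp
  then have "u * (- X) \<le> u * (u * x\<^sup>2 + 2 * m * x)"
    using assms(3) by (simp add: power2_eq_square algebra_simps)
  then show ?thesis using u by (simp only: mult_le_cancel_left_pos)
qed

context ratio
begin

text \<open>Here \<open>h\<close> is the centre of \<open>J\<^bsub>33\<^esub>\<close> and \<open>B\<close> the mirror image of the external point in the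
  end point \<open>1\<close>, both relative to \<open>1 / 2\<close> and in units of \<open>width r\<close>; the second subtracted square
  is the cost of serving \<open>J\<^bsub>33\<^esub>\<close> from \<open>B\<close>.\<close>
lemma two_points_with_ext:
  assumes X: "lorenz_set r X" and um: "(u, m) \<in> X" and u: "u \<le> 2 / 3" and r: "1 / 5 \<le> r"
    and h: "h = 2 / 3 * (1 + r)" and B: "B * (3 * r * (1 - r)) = 5 * r - 1"
    and b: "0 \<le> b" "b \<le> B"
  shows "- gain r \<le> u * x\<^sup>2 + 2 * m * x + (1 - u) * b\<^sup>2 - 2 * b * m - ((h - b)\<^sup>2 - (h - B)\<^sup>2) / 9"
    (is "_ \<le> ?Q")
proof -
  note um' = lorenz_setD[OF X um]
  have cp: "curve_point (gain r) u m"
    using um' lorenz_set_gain[OF X um] by (simp add: curve_point_def)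
  have rr: "0 < 3 * r * (1 - r)" using r_pos r_less by simp
  have B0: "0 \<le> B" using b by simp
  have Bmono: "B \<le> q" if "5 * r - 1 \<le> q * (3 * r * (1 - r))" for q
    using that rr unfolding B[symmetric] by (simp only: mult_le_cancel_right_pos)
  have B1: "B \<le> 2976 / 10000"
  proof (rule Bmono)
    have "0 \<le> (23177 / 100000 - r) * (41072 + 8928 * (r + 23177 / 100000))"
      using r_pos r_less by (intro mult_nonneg_nonneg) auto
    then show "5 * r - 1 \<le> 2976 / 10000 * (3 * r * (1 - r))" by (simp add: field_simps)
  qed
  have h0: "8 / 10 \<le> h" "h \<le> 8212 / 10000" using h r r_less by auto
  have split: "?Q = (u * x\<^sup>2 + 2 * m * x) + ((8 / 9 - u) * b\<^sup>2 + 2 * (h / 9 - m) * b) - (2 * h * B - B\<^sup>2) / 9"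
    by (simp add: power2_eq_square field_simps)
  \<comment> \<open>Under this condition the expression decreases in b up to B, where the subtracted
    term vanishes and the plain two-point bound remains.\<close>
  have first: "- gain r \<le> ?Q" if I: "B * (8 / 9 - u) \<le> m - h / 9"
  proof -
    have "(8 / 9 - u) * (B + b) \<le> (8 / 9 - u) * (2 * B)" using u b by (intro mult_left_mono) auto
    also have "(8 / 9 - u) * (2 * B) = 2 * (B * (8 / 9 - u))" by simp
    also have "\<dots> \<le> 2 * (m - h / 9)" using I by (intro mult_left_mono) auto
    finally have "(8 / 9 - u) * (B + b) \<le> 2 * (m - h / 9)" .
    then have "0 \<le> (B - b) * (2 * (m - h / 9) - (8 / 9 - u) * (B + b))"
      using b by (intro mult_nonneg_nonneg) auto
    moreover have "?Q = (B - b) * (2 * (m - h / 9) - (8 / 9 - u) * (B + b))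
        - pair_gain (1 - (1 - u)) m (- B) (- x)"
      unfolding pair_gain_def by (simp add: power2_eq_square field_simps)
    moreover have "pair_gain (1 - (1 - u)) m (- B) (- x) \<le> gain r"
      by (rule pair_gain_le_gain) (use cp gain_bounds in auto)
    ultimately show ?thesis by linarith
  qed
  \<comment> \<open>Alternatively x and b are minimised separately: Y is a budget for m^2 / u and Z
    one for (h/9 - m)^2 / (8/9 - u).\<close>
  have second: "- gain r \<le> ?Q"
    if "m\<^sup>2 \<le> Y * u" "(h / 9 - m)\<^sup>2 \<le> Z * (8 / 9 - u)" "0 \<le> Y" "0 \<le> Z"
      "Y + Z + (2 * h * B - B\<^sup>2) / 9 \<le> gain r" for Y Z
    using quadratic_lower[OF _ that(3) that(1), of x] quadratic_lower[OF _ that(4) that(2), of b] u um'(1) that(5)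
    unfolding split by linarith
  have K: "(2 * h * B - B\<^sup>2) / 9 \<le> 44469 / 1000000"
  proof -
    have "2 * h * B \<le> 2 * (8212 / 10000) * B" using h0 B0 by (intro mult_right_mono) auto
    moreover have "0 \<le> (2976 / 10000 - B) * (16424 / 10000 - (B + 2976 / 10000))"
      using B1 by (intro mult_nonneg_nonneg) auto
    ultimately show ?thesis by (simp add: power2_eq_square field_simps)
  qed
  have g1: "22755 / 100000 \<le> gain r"
  proof -
    have "(16 / 15)\<^sup>2 \<le> (1 + r / 3)\<^sup>2" using r by (intro power_mono) auto
    then show ?thesis using gain_bounds(2) by (simp add: power2_eq_square)
  qed
  show ?thesis
    using X um
  proof (cases rule: lorenz_set_cases)
    case (left v k)
    have u3: "u \<le> 1 / 3" using lorenz_setD[OF X left(1)] left by simp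
    show ?thesis
    \<comment> \<open>4/27 is the value of u (1 - u)^2 at u = 1/3, its maximum here, and 32/1000 is
      (2/15)^2 / (8/9 - 1/3).\<close>
    proof (rule second[of "4 / 27" "32 / 1000"])
      have "0 \<le> (1 / 3 - u)\<^sup>2 * (4 / 3 - u)" using u3 by (intro mult_nonneg_nonneg) auto
      then have "u * (1 - u)\<^sup>2 \<le> 4 / 27" by (simp add: power2_eq_square field_simps)
      then have "(u * (1 - u)\<^sup>2) * u \<le> 4 / 27 * u" using um' by (intro mult_right_mono) auto
      moreover have "m\<^sup>2 \<le> (u * (1 - u))\<^sup>2" using um' by (intro power_mono) auto
      ultimately show "m\<^sup>2 \<le> 4 / 27 * u" by (simp add: power2_eq_square algebra_simps)
      have "0 \<le> (1 / 3 - u) * (2 / 3 - u)" using u3 by (intro mult_nonneg_nonneg) auto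
      then have "u * (1 - u) \<le> 2 / 9" by (simp add: field_simps)
      then have "m \<le> 2 / 9" using um'(4) by linarith
      then have "\<bar>h / 9 - m\<bar> \<le> 2 / 15" using um'(3) h0 by (intro abs_leI) linarith+
      then have "\<bar>h / 9 - m\<bar>\<^sup>2 \<le> (2 / 15)\<^sup>2" by (intro power_mono) auto
      also have "(2 / 15)\<^sup>2 \<le> 32 / 1000 * (8 / 9 - u)" using u3 by (simp add: power2_eq_square)
      finally show "(h / 9 - m)\<^sup>2 \<le> 32 / 1000 * (8 / 9 - u)" by simp
      show "4 / 27 + 32 / 1000 + (2 * h * B - B\<^sup>2) / 9 \<le> gain r" using K g1 by linarith
    qed auto
  next
    case (right v k)
    then have uu: "u = 2 / 3" "m \<ge> 0" using lorenz_setD[OF X right(1)] u um' by auto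
    then have v0: "v = 0" using right(2) by simp
    then have "k = 0" using lorenz_setD[OF X right(1)] by simp
    then have "m = 2 / 9" using right(3) v0 by simp
    show ?thesis
    proof (rule first)
      show "B * (8 / 9 - u) \<le> m - h / 9" unfolding uu(1) \<open>m = 2 / 9\<close> using B1 h0 by simp
    qed
  next
    case (middle v k)
    note vk = lorenz_setD[OF X middle(1)]
    have rk: "0 \<le> r / 3 * k" using r_pos vk by simp
    from X middle(1) show ?thesis
    proof (cases rule: lorenz_set_cases)
      case (right w k2)
      have "0 \<le> w" using lorenz_setD[OF X right(1)] by simp
      then have u5: "5 / 9 \<le> u" unfolding middle(2) right(2) by simp
      show ?thesis
      proof (rule first)
        have "B * (8 / 9 - u) \<le> 2976 / 10000 * (1 / 3)" using B0 B1 u5 u by (intro mult_mono) auto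
        also have "\<dots> \<le> m - h / 9" unfolding middle(3) using rk h0 by simp
        finally show "B * (8 / 9 - u) \<le> m - h / 9" .
      qed
    next
      case inner: (middle w k2)
      note wk = lorenz_setD[OF X inner(1)]
      have u4: "4 / 9 \<le> u" unfolding middle(2) inner(2) using wk by simp
      show ?thesis
      proof (rule first)
        have "B * (8 / 9 - u) \<le> 2976 / 10000 * (4 / 9)" using B0 B1 u4 u by (intro mult_mono) auto
        moreover have "r / 3 * (2 / 9) \<le> r / 3 * k"
          unfolding inner(3) using r_pos wk by (intro mult_left_mono) auto
        moreover have "h / 9 = 2 / 27 + r / 3 * (2 / 9)" unfolding h by (simp add: field_simps)
        ultimately show "B * (8 / 9 - u) \<le> m - h / 9" unfolding middle(3) by linarith
      qed
    next
      case (left w k2)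
      note wk = lorenz_setD[OF X left(1)]
      have u_w: "u = 1 / 3 + w / 9" unfolding middle(2) left(2) by (simp add: field_simps)
      have m_w: "m = 2 / 9 + 2 * r / 27 * w + r\<^sup>2 / 9 * k2"
        unfolding middle(3) left(3) by (simp add: power2_eq_square field_simps)
      have k2: "0 \<le> r\<^sup>2 / 9 * k2" using wk by simp
      show ?thesis
      \<comment> \<open>For large w the monotonicity argument still works. Otherwise the budgets of
        the case u \<le> 1/3 are continued linearly in w; the slope 2314/100000 bounds 2 r / 27 +
        r^2 / 9.\<close>
      proof (cases "18 / 25 \<le> w")
        case True
        show ?thesis
        proof (rule first)
          have "B * (8 / 9 - u) \<le> 2976 / 10000 * (5 / 9 - 2 / 25)"
            unfolding u_w using B0 B1 True wk by (intro mult_mono) auto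
          then have le1: "B * (8 / 9 - u) \<le> 1416 / 10000" by simp
          have "r * (1 - w) \<le> 23177 / 100000 * (7 / 25)"
            using True wk r_pos r_less by (intro mult_mono) auto
          then have "r * (1 - w) \<le> 65 / 1000" by simp
          then have le2: "1416 / 10000 \<le> 4 / 27 - 2 / 27 * (r * (1 - w))" by (simp add: field_simps)
          have "m - h / 9 = 4 / 27 - 2 / 27 * (r * (1 - w)) + r\<^sup>2 / 9 * k2"
            unfolding m_w h by (simp add: field_simps)
          then have "4 / 27 - 2 / 27 * (r * (1 - w)) \<le> m - h / 9" using k2 by simp
          with le1 le2 show "B * (8 / 9 - u) \<le> m - h / 9" by (meson order_trans)
        qed
      next
        case False
        define s where "s = 2314 / 100000 * w"
        have w: "0 \<le> w" "w \<le> 18 / 25" using wk False by auto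
        have s: "m \<le> 2 / 9 + s"
        proof -
          have "k2 \<le> w" using wk mult_left_le[of "1 - w" w] by simp
          then have "r\<^sup>2 / 9 * k2 \<le> 53718 / 9000000 * w"
            using r_sq wk by (intro mult_mono) auto
          moreover have "2 * r / 27 * w \<le> 46354 / 2700000 * w"
            using r_less wk by (intro mult_right_mono) auto
          moreover have "53718 / 9000000 * w + 46354 / 2700000 * w \<le> 2314 / 100000 * w" using w by simp
          ultimately show ?thesis unfolding m_w s_def by linarith
        qed
        have ww: "w * w \<le> 18 / 25 * w" using w by (intro mult_right_mono) auto
        have lo: "h / 9 \<le> m" using h0 k2 r_pos w unfolding m_w by (simp add: add_increasing2)
        show ?thesis
        proof (rule second[of "4 / 27 - 135 / 10000 * w" "32 / 1000 + 214 / 10000 * w"])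
          have "m\<^sup>2 \<le> (2 / 9 + s)\<^sup>2" using s um' by (intro power_mono) auto
          also have "\<dots> \<le> (4 / 27 - 135 / 10000 * w) * u"
            unfolding s_def u_w using ww w by (simp add: power2_eq_square field_simps)
          finally show "m\<^sup>2 \<le> (4 / 27 - 135 / 10000 * w) * u" .
          have "(m - h / 9)\<^sup>2 \<le> (2 / 15 + s)\<^sup>2" using s lo h0 by (intro power_mono) auto
          also have "\<dots> \<le> (32 / 1000 + 214 / 10000 * w) * (8 / 9 - u)"
            unfolding s_def u_w using ww w by (simp add: power2_eq_square field_simps)
          finally show "(h / 9 - m)\<^sup>2 \<le> (32 / 1000 + 214 / 10000 * w) * (8 / 9 - u)"
            by (simp add: power2_commute)
          show "4 / 27 - 135 / 10000 * w + (32 / 1000 + 214 / 10000 * w) + (2 * h * B - B\<^sup>2) / 9 \<le> gain r"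
          \<comment> \<open>Larger r has the larger gain, smaller r the smaller B; either pays for
            the growth of the budgets with w.\<close>
          proof (cases "22 / 100 \<le> r")
            case True
            have "(161 / 150)\<^sup>2 \<le> (1 + r / 3)\<^sup>2" using True by (intro power_mono) auto
            then have "2304 / 10000 \<le> gain r" using gain_bounds(2) by (simp add: power2_eq_square)
            then show ?thesis using K w by linarith
          next
            case False
            have "B \<le> 195 / 1000"
            proof (rule Bmono)
              have "0 \<le> (22 / 100 - r) * (4415 + 585 * (r + 22 / 100))"
                using r_pos False by (intro mult_nonneg_nonneg) auto
              then show "5 * r - 1 \<le> 195 / 1000 * (3 * r * (1 - r))" by (simp add: field_simps)
            qed
            then have "2 * h * B \<le> 2 * (8212 / 10000) * (195 / 1000)"
              using h0 B0 by (intro mult_mono) auto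
            moreover have "0 \<le> B\<^sup>2" by simp
            ultimately have "2 * h * B - B\<^sup>2 \<le> 324 / 1000" by linarith
            then have "(2 * h * B - B\<^sup>2) / 9 \<le> 36 / 1000" by simp
            then show ?thesis using g1 w by linarith
          qed
        qed (use w in auto)
      qed
    qed
  qed
qed

end

context small_ratio
begin

definition \<delta> :: real where "\<delta> = (1 - 3 * r) / (4 * r)"

lemma E_delta: "E = {- \<delta>, 1 + \<delta>}"
proof -
  have "(1 + r) / (4 * r) = 1 + \<delta>" using r_pos by (simp add: \<delta>_def field_simps)
  moreover have "- (1 - 3 * r) / (4 * r) = - \<delta>" unfolding \<delta>_def by (rule minus_divide_left[symmetric])
  ultimately show ?thesis unfolding E_eq by metis
qed

lemma delta_pos: "0 < \<delta>"
  using r_pos r3 by (simp add: \<delta>_def)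

lemma delta_ge: "3286 / 10000 \<le> \<delta>"
  using r_pos r_less by (simp add: \<delta>_def field_simps)

lemma half_gap_coord: "c * (rho / 2) = 1 / 2 + \<delta>"
  using r_pos c_rho by (simp add: \<delta>_def field_simps)

lemma variance_scaled: "variance0 - r\<^sup>2 * variance0 = 8 / 27 * c\<^sup>2"
proof -
  have "variance0 - r\<^sup>2 * variance0 = (1 - r)\<^sup>2 / 6"
  proof -
    have "variance0 * (1 + r) = (1 - r) / 6" using r_pos by (simp add: variance0_def field_simps)
    then have "variance0 * (1 + r) * (1 - r) = (1 - r) / 6 * (1 - r)" by (simp only:)
    then show ?thesis by (simp add: power2_eq_square algebra_simps)
  qed
  then show ?thesis by (simp add: width_def power2_eq_square field_simps)
qed

text \<open>The right-hand side is the value belonging to the cut at u = 1/3, that is, to g =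
  2/9.\<close>

lemma V2_le: "V2 \<le> r\<^sup>2 * variance0 + (1 - r)\<^sup>2 / 24"
proof -
  have "c\<^sup>2 * (2 / 9) \<le> c\<^sup>2 * g" using g_bounds by (intro mult_left_mono) auto
  then have "V2 \<le> r\<^sup>2 * variance0 + 8 / 27 * c\<^sup>2 - c\<^sup>2 * (2 / 9)"
    unfolding V2_def using variance_scaled by linarith
  also have "\<dots> = r\<^sup>2 * variance0 + (1 - r)\<^sup>2 / 24"
    by (simp add: width_def power2_eq_square field_simps)
  finally show ?thesis .
qed

lemma variance_bounds: "0 < variance0" "1 / 5 \<le> r \<Longrightarrow> variance0 \<le> 1 / 9"
proof -
  show "0 < variance0" using r_pos r3 by (simp add: variance0_def)
  show "variance0 \<le> 1 / 9" if "1 / 5 \<le> r"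
    using r_pos that by (simp add: variance0_def divide_le_eq)
qed

lemma V_ge_square:
  assumes A: "finite A" "A \<noteq> {}" and "0 \<le> h" and far: "\<And>x. x \<in> A \<Longrightarrow> x \<le> - h \<or> 1 + h \<le> x"
  shows "h\<^sup>2 \<le> V P A"
proof -
  have "h\<^sup>2 = (LINT x|P. h\<^sup>2)" by simp
  also have "\<dots> \<le> V P A"
    unfolding V_def
  proof (rule integral_mono_AE)
    show "AE x in P. h\<^sup>2 \<le> Min ((\<lambda>c. (x - c)\<^sup>2) ` A)"
      using AE_support
    proof eventually_elim
      case (elim x)
      have "h\<^sup>2 \<le> (x - y)\<^sup>2" if "y \<in> A" for y
      proof -
        have "h \<le> \<bar>x - y\<bar>" using far[OF that] elim by auto
        then have "h\<^sup>2 \<le> \<bar>x - y\<bar>\<^sup>2" using \<open>0 \<le> h\<close> by (rule power_mono)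
        then show ?thesis by simp
      qed
      then show ?case using A by (subst Min_ge_iff) auto
    qed
  qed (use integrable_V[OF A] in auto)
  finally show ?thesis .
qed

lemma rescale_le: "x \<le> y \<Longrightarrow> rescale j x \<le> rescale j y"
  using r_pos by (simp add: rescale_def divide_right_mono)

lemma V_rescale_nonneg:
  assumes "finite A" "A \<noteq> {}"
  shows "0 \<le> V P (rescale j ` A)"
  using assms by (intro V_nonneg) auto

text \<open>Both points lie in the middle region, so both outer cells are served badly.\<close>
lemma ext_useless_central:
  assumes r: "1 / 5 \<le> r" and b: "\<delta> \<le> b" "b \<le> d" "d \<le> 1 - \<delta>"
  shows "V2 \<le> V P ({b, d} \<union> E)"
proof -
  define A where "A = {b, d} \<union> E"
  have A: "finite A" "A \<noteq> {}" by (auto simp: A_def E_delta)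
  have near: "V P {\<delta> / r} \<le> V P (rescale 1 ` A)"
  proof (rule V_mono)
    fix x y assume x: "x \<in> {0..1::real}" and "y \<in> rescale 1 ` A"
    then obtain a where a: "a \<in> A" "y = a / r" by (auto simp: rescale_def)
    have 1: "1 \<le> \<delta> / r" using delta_ge r_less r_pos by (simp add: le_divide_eq)
    consider "a = - \<delta>" | "\<delta> \<le> a" using a(1) b delta_pos unfolding A_def E_delta by auto
    then show "\<exists>z\<in>{\<delta> / r}. (x - z)\<^sup>2 \<le> (x - y)\<^sup>2"
    proof cases
      case 1
      \<comment> \<open>-\<delta> and \<delta> are equally far from 0, so -\<delta> is no better on
        the cell.\<close>
      have "0 \<le> 4 * x * (\<delta> / r)" using x delta_pos r_pos by simp
      then show ?thesis using 1 a(2) by (simp add: power2_eq_square algebra_simps)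
    next
      case 2
      then have "\<delta> / r \<le> y" using a(2) r_pos by (simp add: divide_right_mono)
      then show ?thesis using nearer_right[of "\<delta> / r" y x] x \<open>1 \<le> \<delta> / r\<close> by simp
    qed
  qed (use A in auto)
  have far: "V P {1 - \<delta> / r} \<le> V P (rescale 3 ` A)"
  proof (rule V_mono)
    fix x y assume x: "x \<in> {0..1::real}" and "y \<in> rescale 3 ` A"
    then obtain a where a: "a \<in> A" "y = 1 - (1 - a) / r"
      using r_pos by (auto simp: rescale_def field_simps)
    have 1: "1 \<le> \<delta> / r" using delta_ge r_less r_pos by (simp add: le_divide_eq)
    consider "a = 1 + \<delta>" | "a \<le> 1 - \<delta>" using a(1) b delta_pos unfolding A_def E_delta by auto
    then show "\<exists>z\<in>{1 - \<delta> / r}. (x - z)\<^sup>2 \<le> (x - y)\<^sup>2"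
    proof cases
      case 1
      have "0 \<le> 4 * (1 - x) * (\<delta> / r)" using x delta_pos r_pos by simp
      then show ?thesis using 1 a(2) by (simp add: power2_eq_square algebra_simps)
    next
      case 2
      then have "\<delta> / r \<le> (1 - a) / r" using r_pos by (intro divide_right_mono) auto
      then have "y \<le> 1 - \<delta> / r" using a(2) by simp
      then show ?thesis using nearer_left[of y "1 - \<delta> / r" x] x \<open>1 \<le> \<delta> / r\<close> by simp
    qed
  qed (use A in auto)
  have "r\<^sup>2 * ((\<delta> / r - 1 / 2)\<^sup>2) = (\<delta> - r / 2)\<^sup>2"
    using r_pos by (simp add: power2_eq_square field_simps)
  moreover have "(21 / 100)\<^sup>2 \<le> (\<delta> - r / 2)\<^sup>2" using delta_ge r_less by (intro power_mono) auto
  ultimately have s: "441 / 10000 \<le> r\<^sup>2 * ((\<delta> / r - 1 / 2)\<^sup>2)" by (simp add: power2_eq_square)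
  have e: "(1 - \<delta> / r - 1 / 2)\<^sup>2 = (\<delta> / r - 1 / 2)\<^sup>2"
    by (simp add: power2_eq_square algebra_simps)
  have "r\<^sup>2 / 3 * (V P {\<delta> / r} + 0 + V P {1 - \<delta> / r})
      \<le> r\<^sup>2 / 3 * (V P (rescale 1 ` A) + V P (rescale 2 ` A) + V P (rescale 3 ` A))"
    using near far V_rescale_nonneg[OF A, of 2] by (intro mult_left_mono add_mono) auto
  then have "r\<^sup>2 / 3 * (V P {\<delta> / r} + 0 + V P {1 - \<delta> / r}) \<le> V P A"
    using V_rescale[OF A] by simp
  moreover have "r\<^sup>2 / 3 * (V P {\<delta> / r} + 0 + V P {1 - \<delta> / r})
      = 2 / 3 * (r\<^sup>2 * variance0) + 2 / 3 * (r\<^sup>2 * ((\<delta> / r - 1 / 2)\<^sup>2))"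
    unfolding V_singleton e by (simp add: algebra_simps)
  moreover have "r\<^sup>2 * variance0 \<le> 53718 / 1000000 * (1 / 9)"
    using r_sq variance_bounds r by (intro mult_mono) auto
  moreover have "(1 - r)\<^sup>2 \<le> (4 / 5)\<^sup>2" using r r3 by (intro power_mono) auto
  then have "(1 - r)\<^sup>2 / 24 \<le> 64 / 2400" by (simp add: power2_eq_square)
  ultimately show ?thesis using V2_le s unfolding A_def by linarith
qed

text \<open>No point lies in \<open>(1 / 2, 1]\<close>, so \<open>J\<^bsub>3\<^esub>\<close> alone costs too much.\<close>
lemma ext_useless_left:
  assumes b: "b \<le> d" "d \<le> 1 / 2"
  shows "V2 \<le> V P ({b, d} \<union> E)"
proof -
  define A where "A = {b, d} \<union> E"
  have A: "finite A" "A \<noteq> {}" by (auto simp: A_def E_delta)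
  have A': "x \<le> 1 / 2 \<or> x = 1 + \<delta>" if "x \<in> A" for x
    using that b delta_pos unfolding A_def E_delta by auto
  have J3: "r\<^sup>2 / 3 * V P (rescale 3 ` A) \<le> V P A"
  proof -
    have "r\<^sup>2 / 3 * (0 + 0 + V P (rescale 3 ` A))
        \<le> r\<^sup>2 / 3 * (V P (rescale 1 ` A) + V P (rescale 2 ` A) + V P (rescale 3 ` A))"
      using V_rescale_nonneg[OF A] by (intro mult_left_mono add_mono) auto
    then show ?thesis using V_rescale[OF A] by simp
  qed
  show ?thesis
  proof (cases "r \<le> 1 / 5")
    case True
    define s where "s = rescale 3 (1 / 2)"
    have s: "s = 1 - 1 / (2 * r)" using r_pos by (simp add: s_def rescale_def field_simps)
    have "s \<le> 0" using r_pos r3 by (simp add: s field_simps)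
    have "V P {s} \<le> V P (rescale 3 ` A)"
    proof (rule V_mono)
      fix x y assume x: "x \<in> {0..1::real}" and "y \<in> rescale 3 ` A"
      then obtain a where a: "a \<in> A" "y = rescale 3 a" by blast
      from A'[OF a(1)] show "\<exists>z\<in>{s}. (x - z)\<^sup>2 \<le> (x - y)\<^sup>2"
      proof
        assume "a \<le> 1 / 2"
        then have "y \<le> s" unfolding a(2) s_def by (rule rescale_le)
        then show ?thesis using nearer_left[of y s x] \<open>s \<le> 0\<close> x by simp
      next
        assume "a = 1 + \<delta>"
        then have y: "y = 1 + \<delta> / r" using a(2) r_pos by (simp add: rescale_def field_simps)
        \<comment> \<open>For r \<le> 1/5 the bisector of 1/2 and 1 + \<delta> is not left of 1, so
          the external point serves nothing.\<close>
        have "1 / 2 \<le> \<delta>" using True r_pos by (simp add: \<delta>_def field_simps)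
        then have "1 / 2 / r \<le> \<delta> / r" using r_pos by (intro divide_right_mono) auto
        then have "2 * x \<le> y + s" using x unfolding y s by simp
        then have "0 \<le> (y - s) * (y + s - 2 * x)"
          using \<open>s \<le> 0\<close> divide_pos_pos[OF delta_pos r_pos] unfolding y by (intro mult_nonneg_nonneg) auto
        then have "(x - s)\<^sup>2 \<le> (x - y)\<^sup>2" by (simp add: power2_eq_square algebra_simps)
        then show ?thesis by simp
      qed
    qed (use A in auto)
    then have "r\<^sup>2 / 3 * V P {s} \<le> r\<^sup>2 / 3 * V P (rescale 3 ` A)" by (rule mult_left_mono) simp
    then have "r\<^sup>2 / 3 * V P {s} \<le> V P A" using J3 by linarith
    moreover have "r\<^sup>2 / 3 * V P {s} = r\<^sup>2 * variance0 / 3 + (1 - r)\<^sup>2 / 12"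
      unfolding V_singleton s using r_pos by (simp add: power2_eq_square field_simps)
    moreover have "2 / 3 * (r\<^sup>2 * variance0) \<le> (1 - r)\<^sup>2 / 24"
    proof -
      have "r\<^sup>2 * (8 / 27 * c\<^sup>2) \<le> 54 / 1000 * (8 / 27 * c\<^sup>2)" using r_sq by (intro mult_right_mono) auto
      then have "r\<^sup>2 * (variance0 - r\<^sup>2 * variance0) \<le> 54 / 1000 * (1 - r)\<^sup>2 / 6"
        unfolding variance_scaled by (simp add: width_def power2_eq_square field_simps)
      moreover have "r\<^sup>2 * (r\<^sup>2 * variance0) \<le> 54 / 1000 * (r\<^sup>2 * variance0)"
        using r_sq variance_bounds by (intro mult_right_mono) auto
      moreover have "0 \<le> (1 - r)\<^sup>2" by simp
      moreover have "r\<^sup>2 * (variance0 - r\<^sup>2 * variance0) = r\<^sup>2 * variance0 - r\<^sup>2 * (r\<^sup>2 * variance0)"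
        by (simp only: right_diff_distrib)
      moreover define q q' where "q = r\<^sup>2 * variance0" and "q' = r\<^sup>2 * (r\<^sup>2 * variance0)"
      moreover define w where "w = (1 - r)\<^sup>2"
      ultimately have "q - q' \<le> 54 / 1000 * w / 6" "q' \<le> 54 / 1000 * q" "0 \<le> w" by simp_all
      then have "2 / 3 * q \<le> w / 24" by linarith
      then show ?thesis by (simp add: q_def w_def)
    qed
    ultimately show ?thesis using V2_le unfolding A_def by linarith
  next
    case False
    define B where "B = rescale 3 ` A"
    have B: "finite B" "B \<noteq> {}" using A by (auto simp: B_def)
    have B': "x \<le> 1 - 1 / (2 * r) \<or> x = 1 + \<delta> / r" if x: "x \<in> B" for x
    proof -
      obtain a where a: "a \<in> A" "x = rescale 3 a" using x by (auto simp: B_def)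
      have "rescale 3 (1 / 2) = 1 - 1 / (2 * r)" "rescale 3 (1 + \<delta>) = 1 + \<delta> / r"
        using r_pos by (simp_all add: rescale_def field_simps)
      then show ?thesis using A'[OF a(1)] rescale_le[of a "1 / 2" 3] a(2) by auto
    qed
    \<comment> \<open>Lower bounds for the distance of the subcells of J_3 from all points, in units
      of the subcell: J_31 is at least 1/2 - r > 268/1000 away from 1/2, and J_33 is \<delta> >
      328/1000 away from 1 + \<delta>.\<close>
    define h1 h2 where "h1 = 268 / 1000 / r\<^sup>2" and "h2 = 328 / 1000 / r\<^sup>2"
    have h: "h1 * r\<^sup>2 = 268 / 1000" "h2 * r\<^sup>2 = 328 / 1000" "0 \<le> h1" "0 \<le> h2"
      using r_pos by (auto simp: h1_def h2_def)

    have step: "h\<^sup>2 \<le> V P (rescale j ` B)"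
      if "0 \<le> h" "rescale j (1 - 1 / (2 * r)) \<le> - h" "1 + h \<le> rescale j (1 + \<delta> / r)" for j h
    proof (rule V_ge_square)
      fix y assume "y \<in> rescale j ` B"
      then obtain x where "x \<in> B" "y = rescale j x" by blast
      then show "y \<le> - h \<or> 1 + h \<le> y"
        using B'[of x] rescale_le[of x "1 - 1 / (2 * r)" j] that by auto
    qed (use B that in auto)
    have rb: "1 / 5 \<le> r" "r < 23177 / 100000" using False r_less by auto
    have low: "rescale j (1 - 1 / (2 * r)) \<le> - q"
      if "q * r\<^sup>2 \<le> 1 / 2 - r + (real j - 1) / 2 * (1 - r) * r" for j q
    proof -
      have "(rescale j (1 - 1 / (2 * r)) + q) * r\<^sup>2 = q * r\<^sup>2 - (1 / 2 - r + (real j - 1) / 2 * (1 - r) * r)"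
        using r_pos by (simp add: rescale_def power2_eq_square field_simps)
      then have "(rescale j (1 - 1 / (2 * r)) + q) * r\<^sup>2 \<le> 0" using that by simp
      then have "rescale j (1 - 1 / (2 * r)) + q \<le> 0" using r_pos by (simp add: mult_le_0_iff)
      then show ?thesis by simp
    qed
    have high: "1 + q \<le> rescale j (1 + \<delta> / r)"
      if "q * r\<^sup>2 \<le> r + \<delta> - r\<^sup>2 - (real j - 1) / 2 * (1 - r) * r" for j q
    proof -
      have "(rescale j (1 + \<delta> / r) - 1 - q) * r\<^sup>2 = (r + \<delta> - r\<^sup>2 - (real j - 1) / 2 * (1 - r) * r) - q * r\<^sup>2"
        using r_pos by (simp add: rescale_def power2_eq_square field_simps)
      then have "0 \<le> (rescale j (1 + \<delta> / r) - 1 - q) * r\<^sup>2" using that by simp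
      then have "0 \<le> rescale j (1 + \<delta> / r) - 1 - q" using r_pos by (simp add: zero_le_mult_iff)
      then show ?thesis by simp
    qed
    have rr: "r * r < 54 / 1000" "r * r \<ge> 1 / 25"
      using r_sq mult_mono[of "1/5" r "1/5" r] rb by (auto simp: power2_eq_square)
    have 1: "h1\<^sup>2 \<le> V P (rescale 1 ` B)"
      by (rule step[OF h(3) low high]) (use h rb rr delta_ge in \<open>auto simp: power2_eq_square algebra_simps\<close>)
    have 2: "h2\<^sup>2 \<le> V P (rescale 2 ` B)"
      by (rule step[OF h(4) low high]) (use h rb rr delta_ge in \<open>auto simp: power2_eq_square field_simps\<close>)
    have 3: "h2\<^sup>2 \<le> V P (rescale 3 ` B)"
      by (rule step[OF h(4) low high]) (use h rb rr delta_ge in \<open>auto simp: power2_eq_square algebra_simps\<close>)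
    have "r\<^sup>2 / 3 * (r\<^sup>2 / 3 * (h1\<^sup>2 + h2\<^sup>2 + h2\<^sup>2)) \<le> r\<^sup>2 / 3 * V P B"
      unfolding V_rescale[OF B] using 1 2 3 by (intro mult_left_mono add_mono) auto
    also have "\<dots> \<le> V P A" using J3 by (simp add: B_def)
    finally have "((h1 * r\<^sup>2)\<^sup>2 + 2 * (h2 * r\<^sup>2)\<^sup>2) / 9 \<le> V P A"
      by (simp add: power2_eq_square algebra_simps)
    then have "318 / 10000 \<le> V P A" unfolding h by (simp add: power2_eq_square)
    moreover have "V2 \<le> 318 / 10000"
    proof -
      have "r\<^sup>2 * variance0 \<le> r\<^sup>2 * (1 / 9)"
        using variance_bounds rb by (intro mult_left_mono) auto
      moreover have "r\<^sup>2 / 9 + (1 - r)\<^sup>2 / 24 \<le> 318 / 10000"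
      proof -
        have "0 \<le> (r - 1 / 5) * (1 / 4 - r)" using rb by (intro mult_nonneg_nonneg) auto
        then show ?thesis using rb by (simp add: power2_eq_square field_simps)
      qed
      ultimately show ?thesis using V2_le by linarith
    qed
    ultimately show ?thesis unfolding A_def by linarith
  qed
qed

lemma V_useless_right:
  assumes "d \<le> y" "2 \<le> d + y"
  shows "V P {d, y} = V P {d}"
proof (rule antisym)
  show "V P {d} \<le> V P {d, y}"
  proof (rule V_mono)
    fix x z assume x: "x \<in> {0..1::real}" and z: "z \<in> {d, y}"
    have "0 \<le> (y - d) * (y + d - 2 * x)" using assms x by (intro mult_nonneg_nonneg) auto
    then have "(x - d)\<^sup>2 \<le> (x - y)\<^sup>2" by (simp add: power2_eq_square algebra_simps)
    then show "\<exists>b\<in>{d}. (x - b)\<^sup>2 \<le> (x - z)\<^sup>2" using z by auto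
  qed auto
  show "V P {d, y} \<le> V P {d}" by (rule V_antimono) auto
qed

lemma loss_zero_right: "d \<le> y \<Longrightarrow> 2 \<le> d + y \<Longrightarrow> loss d y = 0"
  using V_useless_right[of d y] V_pair_loss[of d y] by simp

lemma loss_zero_left:
  assumes "y \<le> b" "b + y \<le> 0"
  shows "loss b y = 0"
proof -
  have "V P {b} \<le> V P {b, y}"
  proof (rule V_mono)
    fix x z assume x: "x \<in> {0..1::real}" and z: "z \<in> {b, y}"
    have "0 \<le> (b - y) * (2 * x - y - b)" using assms x by (intro mult_nonneg_nonneg) auto
    then have "(x - b)\<^sup>2 \<le> (x - y)\<^sup>2" by (simp add: power2_eq_square algebra_simps)
    then show "\<exists>c\<in>{b}. (x - c)\<^sup>2 \<le> (x - z)\<^sup>2" using z by auto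
  qed auto
  moreover have "V P {b, y} \<le> V P {b}" by (rule V_antimono) auto
  ultimately show ?thesis using V_pair_loss[of b y] by simp
qed

text \<open>The external point can only be of use inside \<open>J\<^bsub>33\<^esub>\<close>.\<close>
lemma loss_ext_le:
  assumes d: "1 / 2 \<le> d" "d \<le> 1 - \<delta>"
  shows "loss d (1 + \<delta>) \<le> ((1 - r\<^sup>2 / 2 - d)\<^sup>2 - (\<delta> - r\<^sup>2 / 2)\<^sup>2) / 9"
proof -
  define y where "y = 1 + \<delta>"
  have dy: "d \<le> y" using d delta_pos by (simp add: y_def)
  have sum: "2 - r + r\<^sup>2 \<le> d + y"
  proof -
    have "r * r\<^sup>2 \<le> r * (54 / 1000)" using r_sq r_pos by (intro mult_left_mono) auto
    moreover have "0 \<le> (23177 / 100000 - r) * (5216 / 1000 - 4 * (r + 23177 / 100000))"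
      using r_pos r_less by (intro mult_nonneg_nonneg) auto
    ultimately have "0 \<le> 1 - 5 * r + 4 * r\<^sup>2 - 4 * (r * r\<^sup>2)" by (simp add: power2_eq_square field_simps)
    then have "1 / 2 - r + r\<^sup>2 \<le> \<delta>"
      using r_pos by (simp add: \<delta>_def le_divide_eq power2_eq_square algebra_simps)
    then show ?thesis using d by (simp add: y_def)
  qed
  have resc_sum: "rescale j x + rescale j z = (x + z - (real j - 1) * (1 - r)) / r" for j x z
    unfolding rescale_def add_divide_distrib[symmetric] by simp
  have pair: "V P (rescale j ` {d, y}) = V P (rescale j ` {d})"
    if "2 * r + (real j - 1) * (1 - r) \<le> d + y" for j
  proof -
    have "2 \<le> rescale j d + rescale j y"
      unfolding resc_sum using that r_pos by (simp add: le_divide_eq)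
    then show ?thesis using V_useless_right[of "rescale j d" "rescale j y"] rescale_le[OF dy] by simp
  qed
  define D Y where "D = rescale 3 d" and "Y = rescale 3 y"
  have DY: "D \<le> Y" unfolding D_def Y_def by (rule rescale_le[OF dy])
  \<comment> \<open>The bisector is not left of the right end of J_2 and, inside J_3, not left of
    that of J_32. Thus only J_33 can profit.\<close>
  have sumDY: "1 + r \<le> D + Y"
    unfolding D_def Y_def resc_sum using sum r_pos by (simp add: le_divide_eq power2_eq_square algebra_simps)
  have pairDY: "V P (rescale j ` {D, Y}) = V P (rescale j ` {D})"
    if "2 * r + (real j - 1) * (1 - r) \<le> D + Y" for j
  proof -
    have "2 \<le> rescale j D + rescale j Y"
      unfolding resc_sum using that r_pos by (simp add: le_divide_eq)
    then show ?thesis using V_useless_right[of "rescale j D" "rescale j Y"] rescale_le[OF DY] by simp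
  qed
  \<comment> \<open>The mirror image of the external point in 1, in coordinates of J_33; for every x
    in [0, 1] it is at least as near as either point.\<close>
  define q where "q = 1 - \<delta> / r\<^sup>2"
  have r2: "0 < r\<^sup>2" using r_pos by simp
  have D33: "rescale 3 D = 1 - (1 - d) / r\<^sup>2"
    using r_pos by (simp add: D_def rescale_def power2_eq_square field_simps)
  have Y33: "rescale 3 Y = 1 + \<delta> / r\<^sup>2"
    using r_pos by (simp add: Y_def y_def rescale_def power2_eq_square field_simps)
  have "r\<^sup>2 \<le> \<delta>" using r_sq delta_ge by simp
  then have "1 \<le> \<delta> / r\<^sup>2" using r2 by (simp add: le_divide_eq)
  have "V P {q} \<le> V P (rescale 3 ` {D, Y})"
  proof (rule V_mono)
    fix x z assume x: "x \<in> {0..1::real}" and z: "z \<in> rescale 3 ` {D, Y}"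
    have "\<delta> / r\<^sup>2 \<le> (1 - d) / r\<^sup>2" using d r2 by (intro divide_right_mono) auto
    then have "(x - q)\<^sup>2 \<le> (x - rescale 3 D)\<^sup>2"
      using x \<open>1 \<le> \<delta> / r\<^sup>2\<close> unfolding D33 q_def by (intro nearer_left) auto
    moreover have "(x - q)\<^sup>2 \<le> (x - rescale 3 Y)\<^sup>2"
    proof -
      have "0 \<le> 4 * (1 - x) * (\<delta> / r\<^sup>2)"
        using x \<open>1 \<le> \<delta> / r\<^sup>2\<close> by (intro mult_nonneg_nonneg) auto
      then show ?thesis unfolding Y33 q_def by (simp add: power2_eq_square algebra_simps)
    qed
    ultimately show "\<exists>b\<in>{q}. (x - b)\<^sup>2 \<le> (x - z)\<^sup>2" using z by auto
  qed auto
  note q_le = this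
  have p12: "V P (rescale 1 ` {D, Y}) = V P (rescale 1 ` {D})" "V P (rescale 2 ` {D, Y}) = V P (rescale 2 ` {D})"
    using pairDY[of 1] pairDY[of 2] sumDY r3 by auto
  have DY_eq: "V P {D, Y} = r\<^sup>2 / 3 * (V P (rescale 1 ` {D, Y}) + V P (rescale 2 ` {D, Y}) + V P (rescale 3 ` {D, Y}))"
    by (rule V_rescale) auto
  have D_eq: "V P {D} = r\<^sup>2 / 3 * (V P (rescale 1 ` {D}) + V P (rescale 2 ` {D}) + V P (rescale 3 ` {D}))"
    by (rule V_rescale) auto
  have "V P {D} - V P {D, Y} = r\<^sup>2 / 3 * (V P (rescale 3 ` {D}) - V P (rescale 3 ` {D, Y}))"
    unfolding D_eq DY_eq p12 by (simp only: right_diff_distrib[symmetric]) simp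
  also have "\<dots> \<le> r\<^sup>2 / 3 * (V P {rescale 3 D} - V P {q})"
    using q_le by (intro mult_left_mono) auto
  finally have DY_le: "V P {D} - V P {D, Y} \<le> r\<^sup>2 / 3 * (V P {rescale 3 D} - V P {q})" .
  have "r * r \<le> r * 1" using r_pos r3 by (intro mult_left_mono) auto
  then have "2 * r \<le> d + y" "1 + r \<le> d + y" using sum r3 r_sq by (simp_all add: power2_eq_square)
  then have p12': "V P (rescale 1 ` {d, y}) = V P (rescale 1 ` {d})" "V P (rescale 2 ` {d, y}) = V P (rescale 2 ` {d})"
    using pair[of 1] pair[of 2] by auto
  have dy_eq: "V P {d, y} = r\<^sup>2 / 3 * (V P (rescale 1 ` {d, y}) + V P (rescale 2 ` {d, y}) + V P (rescale 3 ` {d, y}))"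
    by (rule V_rescale) auto
  have d_eq: "V P {d} = r\<^sup>2 / 3 * (V P (rescale 1 ` {d}) + V P (rescale 2 ` {d}) + V P (rescale 3 ` {d}))"
    by (rule V_rescale) auto
  have "loss d y = V P {d} - V P {d, y}" using V_pair_loss by simp
  also have "\<dots> = r\<^sup>2 / 3 * (V P (rescale 3 ` {d}) - V P (rescale 3 ` {d, y}))"
    unfolding d_eq dy_eq p12' by (simp only: right_diff_distrib[symmetric]) simp
  also have "\<dots> = r\<^sup>2 / 3 * (V P {D} - V P {D, Y})" by (simp add: D_def Y_def)
  also have "\<dots> \<le> r\<^sup>2 / 3 * (r\<^sup>2 / 3 * (V P {rescale 3 D} - V P {q}))"
    using DY_le by (rule mult_left_mono) simp
  also have "\<dots> = r\<^sup>2 / 3 * (r\<^sup>2 / 3 * ((rescale 3 D - 1 / 2)\<^sup>2 - (q - 1 / 2)\<^sup>2))"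
    unfolding V_singleton by simp
  also have "\<dots> = ((r\<^sup>2 * (rescale 3 D - 1 / 2))\<^sup>2 - (r\<^sup>2 * (q - 1 / 2))\<^sup>2) / 9"
    by (simp add: power2_eq_square field_simps)
  also have "r\<^sup>2 * (rescale 3 D - 1 / 2) = - (1 - r\<^sup>2 / 2 - d)"
    unfolding D33 using r_pos by (simp add: field_simps)
  also have "r\<^sup>2 * (q - 1 / 2) = - (\<delta> - r\<^sup>2 / 2)"
    unfolding q_def using r_pos by (simp add: field_simps)
  finally show ?thesis unfolding y_def power2_minus .
qed

text \<open>As b \<le> \<delta>, the bisector of b and -\<delta> is not right of 0, so only 1 +
  \<delta> can help. Its saving is bounded by \<open>loss_ext_le\<close>, and the balance is
  \<open>two_points_with_ext\<close>.\<close>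

lemma ext_useless_main:
  assumes b: "0 \<le> b" "b \<le> d" "b \<le> \<delta>" and d: "1 / 2 \<le> d" "d \<le> 1 - \<delta>"
  shows "V2 \<le> V P ({b, d} \<union> E)"
proof -
  have "\<delta> \<le> 1 / 2" using d by simp
  then have r: "1 / 5 \<le> r" using r_pos by (simp add: \<delta>_def field_simps)
  obtain x where x: "b = 1 / 2 + c * x" by (rule centered)
  obtain \<beta> where \<beta>: "d = 1 / 2 + c * \<beta>" by (rule centered)
  obtain h where h: "1 - r\<^sup>2 / 2 = 1 / 2 + c * h" by (rule centered)
  obtain B where B: "1 - \<delta> = 1 / 2 + c * B" by (rule centered)
  have c0: "0 < c" by (rule width_pos)
  have xb: "x \<le> \<beta>" using b(2) c0 unfolding x \<beta> by simp
  have \<beta>0: "0 \<le> \<beta>" using d(1) c0 unfolding \<beta> by (simp add: zero_le_mult_iff)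
  have \<beta>B: "\<beta> \<le> B" using d(2) c0 unfolding \<beta> B by simp
  have h': "h = 2 / 3 * (1 + r)"
  proof -
    have "c * h = c * (2 / 3 * (1 + r))"
      using h by (simp add: width_def power2_eq_square field_simps)
    then show ?thesis using c0 by simp
  qed
  have B': "B * (3 * r * (1 - r)) = 5 * r - 1"
  proof -
    have "4 * r * (c * B) = 5 * r - 1" using B r_pos by (simp add: \<delta>_def field_simps)
    then show ?thesis by (simp add: width_def field_simps)
  qed
  define t where "t = (b + d) / 2"
  have "t < 1 - r" using b d r3 by (simp add: t_def)
  have u: "cut_mass t \<le> 2 / 3"
  proof (cases "t < (1 - r) / 2")
    case True
    then show ?thesis using cut_left(1)[OF True] cut_mass_bounds(2)[of "t / r"] by simp
  next
    case False
    then show ?thesis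
      using cut_middle(1)[of t] \<open>t < 1 - r\<close> cut_mass_bounds(2)[of "(t - (1 - r) / 2) / r"] by simp
  qed
  have mem: "(cut_mass t, cut_m t) \<in> range (\<lambda>t. (cut_mass t, cut_m t))" by blast
  have "- g \<le> cut_mass t * x\<^sup>2 + 2 * cut_m t * x + (1 - cut_mass t) * \<beta>\<^sup>2 - 2 * \<beta> * cut_m t
      - ((h - \<beta>)\<^sup>2 - (h - B)\<^sup>2) / 9" (is "_ \<le> ?Q")
    by (rule two_points_with_ext[OF lorenz_set_cut mem u r h' B' \<beta>0 \<beta>B])
  then have "c\<^sup>2 * - g \<le> c\<^sup>2 * ?Q" by (rule mult_left_mono) simp
  moreover have "V P {b, d} - loss d (1 + \<delta>) \<ge> variance0 + c\<^sup>2 * ?Q"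
  proof -
    have i: "(1 - r\<^sup>2 / 2 - d)\<^sup>2 = c\<^sup>2 * (h - \<beta>)\<^sup>2"
      unfolding h \<beta> by (simp add: power2_eq_square algebra_simps)
    have "\<delta> - r\<^sup>2 / 2 = c * (h - B)" using h B by (simp add: algebra_simps)
    then have ii: "(\<delta> - r\<^sup>2 / 2)\<^sup>2 = c\<^sup>2 * (h - B)\<^sup>2" by (simp add: power_mult_distrib)
    have iii: "V P {b, d} = variance0 + c\<^sup>2 * (cut_mass t * x\<^sup>2 + 2 * cut_m t * x
        + (1 - cut_mass t) * \<beta>\<^sup>2 - 2 * \<beta> * cut_m t)"
    proof -
      have "b - 1 / 2 = c * x" "d - 1 / 2 = c * \<beta>" "d - b = c * (\<beta> - x)"
        using x \<beta> by (simp_all add: algebra_simps)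
      then have "V P {b, d} = variance0 + cut_mass t * (c * x)\<^sup>2 + (1 - cut_mass t) * (c * \<beta>)\<^sup>2
          - 2 * (c * (\<beta> - x)) * (c * cut_m t)"
        using V_pair[OF b(2), folded t_def] by (simp only: cut_moment_eq)
      then show ?thesis by (simp add: power2_eq_square algebra_simps)
    qed
    have iv: "c\<^sup>2 * ?Q = c\<^sup>2 * (cut_mass t * x\<^sup>2 + 2 * cut_m t * x
        + (1 - cut_mass t) * \<beta>\<^sup>2 - 2 * \<beta> * cut_m t) - (c\<^sup>2 * (h - \<beta>)\<^sup>2 - c\<^sup>2 * (h - B)\<^sup>2) / 9"
      by (simp add: right_diff_distrib diff_divide_distrib)
    have "variance0 + c\<^sup>2 * ?Q = V P {b, d} - (c\<^sup>2 * (h - \<beta>)\<^sup>2 - c\<^sup>2 * (h - B)\<^sup>2) / 9"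
      unfolding iv iii by (simp only: add_diff_eq)
    then show ?thesis using loss_ext_le[OF d] unfolding i ii by linarith
  qed
  moreover have "loss b (- \<delta>) = 0" using b delta_pos by (intro loss_zero_left) auto
  moreover have "{b, d, - \<delta>, 1 + \<delta>} = {b, d} \<union> E" unfolding E_delta by auto
  ultimately show ?thesis
    using V_pair_two_ext[of b d "- \<delta>" "1 + \<delta>"] unfolding V2_def by simp
qed

end

lemma (in small_ratio) ext_useless_left_half:
  assumes b: "0 \<le> b" "b \<le> d" "d \<le> 1" "b \<le> \<delta>"
  shows "V2 \<le> V P ({b, d} \<union> E)"
proof -
  consider "d \<le> 1 / 2" | "1 / 2 \<le> d" "d \<le> 1 - \<delta>" | "1 - \<delta> \<le> d" by linarith
  then show ?thesis
  proof cases
    case 1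
    then show ?thesis using ext_useless_left b by blast
  next
    case 2
    then show ?thesis using ext_useless_main b by blast
  next
    case 3
    have "{b, d, - \<delta>, 1 + \<delta>} = {b, d} \<union> E" unfolding E_delta by auto
    moreover have "loss b (- \<delta>) = 0" using b delta_pos by (intro loss_zero_left) auto
    moreover have "loss d (1 + \<delta>) = 0" using b 3 delta_pos by (intro loss_zero_right) auto
    ultimately show ?thesis
      using V_pair_two_ext[of b d "- \<delta>" "1 + \<delta>"] V_two_ge[of b d] by simp
  qed
qed

lemma (in small_ratio) reflected_small_ratio: "small_ratio r (distr P borel (\<lambda>x. 1 - x))"
  using ratio_axioms reflected_self_similar by (simp add: small_ratio_def)

text \<open>Up to reflection either b is within \<delta> of 0 or both points are central; the latter
  forces \<delta> \<le> 1/2, hence r \<ge> 1/5.\<close>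

lemma (in small_ratio) ext_useless:
  assumes b: "0 \<le> b" "b \<le> d" "d \<le> 1"
  shows "V2 \<le> V P ({b, d} \<union> E)"
proof -
  interpret R: small_ratio r "distr P borel (\<lambda>x. 1 - x)" by (rule reflected_small_ratio)
  consider "b \<le> \<delta>" | "1 - \<delta> \<le> d" | "\<delta> < b" "d < 1 - \<delta>" by linarith
  then show ?thesis
  proof cases
    case 1
    then show ?thesis using ext_useless_left_half b by blast
  next
    case 2
    have "V2 \<le> V (distr P borel (\<lambda>x. 1 - x)) ({1 - d, 1 - b} \<union> E)"
      by (rule R.ext_useless_left_half) (use b 2 in auto)
    also have "\<dots> = V P ((\<lambda>x. 1 - x) ` ({1 - d, 1 - b} \<union> E))"
      by (rule V_reflected) (simp_all add: E_delta)
    also have "(\<lambda>x. 1 - x) ` ({1 - d, 1 - b} \<union> E) = {1 + \<delta>, - \<delta>, d, b}"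
      unfolding E_delta by simp
    also have "\<dots> = {b, d} \<union> E" unfolding E_delta by blast
    finally show ?thesis .
  next
    case 3
    then have "\<delta> \<le> 1 / 2" using b by linarith
    then have "1 / 5 \<le> r" using r_pos by (simp add: \<delta>_def field_simps)
    then show ?thesis using ext_useless_central b 3 by simp
  qed
qed

section \<open>The slope between two and three points per cell\<close>

context small_ratio
begin

text \<open>The subtracted term is the error of three means, one in the centre of each level-one
  cell.\<close>

definition D3 :: real where "D3 = V2 - r\<^sup>2 * variance0"

lemma D3_eq: "D3 = c\<^sup>2 * (8 / 27 - g)"
  using variance_scaled by (simp add: D3_def V2_def algebra_simps)

lemma D3_nonneg: "0 \<le> D3"
  unfolding D3_eq using g_bounds by simp

text \<open>Four or more points reach V2 + 2 D3 by their price alone.\<close>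

lemma V2_le_2D3: "V2 \<le> 2 * D3"
proof -
  have "c\<^sup>2 * g \<le> c\<^sup>2 * (1 / 4)" using g_bounds by (intro mult_left_mono) auto
  moreover have "c\<^sup>2 * (1 / 4) = 27 / 32 * variance0 - 27 / 32 * (r\<^sup>2 * variance0)"
    using variance_scaled by linarith
  moreover have "r\<^sup>2 * variance0 \<le> 54 / 1000 * variance0"
    using r_sq variance_bounds by (intro mult_right_mono) auto
  moreover have "w - x \<le> 2 * (w - x - q)"
    if "x \<le> k" "k = 27 / 32 * w - 27 / 32 * q" "q \<le> 54 / 1000 * w" "0 < w" for x k w q :: real
    using that by argo
  ultimately show ?thesis using variance_bounds(1) unfolding D3_def V2_def by blast
qed

text \<open>The tight cases are two points (\<open>ext_useless\<close>) and three points
  (\<open>penalized_base1\<close>). With fewer points there is room for the help from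
  \<open>E\<close> because g \<ge> 2/9.\<close>

lemma penalized_base2: "penalized D3 (V2 + 2 * D3)"
  unfolding penalized_def
proof (intro allI impI)
  fix \<alpha>0 :: "real set" assume fin0: "finite \<alpha>0"
  \<comment> \<open>Clamping to [0, 1] brings a point no farther from any x there and does not
    increase the number of points.\<close>
  define \<alpha> where "\<alpha> = (\<lambda>x. max 0 (min 1 x)) ` \<alpha>0"
  have fin: "finite \<alpha>" and sub: "\<alpha> \<subseteq> {0..1}" using fin0 by (auto simp: \<alpha>_def)
  have le: "V P (\<alpha> \<union> E) \<le> V P (\<alpha>0 \<union> E)"
  proof (rule V_mono)
    fix x y assume x: "x \<in> {0..1::real}" and y: "y \<in> \<alpha>0 \<union> E"
    show "\<exists>b\<in>\<alpha> \<union> E. (x - b)\<^sup>2 \<le> (x - y)\<^sup>2"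
    proof (cases "y \<in> E")
      case False
      then have "max 0 (min 1 y) \<in> \<alpha> \<union> E" using y by (auto simp: \<alpha>_def)
      moreover have "(x - max 0 (min 1 y))\<^sup>2 \<le> (x - y)\<^sup>2"
      proof -
        have "\<bar>x - max 0 (min 1 y)\<bar> \<le> \<bar>x - y\<bar>" using x by (auto simp: max_def min_def)
        then show ?thesis using abs_le_square_iff by blast
      qed
      ultimately show ?thesis by blast
    qed auto
  qed (use fin fin0 in \<open>auto simp: E_delta\<close>)
  have "V2 + 2 * D3 \<le> V P (\<alpha> \<union> E) + D3 * card \<alpha>"
  proof -
    have zh: "1 / (2 * c) \<le> rho / 2"
      using width_pos half_gap_coord delta_pos by (simp add: divide_le_eq mult.commute)
    have pos: "0 \<le> V P (\<alpha> \<union> E)" using fin by (intro V_nonneg) (auto simp: E_delta)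
    consider "card \<alpha> = 0" | "card \<alpha> = 1" | "card \<alpha> = 2" | "card \<alpha> = 3" | "4 \<le> card \<alpha>" by linarith
    then show ?thesis
    proof cases
      case 1
      then have "\<alpha> = {}" using fin by simp
      have "variance0 + c\<^sup>2 * g \<le> V P E"
        using V_two_ext[OF zh zh] unfolding E_def by (simp add: gap_share_def)
      moreover have "c\<^sup>2 * (4 / 27) \<le> c\<^sup>2 * g" using g_bounds by (intro mult_left_mono) auto
      moreover have "D3 = c\<^sup>2 * (8 / 27) - c\<^sup>2 * g" unfolding D3_eq by (rule right_diff_distrib)
      moreover have "V P (\<alpha> \<union> E) + D3 * card \<alpha> = V P E" using \<open>\<alpha> = {}\<close> by simp
      ultimately show ?thesis unfolding V2_def by linarith
    next
      case 2
      then obtain b where b: "\<alpha> = {b}" by (auto simp: card_1_singleton_iff)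
      have b01: "0 \<le> b" "b \<le> 1" using sub b by auto
      have y: "- \<delta> = 1 / 2 - c * (rho / 2)" "1 + \<delta> = 1 / 2 + c * (rho / 2)"
        using half_gap_coord by linarith+
      have half: "loss (1 / 2) (1 + \<delta>) + c\<^sup>2 * ext_gain g (rho / 2) \<le> c\<^sup>2 * (4 / 27)"
        "loss (1 / 2) (- \<delta>) + c\<^sup>2 * ext_gain g (rho / 2) \<le> c\<^sup>2 * (4 / 27)"
      proof -
        have rh: "23 / 16 \<le> rho / 2" using rho_ge by simp
        define t where "t = ((1 / 2 + c * 0) + (1 / 2 + c * (rho / 2))) / 2"
        have "V P {1 / 2, 1 + \<delta>} = variance0 - c\<^sup>2 * pair_gain (1 - cut_mass t) (cut_m t) 0 (rho / 2)"
          using V_pair_gain(1)[of 0 "rho / 2"] rho_ge unfolding t_def y(2) by simp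
        then have "loss (1 / 2) (1 + \<delta>) = c\<^sup>2 * pair_gain (1 - cut_mass t) (cut_m t) 0 (rho / 2)"
          using V_pair_loss[of "1 / 2" "1 + \<delta>"] by (simp add: V_singleton)
        moreover have "c\<^sup>2 * (ext_gain g (rho / 2) + pair_gain (1 - cut_mass t) (cut_m t) 0 (rho / 2)) \<le> c\<^sup>2 * (4 / 27)"
          by (intro mult_left_mono ext_gain_half_gap[OF rh g_bounds(1)] curve_point_reflect curve_cut) simp
        ultimately show "loss (1 / 2) (1 + \<delta>) + c\<^sup>2 * ext_gain g (rho / 2) \<le> c\<^sup>2 * (4 / 27)"
          by (simp add: distrib_left)
        define s where "s = ((1 / 2 + c * - (rho / 2)) + (1 / 2 + c * 0)) / 2"
        have "V P {1 / 2, - \<delta>} = variance0 - c\<^sup>2 * pair_gain (cut_mass s) (cut_m s) 0 (rho / 2)"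
          using V_pair_gain(2)[of "- (rho / 2)" 0] rho_ge unfolding s_def y(1) by (simp add: insert_commute)
        then have "loss (1 / 2) (- \<delta>) = c\<^sup>2 * pair_gain (cut_mass s) (cut_m s) 0 (rho / 2)"
          using V_pair_loss[of "1 / 2" "- \<delta>"] by (simp add: V_singleton)
        moreover have "c\<^sup>2 * (ext_gain g (rho / 2) + pair_gain (cut_mass s) (cut_m s) 0 (rho / 2)) \<le> c\<^sup>2 * (4 / 27)"
          by (intro mult_left_mono ext_gain_half_gap[OF rh g_bounds(1)] curve_cut) simp
        ultimately show "loss (1 / 2) (- \<delta>) + c\<^sup>2 * ext_gain g (rho / 2) \<le> c\<^sup>2 * (4 / 27)"
          by (simp add: distrib_left)
      qed
      note * = V_single_two_ext[of b "- \<delta>" "1 + \<delta>"] V_pair_loss[of b "- \<delta>"] V_pair_loss[of b "1 + \<delta>"]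
      have "variance0 - c\<^sup>2 * (4 / 27) \<le> V P {b, - \<delta>, 1 + \<delta>}"
      proof (cases "1 / 2 \<le> b")
        case True
        have "loss b (1 + \<delta>) \<le> loss (1 / 2) (1 + \<delta>)"
          using True b01 delta_pos by (intro loss_right_antimono) auto
        moreover have "variance0 - c\<^sup>2 * ext_gain g (rho / 2) \<le> V P {b, - \<delta>}"
          by (rule V_ext_left[of "rho / 2" b, folded y(1)]) (use b01 delta_pos in simp)
        ultimately show ?thesis using * half(1) by linarith
      next
        case False
        have "loss b (- \<delta>) \<le> loss (1 / 2) (- \<delta>)"
          using False b01 delta_pos by (intro loss_left_mono) auto
        moreover have "variance0 - c\<^sup>2 * ext_gain g (rho / 2) \<le> V P {b, 1 + \<delta>}"
          by (rule V_ext_right[of b "rho / 2", folded y(2)]) (use b01 delta_pos in simp)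
        ultimately show ?thesis using * half(2) by linarith
      qed
      moreover have "\<alpha> \<union> E = {b, - \<delta>, 1 + \<delta>}" unfolding b E_delta by auto
      then have "V P (\<alpha> \<union> E) + D3 * card \<alpha> = V P {b, - \<delta>, 1 + \<delta>} + D3" using 2 by simp
      moreover have "c\<^sup>2 * (2 / 9) \<le> c\<^sup>2 * g" using g_bounds by (intro mult_left_mono) auto
      moreover have "D3 = c\<^sup>2 * (8 / 27) - c\<^sup>2 * g" unfolding D3_eq by (rule right_diff_distrib)
      ultimately show ?thesis unfolding V2_def by linarith
    next
      case 3
      then obtain x y where xy: "\<alpha> = {x, y}" "x \<noteq> y" by (auto simp: card_2_iff)
      obtain b d where b: "\<alpha> = {b, d}" "b \<le> d"
        using xy by (metis insert_commute linear)
      have "0 \<le> b" "d \<le> 1" using sub b by auto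
      then show ?thesis using ext_useless[of b d] b 3 by simp
    next
      case 4
      have "r\<^sup>2 * (variance0 + c\<^sup>2 * g) \<le> V P (\<alpha> \<union> E) + r\<^sup>2 / 3 * (c\<^sup>2 * g) * card \<alpha>"
        using penalized_base1 fin unfolding penalized_def by blast
      then have "r\<^sup>2 * variance0 \<le> V P (\<alpha> \<union> E)" using 4 by (simp add: distrib_left)
      moreover have "D3 * card \<alpha> = 3 * D3" using 4 by simp
      ultimately show ?thesis using D3_def by linarith
    next
      case 5
      then have "D3 * 4 \<le> D3 * card \<alpha>" using D3_nonneg by (intro mult_left_mono) auto
      then show ?thesis using pos V2_le_2D3 by linarith
    qed
  qed
  moreover have "D3 * card \<alpha> \<le> D3 * card \<alpha>0"
    using D3_nonneg fin0 by (intro mult_left_mono) (auto simp: \<alpha>_def intro: card_image_le)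
  ultimately show "V2 + 2 * D3 \<le> V P (\<alpha>0 \<union> E) + D3 * card \<alpha>0" using le by linarith
qed

end

section \<open>Sets attaining the bound\<close>

context self_similar
begin

lemma AE_self_similar:
  assumes Q: "{x. Q x} \<in> sets borel" and ae: "\<And>j. j \<in> {1, 2, 3} \<Longrightarrow> AE x in P. Q (S r j x)"
  shows "AE x in P. Q x"
proof -
  define N where "N = {x. \<not> Q x}"
  have N: "N \<in> sets borel" using Q unfolding N_def by (auto simp: Collect_neg_eq)
  have "measure P (S r j -` N) = 0" if "j \<in> {1, 2, 3}" for j
  proof -
    have "S r j -` N \<in> sets P" using measurable_sets[OF measurable_S N, of j] by simp
    moreover have "AE x in P. x \<notin> S r j -` N" using ae[OF that] by (simp add: N_def)
    ultimately have "S r j -` N \<in> null_sets P" using AE_iff_null_sets by blast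
    then show ?thesis by (simp add: measure_eq_0_null_sets)
  qed
  then have "measure P N = 0" using measure_self_similar[OF N] by simp
  then have "N \<in> null_sets P" using N by (intro null_setsI) (auto simp: emeasure_eq_measure)
  then have "AE x in P. x \<notin> N" by (rule AE_not_in)
  then show ?thesis by (simp add: N_def)
qed

lemma S_image: "S r j ` {u..v} = {S r j u..S r j v}" if "u \<le> v"
  using image_affinity_atLeastAtMost[of r "(real j - 1) / 2 * (1 - r)" u v] that r0 unfolding S_def by simp

lemma J_single: "J r [j] = {(real j - 1) / 2 * (1 - r)..r + (real j - 1) / 2 * (1 - r)}"
  unfolding J_def S_word_def by (simp add: S_image) (simp add: S_def)

lemma J_double:
  "J r [i, j] = {r * ((real j - 1) / 2 * (1 - r)) + (real i - 1) / 2 * (1 - r)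
    ..r * (r + (real j - 1) / 2 * (1 - r)) + (real i - 1) / 2 * (1 - r)}"
proof -
  have "J r [i, j] = S r i ` S r j ` {0..1}"
    unfolding J_def S_word_def by (simp add: image_comp)
  also have "\<dots> = S r i ` {S r j 0..S r j 1}" by (simp add: S_image)
  also have "\<dots> = {S r i (S r j 0)..S r i (S r j 1)}"
    using r0 by (intro S_image) (simp add: S_def)
  finally show ?thesis by (simp add: S_def)
qed

lemma cond_mean_eq:
  assumes A: "A \<in> sets borel" and pos: "0 < measure P A"
  shows "cond_mean P A = (LINT x|P. indicator A x * x) / measure P A"
proof -
  have "uniform_measure P A = density P (\<lambda>x. ennreal (indicator A x / measure P A))"
    unfolding uniform_measure_def
  proof (rule density_cong)
    show "AE x in P. indicator A x / emeasure P A = ennreal (indicator A x / measure P A)"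
      using pos by (simp add: emeasure_eq_measure divide_ennreal flip: ennreal_indicator)
  qed (use A in auto)
  then have "cond_mean P A = (LINT x|P. (indicator A x / measure P A) *\<^sub>R x)"
    unfolding cond_mean_def using A pos by (simp add: integral_density borel_measurable_P)
  then show ?thesis by simp
qed

lemma cond_mean_lower:
  assumes A: "A \<in> sets borel" and pos: "0 < cut_mass t" and ae: "AE x in P. x \<in> A \<longleftrightarrow> x \<le> t"
  shows "cond_mean P A = 1 / 2 - cut_moment t / cut_mass t"
proof -
  have "measure P A = measure P {..t}"
    by (rule finite_measure_eq_AE) (use ae A in auto)
  also have "\<dots> = cut_mass t" by (simp add: cut_mass_def)
  finally have m: "measure P A = cut_mass t" .
  have "(LINT x|P. indicator A x * x) = (LINT x|P. 1 / 2 * indicator {..t} x - indicator {..t} x * (1 / 2 - x))"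
    by (rule integral_cong_AE)
      (use ae A in \<open>auto simp: borel_measurable_P indicator_def algebra_simps elim!: eventually_mono\<close>)
  also have "\<dots> = 1 / 2 * cut_mass t - cut_moment t"
    unfolding cut_mass_def cut_moment_def
    by (subst Bochner_Integration.integral_diff) (use integrable_cut_mass integrable_cut_moment in auto)
  finally show ?thesis
    using cond_mean_eq[OF A] pos unfolding m by (simp add: diff_divide_distrib)
qed

lemma cond_mean_upper:
  assumes A: "A \<in> sets borel" and pos: "cut_mass t < 1" and ae: "AE x in P. x \<in> A \<longleftrightarrow> t < x"
  shows "cond_mean P A = 1 / 2 + cut_moment t / (1 - cut_mass t)"
proof -
  have "measure P A = measure P (- {..t})"
    by (rule finite_measure_eq_AE) (use ae A in \<open>auto simp: not_le\<close>)
  also have "\<dots> = 1 - cut_mass t" using prob_compl[of "{..t}"] by (simp add: cut_mass_def Compl_eq_Diff_UNIV)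
  finally have m: "measure P A = 1 - cut_mass t" .
  have "(LINT x|P. indicator A x * x)
      = (LINT x|P. (x - 1 / 2 * indicator {..t} x) + indicator {..t} x * (1 / 2 - x))"
    by (rule integral_cong_AE)
      (use ae A in \<open>auto simp: borel_measurable_P indicator_def algebra_simps elim!: eventually_mono\<close>)
  also have "\<dots> = (LINT x|P. x) - 1 / 2 * cut_mass t + cut_moment t"
    unfolding cut_mass_def cut_moment_def
    using integrable_cut_mass[of t] integrable_cut_moment[of t] integrable_id by simp
  also have "\<dots> = 1 / 2 * (1 - cut_mass t) + cut_moment t" unfolding mean by (simp add: field_simps)
  finally have "cond_mean P A = (1 / 2 * (1 - cut_mass t) + cut_moment t) / (1 - cut_mass t)"
    using cond_mean_eq[OF A] pos unfolding m by simp
  then show ?thesis using pos by (simp add: add_divide_distrib)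
qed

lemma AE_level1: "AE x in P. x \<in> J r [1] \<union> (J r [2] \<union> J r [3])"
proof (rule AE_self_similar)
  show "{x. x \<in> J r [1] \<union> (J r [2] \<union> J r [3])} \<in> sets borel" by (simp add: J_single)
  show "AE x in P. S r j x \<in> J r [1] \<union> (J r [2] \<union> J r [3])" if j: "j \<in> {1, 2, 3}" for j
    using AE_support
  proof eventually_elim
    case (elim x)
    then have "S r j x \<in> J r [j]" unfolding J_def S_word_def by simp
    then show ?case using j by auto
  qed
qed

lemma cut1: "cut_mass r = 1 / 3" "cut_m r = 2 / 9"
proof -
  have eq: "r / r = 1" using r0 by simp
  have "r < (1 - r) / 2" using r3 by (simp add: field_simps)
  note left = cut_left[OF this, unfolded eq] and high = cut_high[OF order_refl]
  show "cut_mass r = 1 / 3" using left(1) high by simp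
  show "cut_m r = 2 / 9" using left(2) high by (simp add: cut_m_def)
qed

lemma cut2: "cut_mass ((1 - r) / 2 + r * r) = 4 / 9" "cut_m ((1 - r) / 2 + r * r) = 2 / 9 * (1 + r / 3)"
proof -
  define q where "q = r * r"
  have q: "0 < q" "q < r * (1 / 3)" unfolding q_def using r0 r3 by (auto intro!: mult_strict_left_mono)
  have "(1 - r) / 2 \<le> (1 - r) / 2 + r * r" using r0 by simp
  moreover have "(1 - r) / 2 + r * r < 1 - r" unfolding q_def[symmetric] using q r3 by (simp add: field_simps)
  ultimately have "(1 - r) / 2 \<le> (1 - r) / 2 + r * r" "(1 - r) / 2 + r * r < 1 - r" by blast+
  note mid = cut_middle[OF this]
  have eq: "((1 - r) / 2 + r * r - (1 - r) / 2) / r = r" using r0 by simp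
  show "cut_mass ((1 - r) / 2 + r * r) = 4 / 9" unfolding mid(1) eq cut1 by simp
  have "cut_m ((1 - r) / 2 + r * r) = 2 / 9 + r / 3 * (2 / 9)" unfolding mid(2) eq cut1 ..
  also have "\<dots> = 2 / 9 * (1 + r / 3)" by simp
  finally show "cut_m ((1 - r) / 2 + r * r) = 2 / 9 * (1 + r / 3)" .
qed

text \<open>Each side of the cut is served by its own conditional mean. As an upper bound this holds
  for every t, whether or not t is the midpoint of the two means.\<close>

lemma V_cut_le:
  assumes "0 < cut_mass t" "cut_mass t < 1"
  shows "V P {1 / 2 - cut_moment t / cut_mass t, 1 / 2 + cut_moment t / (1 - cut_mass t)}
    \<le> variance0 - (width r)\<^sup>2 * ((cut_m t)\<^sup>2 / (cut_mass t * (1 - cut_mass t)))"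
proof -
  define u M where "u = cut_mass t" and "M = cut_moment t"
  have u: "0 < u" "0 < 1 - u" using assms by (auto simp: u_def)
  have "V P {1 / 2 - M / u, 1 / 2 + M / (1 - u)}
      \<le> variance0 + u * (M / u)\<^sup>2 + (1 - u) * (M / (1 - u))\<^sup>2 - 2 * (M / u + M / (1 - u)) * M"
    using V_pair_le[of "1 / 2 - M / u" "1 / 2 + M / (1 - u)" t] unfolding u_def M_def by (simp add: add.commute)
  also have "u * (M / u)\<^sup>2 = M\<^sup>2 / u" using u by (simp add: power2_eq_square)
  also have "(1 - u) * (M / (1 - u))\<^sup>2 = M\<^sup>2 / (1 - u)" using u by (simp add: power2_eq_square)
  also have "variance0 + M\<^sup>2 / u + M\<^sup>2 / (1 - u) - 2 * (M / u + M / (1 - u)) * M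
      = variance0 - (M\<^sup>2 / u + M\<^sup>2 / (1 - u))"
    by (simp add: power2_eq_square algebra_simps)
  also have "M\<^sup>2 / u + M\<^sup>2 / (1 - u) = M\<^sup>2 / (u * (1 - u))"
    using u by (simp add: add_frac_eq) (simp add: algebra_simps)
  also have "M\<^sup>2 / (u * (1 - u)) = (width r)\<^sup>2 * ((cut_m t)\<^sup>2 / (cut_mass t * (1 - cut_mass t)))"
    unfolding M_def u_def cut_moment_eq power_mult_distrib times_divide_eq_right ..
  finally show ?thesis unfolding u_def M_def .
qed

lemma beta2_eq: "beta2 P r = {1 / 2 - cut_moment r / cut_mass r, 1 / 2 + cut_moment r / (1 - cut_mass r)}"
proof -
  have "a r [1] = 1 / 2 - cut_moment r / cut_mass r"
    unfolding a_def S_word_def cut_moment_eq cut1 by (simp add: S_def width_def field_simps)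
  moreover have "a_union P r {[2], [3]} = 1 / 2 + cut_moment r / (1 - cut_mass r)"
    unfolding a_union_def
  proof (rule cond_mean_upper)
    show "AE x in P. x \<in> (\<Union>w\<in>{[2], [3]}. J r w) \<longleftrightarrow> r < x"
      using AE_level1
    proof eventually_elim
      case (elim x)
      then show ?case using r0 r3 by (auto simp: J_single)
    qed
  qed (auto simp: J_single cut1)
  ultimately show ?thesis unfolding beta2_def by simp
qed

lemma V_beta2_le: "V P (beta2 P r) \<le> variance0 - (width r)\<^sup>2 * (2 / 9)"
proof -
  have eq: "(cut_m r)\<^sup>2 / (cut_mass r * (1 - cut_mass r)) = 2 / 9"
    unfolding cut1 by (simp add: power2_eq_square)
  have "0 < cut_mass r" "cut_mass r < 1" unfolding cut1 by simp_all
  from V_cut_le[OF this] show ?thesis unfolding beta2_eq eq .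
qed

lemma gamma2_eq:
  defines "t \<equiv> (1 - r) / 2 + r * r"
  shows "gamma2 P r = {1 / 2 - cut_moment t / cut_mass t, 1 / 2 + cut_moment t / (1 - cut_mass t)}"
proof -
  define q where "q = r * r"
  have q: "0 < q" "3 * q < r"
  proof -
    show "0 < q" using r0 by (simp add: q_def)
    have "r * r < r * (1 / 3)" using r0 r3 by (intro mult_strict_left_mono) auto
    then show "3 * q < r" by (simp add: q_def)
  qed
  have t: "t = (1 / 2 - r / 2) + q" by (simp add: t_def q_def field_simps)
  have J1: "J r [1] = {0..r}" "J r [2] = {(1 / 2 - r / 2)..(1 / 2 + r / 2)}" "J r [3] = {1 - r..1}"
    by (simp_all add: J_single field_simps)
  have J2: "J r [2, 1] = {(1 / 2 - r / 2)..(1 / 2 - r / 2) + q}"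
    "J r [2, 2] = {(r / 2 - q / 2) + (1 / 2 - r / 2)..(r / 2 + q / 2) + (1 / 2 - r / 2)}"
    "J r [2, 3] = {(r - q) + (1 / 2 - r / 2)..r + (1 / 2 - r / 2)}"
    by (simp_all add: J_double q_def field_simps)
  have S: "S r 1 x = r * x" "S r 2 x = r * x + (1 / 2 - r / 2)" "S r 3 x = r * x + (1 - r)" for x
    by (simp_all add: S_def)
  have "a_union P r {[1], [2, 1]} = 1 / 2 - cut_moment t / cut_mass t"
    unfolding a_union_def
  proof (rule cond_mean_lower)
    define A where "A = (\<Union>w\<in>{[1], [2, 1]}. J r w)"
    have A: "A = {0..r} \<union> {(1 / 2 - r / 2)..(1 / 2 - r / 2) + q}"
      by (simp add: A_def J1 J2 del: One_nat_def)
    have "AE x in P. x \<in> A \<longleftrightarrow> x \<le> t"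
    proof (rule AE_self_similar)
      have "{x. x \<in> A \<longleftrightarrow> x \<le> t} = (A \<inter> {..t}) \<union> (- A \<inter> {t<..})" by auto
      then show "{x. x \<in> A \<longleftrightarrow> x \<le> t} \<in> sets borel" by (simp add: A)
      show "AE x in P. S r j x \<in> A \<longleftrightarrow> S r j x \<le> t" if j: "j \<in> {1, 2, 3}" for j
        using AE_support
      proof eventually_elim
        case (elim x)
        define y where "y = r * x"
        have y: "0 \<le> y" "y \<le> r" using elim r0 by (auto simp: y_def mult_left_le)
        consider "j = 1" | "j = 2" | "j = 3" using j by blast
        then show ?case
        proof cases
          case 1
          then show ?thesis using y q r3 unfolding A t 1 S y_def[symmetric] by auto
        next
          case 2
          then show ?thesis using y q r3 unfolding A t 2 S y_def[symmetric] by auto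
        next
          case 3
          then show ?thesis using y q r3 unfolding A t 3 S y_def[symmetric] by auto
        qed
      qed
    qed
    then show "AE x in P. x \<in> (\<Union>w\<in>{[1], [2, 1]}. J r w) \<longleftrightarrow> x \<le> t" unfolding A_def .
    show "0 < cut_mass t" unfolding t_def cut2 by simp
  qed (simp add: J1 J2 del: One_nat_def)
  moreover have "a_union P r {[2, 2], [2, 3], [3]} = 1 / 2 + cut_moment t / (1 - cut_mass t)"
    unfolding a_union_def
  proof (rule cond_mean_upper)
    define A where "A = (\<Union>w\<in>{[2, 2], [2, 3], [3]}. J r w)"
    have A: "A = {(r / 2 - q / 2) + (1 / 2 - r / 2)..(r / 2 + q / 2) + (1 / 2 - r / 2)} \<union>
        ({(r - q) + (1 / 2 - r / 2)..r + (1 / 2 - r / 2)} \<union> {1 - r..1})" by (simp add: A_def J1 J2)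
    have "AE x in P. x \<in> A \<longleftrightarrow> t < x"
    proof (rule AE_self_similar)
      have "{x. x \<in> A \<longleftrightarrow> t < x} = (A \<inter> {t<..}) \<union> (- A \<inter> {..t})" by auto
      then show "{x. x \<in> A \<longleftrightarrow> t < x} \<in> sets borel" by (simp add: A)
      show "AE x in P. S r j x \<in> A \<longleftrightarrow> t < S r j x" if j: "j \<in> {1, 2, 3}" for j
        \<comment> \<open>Whether \<open>S r 2 x\<close> lies in J_22 or J_23 is a level-two
          condition, so x itself has to be located in a level-one cell.\<close>
        using AE_level1
      proof eventually_elim
        case (elim x)
        then have x: "x \<in> {0..1}" using r0 r3 unfolding J1 by auto
        define y where "y = r * x"
        have y: "0 \<le> y" "y \<le> r" using x r0 by (auto simp: y_def mult_left_le)
        have y3: "y \<le> q \<or> ((r / 2 - q / 2) \<le> y \<and> y \<le> (r / 2 + q / 2)) \<or> r - q \<le> y"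
        proof -
          consider "x \<le> r" | "(1 / 2 - r / 2) \<le> x" "x \<le> (1 / 2 + r / 2)" | "1 - r \<le> x"
            using elim unfolding J1 by auto
          then show ?thesis
          proof cases
            case 1
            then have "y \<le> q" unfolding y_def q_def using r0 by (intro mult_left_mono) auto
            then show ?thesis by blast
          next
            case 2
            then have "r * ((1 / 2 - r / 2)) \<le> y" "y \<le> r * ((1 / 2 + r / 2))"
              unfolding y_def using r0 by (auto intro: mult_left_mono)
            then have "(r / 2 - q / 2) \<le> y" "y \<le> (r / 2 + q / 2)" by (simp_all add: q_def algebra_simps)
            then show ?thesis by blast
          next
            case 3
            then have "r * (1 - r) \<le> y" unfolding y_def using r0 by (intro mult_left_mono) auto
            then have "r - q \<le> y" by (simp add: q_def algebra_simps)
            then show ?thesis by blast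
          qed
        qed
        consider "j = 1" | "j = 2" | "j = 3" using j by blast
        then show ?case
        proof cases
          case 1
          then show ?thesis using y q r3 unfolding A t 1 S y_def[symmetric] by auto
        next
          case 2
          show ?thesis using y y3 q r3 unfolding A t 2 S y_def[symmetric] by auto
        next
          case 3
          then show ?thesis using y q r3 unfolding A t 3 S y_def[symmetric] by auto
        qed
      qed
    qed
    then show "AE x in P. x \<in> (\<Union>w\<in>{[2, 2], [2, 3], [3]}. J r w) \<longleftrightarrow> t < x" unfolding A_def .
    show "cut_mass t < 1" unfolding t_def cut2 by simp
  qed (simp add: J1 J2)
  ultimately show ?thesis unfolding gamma2_def by simp
qed

lemma V_gamma2_le: "V P (gamma2 P r) \<le> variance0 - (width r)\<^sup>2 * ((1 + r / 3)\<^sup>2 / 5)"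
proof -
  define t where "t = (1 - r) / 2 + r * r"
  have eq: "(cut_m t)\<^sup>2 / (cut_mass t * (1 - cut_mass t)) = (1 + r / 3)\<^sup>2 / 5"
    unfolding t_def cut2 by (simp add: power2_eq_square field_simps)
  have "0 < cut_mass t" "cut_mass t < 1" unfolding t_def cut2 by simp_all
  from V_cut_le[OF this] show ?thesis unfolding gamma2_eq t_def[symmetric] eq .
qed

end

section \<open>Words and the level \<open>ell\<close>\<close>

lemma words_0: "words 0 = {[]}"
  by (auto simp: words_def)

lemma words_Suc: "words (Suc l) = (\<lambda>(j, w). j # w) ` ({1, 2, 3} \<times> words l)"
  by (auto simp: words_def length_Suc_conv image_iff)

lemma finite_words: "finite (words l)" and card_words: "card (words l) = 3 ^ l"
proof -
  have "words l = {w. set w \<subseteq> {1, 2, 3} \<and> length w = l}" by (auto simp: words_def)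
  moreover have "card {1, 2, 3::nat} = 3" "finite {1, 2, 3::nat}" by simp_all
  ultimately show "finite (words l)" "card (words l) = 3 ^ l"
    using card_lists_length_eq[of "{1, 2, 3::nat}" l] finite_lists_length_eq[of "{1, 2, 3::nat}" l]
    by (simp_all only:)
qed

lemma ell_bounds: assumes "1 \<le> n" shows "3 ^ ell n \<le> n" "n < 3 ^ (ell n + 1)"
proof -
  have "\<exists>l. 3 ^ l \<le> n \<and> n < 3 ^ (l + 1)"
    using ex_power_ivl1[of 3 n] assms by auto
  moreover have "l = l'" if "3 ^ l \<le> n \<and> n < 3 ^ (l + 1)" "3 ^ l' \<le> n \<and> n < 3 ^ (l' + 1)" for l l'
  proof -
    have "3 ^ l < (3::nat) ^ (l' + 1)" "3 ^ l' < (3::nat) ^ (l + 1)" using that by linarith+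
    then show ?thesis
      using power_less_imp_less_exp[of "3::nat" l "l' + 1"] power_less_imp_less_exp[of "3::nat" l' "l + 1"] by simp
  qed
  ultimately have "\<exists>!l. 3 ^ l \<le> n \<and> n < 3 ^ (l + 1)" by blast
  from theI'[OF this] have "3 ^ ell n \<le> n \<and> n < 3 ^ (ell n + 1)" unfolding ell_def .
  then show "3 ^ ell n \<le> n" "n < 3 ^ (ell n + 1)" by auto
qed

section \<open>Upper bounds meet the Lagrangian bounds\<close>

context small_ratio
begin

lemma rescale_S: "rescale j (S r j x) = x"
  using r_pos by (simp add: rescale_def S_def)

text \<open>Cell w is served by its copy of \<open>B w\<close> alone; the other points of A can only
  lower the error.\<close>

lemma V_words_le:
  assumes "finite A" "A \<noteq> {}"
    and "\<And>w. w \<in> words l \<Longrightarrow> B w \<noteq> {} \<and> S_word r w ` B w \<subseteq> A"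
  shows "V P A \<le> (r\<^sup>2 / 3) ^ l * (\<Sum>w\<in>words l. V P (B w))"
  using assms
proof (induction l arbitrary: A B)
  case 0
  then have "B [] \<noteq> {}" "B [] \<subseteq> A" by (auto simp: words_0 S_word_def)
  then show ?case using 0 V_antimono[of A "B []"] by (simp add: words_0)
next
  case (Suc l)
  have IH: "V P (rescale j ` A) \<le> (r\<^sup>2 / 3) ^ l * (\<Sum>w\<in>words l. V P (B (j # w)))" if j: "j \<in> {1, 2, 3}" for j
  proof (rule Suc.IH)
    fix w assume "w \<in> words l"
    then have "j # w \<in> words (Suc l)" using j by (auto simp: words_def)
    then have "B (j # w) \<noteq> {}" "S_word r (j # w) ` B (j # w) \<subseteq> A" using Suc.prems(3) by blast+
    then have "rescale j ` S r j ` S_word r w ` B (j # w) \<subseteq> rescale j ` A"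
      unfolding S_word_def by (intro image_mono) (simp add: image_comp)
    then show "B (j # w) \<noteq> {} \<and> S_word r w ` B (j # w) \<subseteq> rescale j ` A"
      using \<open>B (j # w) \<noteq> {}\<close> by (simp add: image_image rescale_S)
  qed (use Suc.prems in auto)
  have inj: "inj_on (\<lambda>(j, w). j # w) ({1, 2, 3::nat} \<times> words l)" by (auto simp: inj_on_def)
  have "(\<Sum>w\<in>words (Suc l). V P (B w)) = (\<Sum>(j, w)\<in>{1, 2, 3} \<times> words l. V P (B (j # w)))"
    unfolding words_Suc by (subst sum.reindex[OF inj]) (auto intro!: sum.cong)
  also have "\<dots> = (\<Sum>j\<in>{1, 2, 3}. \<Sum>w\<in>words l. V P (B (j # w)))"
    by (rule sum.cartesian_product[symmetric])
  finally have sum: "(\<Sum>w\<in>words (Suc l). V P (B w)) = (\<Sum>w\<in>words l. V P (B (1 # w)))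
      + (\<Sum>w\<in>words l. V P (B (2 # w))) + (\<Sum>w\<in>words l. V P (B (3 # w)))"
    by (simp add: add.assoc)
  have "V P A = r\<^sup>2 / 3 * (V P (rescale 1 ` A) + V P (rescale 2 ` A) + V P (rescale 3 ` A))"
    using Suc.prems by (intro V_rescale)
  also have "\<dots> \<le> r\<^sup>2 / 3 * ((r\<^sup>2 / 3) ^ l * (\<Sum>w\<in>words l. V P (B (1 # w)))
      + (r\<^sup>2 / 3) ^ l * (\<Sum>w\<in>words l. V P (B (2 # w))) + (r\<^sup>2 / 3) ^ l * (\<Sum>w\<in>words l. V P (B (3 # w))))"
    using IH[of 1] IH[of 2] IH[of 3] by (intro mult_left_mono add_mono) auto
  also have "\<dots> = (r\<^sup>2 / 3) ^ Suc l * (\<Sum>w\<in>words (Suc l). V P (B w))"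
    unfolding sum by (simp add: distrib_left)
  finally show ?case .
qed

lemma V_theta3_le: "V P (theta3 r) \<le> r\<^sup>2 * variance0"
proof -
  have "V P (theta3 r) \<le> (r\<^sup>2 / 3) ^ 1 * (\<Sum>w\<in>words 1. V P {1 / 2})"
  proof (rule V_words_le)
    fix w assume "w \<in> words 1"
    then have "w \<in> {[1], [2], [3]}" by (auto simp: words_def length_Suc_conv)
    then show "{1 / 2::real} \<noteq> {} \<and> S_word r w ` {1 / 2} \<subseteq> theta3 r"
      by (auto simp: theta3_def a_def)
  qed (auto simp: theta3_def)
  then show ?thesis by (simp add: card_words V_singleton)
qed

lemma optimalI:
  assumes "\<theta> \<in> candidates n" "V P \<theta> \<le> F" "\<And>\<alpha>. \<alpha> \<in> candidates n \<Longrightarrow> F \<le> V P \<alpha>"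
  shows "optimal_n_means P n \<theta>"
proof -
  have "bdd_below (V P ` candidates n)"
    using V_nonneg by (intro bdd_belowI2[of _ 0]) (auto simp: candidates_def)
  then have "(INF \<alpha>\<in>candidates n. V P \<alpha>) \<le> V P \<theta>" using assms(1) by (intro cINF_lower)
  moreover have "V P \<theta> \<le> (INF \<alpha>\<in>candidates n. V P \<alpha>)"
    using assms by (intro cINF_greatest) (auto intro: order_trans)
  ultimately show ?thesis using assms(1) by (simp add: optimal_n_means_def V_inf_def)
qed

lemma two_means_optimal:
  assumes "finite \<theta>" "\<theta> \<noteq> {}" "card \<theta> \<le> 2" "V P \<theta> \<le> V2"
  shows "optimal_n_means P 2 \<theta>"
proof (rule optimalI)
  show "\<theta> \<in> candidates 2" using assms by (simp add: candidates_def)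
  fix \<alpha> :: "real set" assume "\<alpha> \<in> candidates 2"
  then have \<alpha>: "finite \<alpha>" "\<alpha> \<noteq> {}" "card \<alpha> \<le> 2" by (auto simp: candidates_def)
  then have "card \<alpha> \<noteq> 0" by simp
  with \<alpha>(3) have "card \<alpha> = 1 \<or> card \<alpha> = 2" by linarith
  then obtain b d where "\<alpha> = {b, d}" by (auto simp: card_1_singleton_iff card_2_iff)
  then show "V2 \<le> V P \<alpha>" using V_two_ge by simp
qed (rule assms)

text \<open>The penalties are the slopes of the convex, piecewise linear optimal error at level \<open>l\<close>.\<close>
lemma lower_bound1:
  assumes "1 \<le> l" "finite \<alpha>" "\<alpha> \<noteq> {}"
  shows "(r\<^sup>2 / 3) ^ l * (3 ^ l * (variance0 + c\<^sup>2 * g) - c\<^sup>2 * g * card \<alpha>) \<le> V P \<alpha>"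
proof -
  \<comment> \<open>\<open>penalized_base1\<close> is already at level 1, so one iteration fewer is
    needed.\<close>
  obtain k where k: "l = Suc k" using assms(1) by (cases l) auto
  have "penalized ((r\<^sup>2 / 3) ^ k * (r\<^sup>2 / 3 * (c\<^sup>2 * g))) ((r\<^sup>2) ^ k * (r\<^sup>2 * (variance0 + c\<^sup>2 * g)))"
    by (rule penalized_iterate[OF penalized_base1]) (simp add: g_bounds)
  from penalizedD[OF this assms(2,3)]
  have "(r\<^sup>2) ^ l * (variance0 + c\<^sup>2 * g) \<le> V P \<alpha> + (r\<^sup>2 / 3) ^ l * (c\<^sup>2 * g) * card \<alpha>"
    unfolding k by (simp add: mult_ac)
  moreover have "(r\<^sup>2) ^ l = (r\<^sup>2 / 3) ^ l * 3 ^ l" by (simp add: power_divide)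
  ultimately show ?thesis by (simp add: right_diff_distrib mult.assoc)
qed

lemma lower_bound2:
  assumes "finite \<alpha>" "\<alpha> \<noteq> {}"
  shows "(r\<^sup>2 / 3) ^ l * (3 ^ l * (V2 + 2 * D3) - D3 * card \<alpha>) \<le> V P \<alpha>"
proof -
  have "penalized ((r\<^sup>2 / 3) ^ l * D3) ((r\<^sup>2) ^ l * (V2 + 2 * D3))"
    by (rule penalized_iterate[OF penalized_base2 D3_nonneg])
  from penalizedD[OF this assms]
  have "(r\<^sup>2) ^ l * (V2 + 2 * D3) \<le> V P \<alpha> + (r\<^sup>2 / 3) ^ l * D3 * card \<alpha>" .
  moreover have "(r\<^sup>2) ^ l = (r\<^sup>2 / 3) ^ l * 3 ^ l" by (simp add: power_divide)
  ultimately show ?thesis by (simp add: right_diff_distrib mult.assoc)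
qed

text \<open>Adding up the cells gives a value linear in n on each of the two ranges, equal to the
  Lagrangian bound there. Only card \<le> n is shown, so coinciding points would do no harm.\<close>

lemma theta_optimal:
  assumes \<theta>: "finite \<theta>" "\<theta> \<noteq> {}" "card \<theta> \<le> 2" "V P \<theta> \<le> V2"
    and n: "3 \<le> n" and I: "admissible n I"
  shows "optimal_n_means P n (theta r \<theta> (theta3 r) n I)"
proof -
  define l where "l = ell n"
  have l: "3 ^ l \<le> n" "n < 3 ^ (l + 1)" using ell_bounds[of n] n by (auto simp: l_def)
  then have "1 \<le> l" using n by (cases l) auto
  have sub: "I \<subseteq> words l" using I by (simp add: admissible_def l_def)
  have finI: "finite I" using sub finite_words finite_subset by blast
  have finC: "finite (words l - I)" using finite_words by blast
  have cardC: "card (words l - I) = 3 ^ l - card I" "card I \<le> 3 ^ l"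
    using card_Diff_subset[OF finI sub] card_mono[OF finite_words sub] by (simp_all add: card_words)
  have realC: "real (card (words l - I)) = 3 ^ l - real (card I)"
    using cardC by (simp add: of_nat_diff)
  have split: "(\<Sum>w\<in>words l. if w \<in> I then x else y) = real (card I) * x + real (card (words l - I)) * y"
    for x y :: real
  proof -
    have "words l \<inter> {w. w \<in> I} = I" "words l \<inter> - {w. w \<in> I} = words l - I" using sub by auto
    then show ?thesis using sum.If_cases[OF finite_words, of "\<lambda>w. w \<in> I" "\<lambda>_. x" "\<lambda>_. y" l] by simp
  qed
  have cardS: "card (\<Union>w\<in>K. S_word r w ` \<Theta>) \<le> card K * m" if "finite K" "card \<Theta> \<le> m" "finite \<Theta>" for K \<Theta> m
  proof -
    have "card (\<Union>w\<in>K. S_word r w ` \<Theta>) \<le> (\<Sum>w\<in>K. card (S_word r w ` \<Theta>))"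
      using that(1) by (rule card_UN_le)
    also have "\<dots> \<le> (\<Sum>w\<in>K. m)"
      using that by (intro sum_mono order_trans[OF card_image_le])
    finally show ?thesis by simp
  qed
  define T where "T = theta r \<theta> (theta3 r) n I"
  have T3: "finite (theta3 r)" "theta3 r \<noteq> {}" "card (theta3 r) \<le> 3"
    by (auto simp: theta3_def card_insert_if)
  show ?thesis
  proof (cases "n \<le> 2 * 3 ^ l")
    case True
    then have cI: "card I = n - 3 ^ l" using I by (simp add: admissible_def l_def)
    then have nI: "n = 3 ^ l + card I" using l by simp
    have T: "T = a r ` (words l - I) \<union> (\<Union>w\<in>I. S_word r w ` \<theta>)"
      using True by (simp add: T_def theta_def l_def)
    have "finite T" unfolding T using finC finI \<theta> by blast
    have "card T \<le> card (a r ` (words l - I)) + card (\<Union>w\<in>I. S_word r w ` \<theta>)"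
      unfolding T by (rule card_Un_le)
    also have "\<dots> \<le> card (words l - I) + card I * 2"
      using finC finI \<theta> by (intro add_mono card_image_le cardS)
    also have "\<dots> = n" using cardC nI by simp
    finally have "card T \<le> n" .
    define B where "B w = (if w \<in> I then \<theta> else {1 / 2})" for w
    have BT: "B w \<noteq> {} \<and> S_word r w ` B w \<subseteq> T" if "w \<in> words l" for w
      using that \<theta> unfolding B_def T by (auto simp: a_def)
    have "words l \<noteq> {}" using card_words[of l] by auto
    then have "T \<noteq> {}" using BT by blast
    have "V P T \<le> (r\<^sup>2 / 3) ^ l * (\<Sum>w\<in>words l. V P (B w))"
      by (rule V_words_le[OF \<open>finite T\<close> \<open>T \<noteq> {}\<close> BT])
    also have "\<dots> \<le> (r\<^sup>2 / 3) ^ l * (\<Sum>w\<in>words l. if w \<in> I then V2 else variance0)"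
      using \<theta>(4) by (intro mult_left_mono sum_mono) (auto simp: B_def V_singleton)
    also have "(\<Sum>w\<in>words l. if w \<in> I then V2 else variance0) = 3 ^ l * (variance0 + c\<^sup>2 * g) - c\<^sup>2 * g * n"
      unfolding split realC V2_def nI by (simp add: algebra_simps)
    finally have VT: "V P T \<le> (r\<^sup>2 / 3) ^ l * (3 ^ l * (variance0 + c\<^sup>2 * g) - c\<^sup>2 * g * n)" .
    show ?thesis
      unfolding T_def[symmetric]
    proof (rule optimalI[OF _ VT])
      show "T \<in> candidates n" using \<open>finite T\<close> \<open>T \<noteq> {}\<close> \<open>card T \<le> n\<close> by (simp add: candidates_def)
      fix \<alpha> :: "real set" assume "\<alpha> \<in> candidates n"
      then have \<alpha>: "finite \<alpha>" "\<alpha> \<noteq> {}" "card \<alpha> \<le> n" by (auto simp: candidates_def)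
      have "(r\<^sup>2 / 3) ^ l * (3 ^ l * (variance0 + c\<^sup>2 * g) - c\<^sup>2 * g * n)
          \<le> (r\<^sup>2 / 3) ^ l * (3 ^ l * (variance0 + c\<^sup>2 * g) - c\<^sup>2 * g * card \<alpha>)"
        using \<alpha>(3) g_bounds by (intro mult_left_mono diff_left_mono) auto
      also have "\<dots> \<le> V P \<alpha>" by (rule lower_bound1[OF \<open>1 \<le> l\<close> \<alpha>(1,2)])
      finally show "(r\<^sup>2 / 3) ^ l * (3 ^ l * (variance0 + c\<^sup>2 * g) - c\<^sup>2 * g * n) \<le> V P \<alpha>" .
    qed
  next
    case False
    then have cI: "card I = n - 2 * 3 ^ l" using I by (simp add: admissible_def l_def)
    then have nI: "n = 2 * 3 ^ l + card I" using False by simp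
    have T: "T = (\<Union>w\<in>words l - I. S_word r w ` \<theta>) \<union> (\<Union>w\<in>I. S_word r w ` theta3 r)"
      using False by (simp add: T_def theta_def l_def)
    have "finite T" unfolding T using finC finI \<theta> T3 by blast
    have "card T \<le> card (\<Union>w\<in>words l - I. S_word r w ` \<theta>) + card (\<Union>w\<in>I. S_word r w ` theta3 r)"
      unfolding T by (rule card_Un_le)
    also have "\<dots> \<le> card (words l - I) * 2 + card I * 3"
      using finC finI \<theta> T3 by (intro add_mono cardS)
    also have "\<dots> = n" using cardC nI by simp
    finally have "card T \<le> n" .
    define B where "B w = (if w \<in> I then theta3 r else \<theta>)" for w
    have BT: "B w \<noteq> {} \<and> S_word r w ` B w \<subseteq> T" if "w \<in> words l" for w
      using that \<theta> T3 unfolding B_def T by auto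
    have "words l \<noteq> {}" using card_words[of l] by auto
    then have "T \<noteq> {}" using BT by blast
    have "V P T \<le> (r\<^sup>2 / 3) ^ l * (\<Sum>w\<in>words l. V P (B w))"
      by (rule V_words_le[OF \<open>finite T\<close> \<open>T \<noteq> {}\<close> BT])
    also have "\<dots> \<le> (r\<^sup>2 / 3) ^ l * (\<Sum>w\<in>words l. if w \<in> I then r\<^sup>2 * variance0 else V2)"
      using \<theta>(4) V_theta3_le by (intro mult_left_mono sum_mono) (auto simp: B_def)
    also have "(\<Sum>w\<in>words l. if w \<in> I then r\<^sup>2 * variance0 else V2) = 3 ^ l * (V2 + 2 * D3) - D3 * n"
      unfolding split realC D3_def nI by (simp add: algebra_simps)
    finally have VT: "V P T \<le> (r\<^sup>2 / 3) ^ l * (3 ^ l * (V2 + 2 * D3) - D3 * n)" .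
    show ?thesis
      unfolding T_def[symmetric]
    proof (rule optimalI[OF _ VT])
      show "T \<in> candidates n" using \<open>finite T\<close> \<open>T \<noteq> {}\<close> \<open>card T \<le> n\<close> by (simp add: candidates_def)
      fix \<alpha> :: "real set" assume "\<alpha> \<in> candidates n"
      then have \<alpha>: "finite \<alpha>" "\<alpha> \<noteq> {}" "card \<alpha> \<le> n" by (auto simp: candidates_def)
      have "(r\<^sup>2 / 3) ^ l * (3 ^ l * (V2 + 2 * D3) - D3 * n)
          \<le> (r\<^sup>2 / 3) ^ l * (3 ^ l * (V2 + 2 * D3) - D3 * card \<alpha>)"
        using \<alpha>(3) D3_nonneg by (intro mult_left_mono diff_left_mono) auto
      also have "\<dots> \<le> V P \<alpha>" by (rule lower_bound2[OF \<alpha>(1,2)])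
      finally show "(r\<^sup>2 / 3) ^ l * (3 ^ l * (V2 + 2 * D3) - D3 * n) \<le> V P \<alpha>" .
    qed
  qed
qed

end

section \<open>The critical ratios\<close>

text \<open>Over a common denominator the factor 3 (1 - s)^2 (1 + s) splits off; what remains says
  that the two entries of \<open>gain\<close> agree.\<close>

lemma r0_equation_iff:
  assumes "0 < s" "s < 1 / 3"
  shows "r0_equation s \<longleftrightarrow> (s + 3)\<^sup>2 = 10"
proof -
  define p q where "p = 3 * s^5 + 15 * s^4 + 6 * s^3 - 42 * s^2 + 31 * s - 13"
    and "q = 3 * s^3 - 3 * s^2 + s - 1"
  have "r0_equation s \<longleftrightarrow> p / (240 * (s + 1)) = q / (24 * (s + 1))"
    unfolding r0_equation_def p_def q_def by simp
  also have "\<dots> \<longleftrightarrow> p / 240 / (s + 1) = q / 24 / (s + 1)" by simp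
  also have "\<dots> \<longleftrightarrow> p / 240 = q / 24" using assms by (simp only: divide_cancel_right) simp
  also have "\<dots> \<longleftrightarrow> p - 10 * q = 0" by auto
  also have "p - 10 * q = 3 * (1 - s)\<^sup>2 * (1 + s) * ((s + 3)\<^sup>2 - 10)"
    unfolding p_def q_def by (simp add: eval_nat_numeral algebra_simps)
  also have "\<dots> = 0 \<longleftrightarrow> (s + 3)\<^sup>2 = 10" using assms by simp
  finally show ?thesis .
qed

text \<open>The same factor splits off, and equality in \<open>r_le_r1\<close> remains.\<close>

lemma r1_equation_iff:
  assumes "0 < s" "s < 1 / 3"
  shows "r1_equation s \<longleftrightarrow> 91 * (3 + s)\<^sup>2 = 10 * (9 + 3 * s + s\<^sup>2)\<^sup>2"
proof -
  define p q where "p = 3 * s^5 + 15 * s^4 + 6 * s^3 - 42 * s^2 + 31 * s - 13"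
    and "q = 3 * s^7 + 15 * s^6 + 60 * s^5 + 66 * s^4 + 18 * s^3 - 324 * s^2 + 283 * s - 121"
  have "r1_equation s \<longleftrightarrow> p / (240 * (s + 1)) = q / (2184 * (s + 1))"
    unfolding r1_equation_def p_def q_def by simp
  also have "\<dots> \<longleftrightarrow> p / 240 / (s + 1) = q / 2184 / (s + 1)" by simp
  also have "\<dots> \<longleftrightarrow> p / 240 = q / 2184" using assms by (simp only: divide_cancel_right) simp
  also have "\<dots> \<longleftrightarrow> 91 * p - 10 * q = 0" by auto
  also have "91 * p - 10 * q = 3 * (1 - s)\<^sup>2 * (1 + s) * (91 * (3 + s)\<^sup>2 - 10 * (9 + 3 * s + s\<^sup>2)\<^sup>2)"
    unfolding p_def q_def by (simp add: eval_nat_numeral algebra_simps)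
  also have "\<dots> = 0 \<longleftrightarrow> 91 * (3 + s)\<^sup>2 = 10 * (9 + 3 * s + s\<^sup>2)\<^sup>2" using assms by auto
  finally show ?thesis .
qed

lemma card_beta2_le: "finite (beta2 P r)" "beta2 P r \<noteq> {}" "card (beta2 P r) \<le> 2"
  by (auto simp: beta2_def card_insert_if)

lemma card_gamma2_le: "finite (gamma2 P r)" "gamma2 P r \<noteq> {}" "card (gamma2 P r) \<le> 2"
  by (auto simp: gamma2_def card_insert_if)

lemma (in small_ratio) V_beta2_le_V2:
  assumes "(r + 3)\<^sup>2 \<le> 10"
  shows "V P (beta2 P r) \<le> V2"
proof -
  have "(1 + r / 3)\<^sup>2 / 5 = (r + 3)\<^sup>2 / 45" by (simp add: power2_eq_square field_simps)
  then have g_eq: "gain r = 2 / 9" using assms by (simp add: gain_def)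
  show ?thesis using V_beta2_le unfolding V2_def g_eq .
qed

lemma (in small_ratio) V_gamma2_le_V2:
  assumes "10 \<le> (r + 3)\<^sup>2"
  shows "V P (gamma2 P r) \<le> V2"
proof -
  have "(1 + r / 3)\<^sup>2 / 5 = (r + 3)\<^sup>2 / 45" by (simp add: power2_eq_square field_simps)
  then have g_eq: "gain r = (1 + r / 3)\<^sup>2 / 5" using assms by (simp add: gain_def)
  show ?thesis using V_gamma2_le unfolding V2_def g_eq .
qed

section \<open>Closed forms and decimals of the critical ratios\<close>

definition crit0 :: real where "crit0 = sqrt 10 - 3"

definition crit1 :: real where
  "crit1 = (let e = sqrt (91 / 10) - 3 in (e + sqrt (e\<^sup>2 + 12 * e)) / 2)"

lemma crit0_bounds: "0.16227766015 < crit0 \<and> crit0 < 0.16227766022"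
proof -
  have "3.16227766015 < sqrt 10" "sqrt 10 < 3.16227766022"
    by (rule real_less_rsqrt, simp add: power2_eq_square) (rule real_less_lsqrt; simp add: power2_eq_square)
  then show ?thesis unfolding crit0_def by simp
qed

lemma le_crit0_iff: "0 < s \<Longrightarrow> s \<le> crit0 \<longleftrightarrow> (s + 3)\<^sup>2 \<le> 10"
  using real_le_rsqrt[of "s + 3" 10] sqrt_ge_absD[of "s + 3" 10] by (auto simp: crit0_def)

lemma ge_crit0_iff: "0 < s \<Longrightarrow> crit0 \<le> s \<longleftrightarrow> 10 \<le> (s + 3)\<^sup>2"
  using real_le_lsqrt[of "s + 3" 10] sqrt_le_D[of 10 "s + 3"] by (auto simp: crit0_def)

lemma crit0_root_iff: "0 < s \<Longrightarrow> (s + 3)\<^sup>2 = 10 \<longleftrightarrow> s = crit0"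
  using le_crit0_iff[of s] ge_crit0_iff[of s] by auto

text \<open>The equation for \<open>r\<^sub>1\<close> reads \<open>9 + 3s + s\<^sup>2 = q (3 + s)\<close> with \<open>q\<^sup>2 = 91/10\<close>, that is
  \<open>s\<^sup>2 - e s - 3 e = 0\<close> with \<open>e = q - 3\<close>.\<close>
lemma crit1_poly:
  fixes s :: real
  assumes "0 < s"
  shows "10 * (9 + 3 * s + s\<^sup>2)\<^sup>2 \<le> 91 * (3 + s)\<^sup>2 \<longleftrightarrow> s \<le> crit1"
    and "91 * (3 + s)\<^sup>2 = 10 * (9 + 3 * s + s\<^sup>2)\<^sup>2 \<longleftrightarrow> s = crit1"
proof -
  define q e d where "q = sqrt (91 / 10)" and "e = q - 3" and "d = sqrt (e\<^sup>2 + 12 * e)"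
  have q2: "q\<^sup>2 = 91 / 10" by (simp add: q_def)
  have "3 < q" unfolding q_def by (rule real_less_rsqrt) (simp add: power2_eq_square)
  then have e: "0 < e" by (simp add: e_def)
  then have d2: "d\<^sup>2 = e\<^sup>2 + 12 * e" by (simp add: d_def)
  have "e < d" unfolding d_def by (rule real_less_rsqrt) (use e in simp)
  have crit: "crit1 = (e + d) / 2" unfolding crit1_def Let_def e_def d_def q_def ..
  define u v where "u = 9 + 3 * s + s\<^sup>2" and "v = q * (3 + s)"
  have uv: "0 < u + v" using assms \<open>3 < q\<close> by (simp add: u_def v_def add_pos_pos)
  have "v\<^sup>2 = 91 / 10 * (3 + s)\<^sup>2" unfolding v_def power_mult_distrib q2 ..
  then have "10 * u\<^sup>2 - 91 * (3 + s)\<^sup>2 = 10 * (u\<^sup>2 - v\<^sup>2)" by simp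
  also have "\<dots> = 10 * ((u - v) * (u + v))" by (simp add: algebra_simps power2_eq_square)
  finally have "10 * u\<^sup>2 - 91 * (3 + s)\<^sup>2 = 10 * ((u - v) * (u + v))" .
  moreover have "u - v = (s - crit1) * (s + (d - e) / 2)"
    using d2 by (simp add: crit u_def v_def e_def power2_eq_square field_simps)
  moreover define w where "w = 10 * (s + (d - e) / 2) * (u + v)"
  ultimately have eq: "10 * u\<^sup>2 - 91 * (3 + s)\<^sup>2 = (s - crit1) * w" by simp
  have pos: "0 < w" using assms \<open>e < d\<close> uv unfolding w_def by (simp add: add_pos_pos)
  have "10 * u\<^sup>2 \<le> 91 * (3 + s)\<^sup>2 \<longleftrightarrow> (s - crit1) * w \<le> 0"
    unfolding eq[symmetric] by simp
  also have "\<dots> \<longleftrightarrow> s \<le> crit1" using pos by (auto simp: mult_le_0_iff)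
  finally show "10 * (9 + 3 * s + s\<^sup>2)\<^sup>2 \<le> 91 * (3 + s)\<^sup>2 \<longleftrightarrow> s \<le> crit1" unfolding u_def .
  have "91 * (3 + s)\<^sup>2 = 10 * u\<^sup>2 \<longleftrightarrow> (s - crit1) * w = 0"
    unfolding eq[symmetric] by auto
  also have "\<dots> \<longleftrightarrow> s = crit1" using pos by auto
  finally show "91 * (3 + s)\<^sup>2 = 10 * (9 + 3 * s + s\<^sup>2)\<^sup>2 \<longleftrightarrow> s = crit1" unfolding u_def .
qed

lemma crit1_bounds: "0.23176263148 < crit1" "crit1 < 0.23176263154"
proof -
  have "(0.23176263148::real) \<le> crit1"
    by (rule crit1_poly(1)[THEN iffD1]) (simp_all add: power2_eq_square)
  moreover have "(0.23176263148::real) \<noteq> crit1"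
    using crit1_poly(2)[of "0.23176263148"] by (simp add: power2_eq_square)
  ultimately show "0.23176263148 < crit1" by linarith
  have "\<not> (0.23176263154::real) \<le> crit1"
    using crit1_poly(1)[of "0.23176263154"] by (simp add: power2_eq_square)
  then show "crit1 < 0.23176263154" by simp
qed

theorem theorem5p1:
  shows "\<exists>r0 r1 :: real.
     (0 < r0 \<and> r0 < 1 / 3 \<and> r0_equation r0 \<and>
        (\<forall>s. 0 < s \<and> s < 1 / 3 \<and> r0_equation s \<longrightarrow> s = r0)) \<and>
     (0 < r1 \<and> r1 < 1 / 3 \<and> r1_equation r1 \<and>
        (\<forall>s. 0 < s \<and> s < 1 / 3 \<and> r1_equation s \<longrightarrow> s = r1)) \<and>
     \<bar>r0 - 0.1622776602\<bar> < 1 / (2 * 10 ^ 10) \<and>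
     \<bar>r1 - 0.2317626315\<bar> < 1 / (2 * 10 ^ 10) \<and>
     (\<forall>(n::nat) (r::real) (P::real measure).
        2 \<le> n \<and> 0 < r \<and> r < 1 / 3 \<and> self_similar_distribution r P \<longrightarrow>
        (r \<le> r0 \<longrightarrow>
           (n = 2 \<longrightarrow> optimal_n_means P n (beta2 P r)) \<and>
           (3 \<le> n \<longrightarrow> (\<forall>I. admissible n I \<longrightarrow> optimal_n_means P n (beta P r n I)))) \<and>
        (r0 \<le> r \<and> r \<le> r1 \<longrightarrow>
           (n = 2 \<longrightarrow> optimal_n_means P n (gamma2 P r)) \<and>
           (3 \<le> n \<longrightarrow> (\<forall>I. admissible n I \<longrightarrow> optimal_n_means P n (gamma P r n I)))))"
proof (rule exI[of _ crit0], rule exI[of _ crit1], intro conjI allI impI)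
  note b0 = crit0_bounds and b1 = crit1_bounds
  show "0 < crit0" "crit0 < 1 / 3" "0 < crit1" "crit1 < 1 / 3" using b0 b1 by simp_all
  then show "r0_equation crit0" "r1_equation crit1"
    by (simp_all add: r0_equation_iff r1_equation_iff crit0_root_iff crit1_poly(2))
  show "s = crit0" if "0 < s \<and> s < 1 / 3 \<and> r0_equation s" for s
    using that r0_equation_iff[of s] crit0_root_iff[of s] by blast
  show "s = crit1" if "0 < s \<and> s < 1 / 3 \<and> r1_equation s" for s
    using that r1_equation_iff[of s] crit1_poly(2)[of s] by blast
  show "\<bar>crit0 - 0.1622776602\<bar> < 1 / (2 * 10 ^ 10)" using b0 unfolding abs_less_iff by simp
  show "\<bar>crit1 - 0.2317626315\<bar> < 1 / (2 * 10 ^ 10)" using b1 unfolding abs_less_iff by simp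
next
  fix n :: nat and r :: real and P :: "real measure"
  assume "2 \<le> n \<and> 0 < r \<and> r < 1 / 3 \<and> self_similar_distribution r P"
  then have r: "0 < r" "r < 1 / 3" "self_similar_distribution r P" by simp_all
  have small: "small_ratio r P" if "r \<le> crit1"
    using that r crit1_poly(1)[OF r(1)]
    by (simp add: small_ratio_def ratio_def self_similar_def)
  have le: "r \<le> crit1" if "r \<le> crit0" using that crit0_bounds crit1_bounds by simp
  have beta: "V P (beta2 P r) \<le> small_ratio.V2 r" if "r \<le> crit0"
    using small_ratio.V_beta2_le_V2[OF small[OF le[OF that]]] le_crit0_iff[OF r(1)] that by simp
  have gamma: "V P (gamma2 P r) \<le> small_ratio.V2 r" if "crit0 \<le> r \<and> r \<le> crit1"
    using small_ratio.V_gamma2_le_V2[OF small] ge_crit0_iff[OF r(1)] that by simp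
  show "optimal_n_means P n (beta2 P r)" if "r \<le> crit0" "n = 2"
    unfolding that(2)
    by (rule small_ratio.two_means_optimal[OF small[OF le[OF that(1)]] card_beta2_le beta[OF that(1)]])
  show "optimal_n_means P n (beta P r n I)" if "r \<le> crit0" "3 \<le> n" "admissible n I" for I
    unfolding beta_def
    by (rule small_ratio.theta_optimal[OF small[OF le[OF that(1)]] card_beta2_le beta[OF that(1)] that(2,3)])
  show "optimal_n_means P n (gamma2 P r)" if "crit0 \<le> r \<and> r \<le> crit1" "n = 2"
    unfolding that(2)
    by (rule small_ratio.two_means_optimal[OF small card_gamma2_le gamma[OF that(1)]]) (use that in simp)
  show "optimal_n_means P n (gamma P r n I)" if "crit0 \<le> r \<and> r \<le> crit1" "3 \<le> n" "admissible n I" for I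
    unfolding gamma_def
    by (rule small_ratio.theta_optimal[OF small card_gamma2_le gamma[OF that(1)] that(2,3)]) (use that in simp)
qed

end
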